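(* Let $(\mathsf{X},\mathsf{A},p,c)$ be a Markov decision process satisfying the assumptions (A1)--(A7) listed in the context, and let $\{K_n\}$, $\{\nu_n\}$ and the compact-state models c-MDP$_n$ be as described in the context, with average costs $V_n(\cdot,\cdot)$ and average-cost value functions $V_n^*$. Let $\{\varepsilon_n\}$ be positive reals converging to zero, and for each $n$ let $f_n$ be a deterministic stationary policy of c-MDP$_n$, obtained from the finite-state approximations of c-MDP$_n$, such that $$\sup_{x\in\mathsf{X}_n}|V_n(f_n,x)-V_n^*(x)|\le\varepsilon_n.$$ Denote also by $f_n$ its extension to $\mathsf{X}$, equal to $f_n$ on $K_n$ and to the constant $f_n(\Delta_n)$ on $K_n^c$. Then $$|\rho_{f_n}-V^*|\to0\quad\text{as }n\to\infty,$$ where $\rho_{f_n}$ is the average cost of $f_n$ in the original MDP and $V^*$ is the average-cost value function (a constant) of the original MDP.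
   Context: A Markov decision process (MDP) $(\mathsf{X},\mathsf{A},p,c)$ consists of Borel spaces $\mathsf{X}$ (states) and $\mathsf{A}$ (actions, all admissible in every state), a stochastic kernel $p(dy|x,a)$ on $\mathsf{X}$ given $\mathsf{X}\times\mathsf{A}$, and a measurable one-stage cost $c:\mathsf{X}\times\mathsf{A}\to\mathbb{R}$. A policy is a sequence of stochastic kernels on $\mathsf{A}$ given the histories; $\Pi$ is the set of all policies. A deterministic stationary policy is a measurable function $f$ from states to actions, applied as $a_t=f(x_t)$. The average cost is $V(\pi,x)=\limsup_{T\to\infty}\frac1T\mathbb{E}_x^\pi[\sum_{t=0}^{T-1}c(x_t,a_t)]$ and the value function is $V^*(x)=\inf_{\pi\in\Pi}V(\pi,x)$. Under the assumptions below each deterministic stationary $f$ induces a chain with unique invariant probability measure $\mu_f$, $V(f,x)=\rho_f:=\int c(y,f(y))\mu_f(dy)$ for all $x$, and $V^*$ is constant. Assumptions: (A1) $c$ is continuous. (A2) $\mathsf{X}$ is locally compact (and non-compact) and $\mathsf{A}$ is compact. (A3) There are $M\ge0$ and a continuous $w:\mathsf{X}\to[1,\infty)$ with $\sup_{a}|c(x,a)|\le Mw(x)$ for all $x$, and $\int w(y)p(dy|x,a)$ is continuous in $(x,a)$. Moreover there exist a probability measure $\eta$ on $\mathsf{X}$, a positive measurable function $\phi:\mathsf{X}\times\mathsf{A}\to(0,\infty)$ and $\alpha\in(0,1)$ such that for all $(x,a)$: (A4) $\int w(y)p(dy|x,a)\le\alpha w(x)+\eta(w)\phi(x,a)$, where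 $\eta(w)=\int w\,d\eta<\infty$. (A5) $p(D|x,a)\ge\eta(D)\phi(x,a)$ for all Borel $D\subset\mathsf{X}$. (A6) $\inf_{(x,a)\in K_n\times\mathsf{A}}\phi(x,a)>0$ for each $n\ge1$. (A7) $p(\cdot|x,a)$ is continuous in $(x,a)$ with respect to the $w$-norm $\|\vartheta\|_w=\sup\{|\int g\,d\vartheta|:\ |g|\le w\}$ of signed measures. $\{K_n\}$ is a nested sequence of compact subsets of $\mathsf{X}$ with $K_n\subset\operatorname{int}K_{n+1}$, $\mathsf{X}=\bigcup_nK_n$. $\{\nu_n\}$ is a sequence of probability measures with $\nu_n$ concentrated on $K_n^c$, $\gamma_n:=\int_{K_n^c}w\,d\nu_n<\infty$, and with $$\tau_n:=\max\Big\{0,\sup_{(x,a)\in\mathsf{X}\times\mathsf{A}}\int_{K_n^c}(\gamma_n-w(y))\,p(dy|x,a)\Big\},\qquad \varsigma_n:=\int_{K_n^c}w\,d\eta,$$ one has $\sup_n\tau_n<\infty$ and $\lim_{n\to\infty}(\tau_n+\varsigma_n)=0$. c-MDP$_n$ is the MDP with compact state space $\mathsf{X}_n=K_n\cup\{\Delta_n\}$, where $\Delta_n\in K_n^c$ is a pseudo-state (an isolated point of $\mathsf{X}_n$), action space $\mathsf{A}$, transition probability $p_n(\cdot|x,a)=p(\cdot\cap K_n|x,a)+p(K_n^c|x,a)\delta_{\Delta_n}$ for $x\in K_n$ and $p_n(\cdot|\Delta_n,a)=\int_{K_n^c}\big(p(\cdot\cap K_n|z,a)+p(K_n^c|z,a)\delta_{\Delta_n}\big)\nu_n(dz)$,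 and one-stage cost $c_n(x,a)=c(x,a)$ for $x\in K_n$, $c_n(\Delta_n,a)=\int_{K_n^c}c(z,a)\,\nu_n(dz)$. "Obtained from the finite-state approximations of c-MDP$_n$" means: choose a finite subset $\{z_1,\dots,z_k\}$ of $\mathsf{X}_n$ forming a sufficiently fine net, a measurable nearest-neighbour map $Q$ from $\mathsf{X}_n$ onto it with cells $\mathcal{S}_i=Q^{-1}(z_i)$, and a probability measure $\nu$ on $\mathsf{X}_n$ charging every cell; form the finite-state MDP with states $z_i$, actions $\mathsf{A}$, cost $\frac{1}{\nu(\mathcal{S}_i)}\int_{\mathcal{S}_i}c_n(z,a)\nu(dz)$ and transition probabilities $\frac{1}{\nu(\mathcal{S}_i)}\int_{\mathcal{S}_i}p_n(\mathcal{S}_j|z,a)\nu(dz)$; and take $f_n=f\circ Q$ with $f$ an average-cost optimal deterministic stationary policy of this finite-state MDP. *)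

theory Defs
  imports "HOL-Probability.Probability"
begin

section \<open>Markov decision processes, policies and average cost\<close>

text \<open>
  The state and action spaces are carried as measure spaces of which only the underlying
  sigma-algebra matters. This lets a process on a Borel space, on a compact subset of it and on a
  finite subset of it all live over the same state type. All actions are admissible in all states.
\<close>

record ('s, 'a) mdp =
  state_space :: "'s measure"
  action_space :: "'a measure"
  kernel :: "'s \<Rightarrow> 'a \<Rightarrow> 's measure"
  cost :: "'s \<Rightarrow> 'a \<Rightarrow> real"

definition is_mdp :: "('s, 'a) mdp \<Rightarrow> bool" where
  "is_mdp M \<longleftrightarrow>
     (\<lambda>(x, a). kernel M x a) \<in> state_space M \<Otimes>\<^sub>M action_space M \<rightarrow>\<^sub>M prob_algebra (state_space M) \<and>
     (\<lambda>(x, a). cost M x a) \<in> borel_measurable (state_space M \<Otimes>\<^sub>M action_space M)"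

abbreviation stage_space :: "('s, 'a) mdp \<Rightarrow> ('s \<times> 'a) measure" where
  "stage_space M \<equiv> state_space M \<Otimes>\<^sub>M action_space M"

text \<open>
  A history up to time t is a pair: the stages $(x_0,a_0),\dots,(x_{t-1},a_{t-1})$, as an
  extensional function on \<open>{0..<t}\<close>, together with the current state $x_t$.
\<close>

definition histories :: "('s, 'a) mdp \<Rightarrow> nat \<Rightarrow> ((nat \<Rightarrow> 's \<times> 'a) \<times> 's) measure" where
  "histories M t = PiM {0..<t} (\<lambda>_. stage_space M) \<Otimes>\<^sub>M state_space M"

type_synonym ('s, 'a) policy = "nat \<Rightarrow> (nat \<Rightarrow> 's \<times> 'a) \<times> 's \<Rightarrow> 'a measure"

definition policies :: "('s, 'a) mdp \<Rightarrow> ('s, 'a) policy set" where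
  "policies M = {\<pi>. \<forall>t. \<pi> t \<in> histories M t \<rightarrow>\<^sub>M prob_algebra (action_space M)}"

definition stationary_policies :: "('s, 'a) mdp \<Rightarrow> ('s \<Rightarrow> 'a) set" where
  "stationary_policies M = state_space M \<rightarrow>\<^sub>M action_space M"

definition stationary :: "('s, 'a) mdp \<Rightarrow> ('s \<Rightarrow> 'a) \<Rightarrow> ('s, 'a) policy" where
  "stationary M f = (\<lambda>t (h, x). return (action_space M) (f x))"

text \<open>Conditional law of $(x_t,a_t)$ given the previous stages \<open>h\<close>, when $x_0 = x$.\<close>

definition stage_kernel ::
    "('s, 'a) mdp \<Rightarrow> ('s, 'a) policy \<Rightarrow> 's \<Rightarrow> nat \<Rightarrow> (nat \<Rightarrow> 's \<times> 'a) \<Rightarrow> ('s \<times> 'a) measure" where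
  "stage_kernel M \<pi> x t h =
     (if t = 0 then return (state_space M) x else kernel M (fst (h (t - 1))) (snd (h (t - 1))))
       \<bind> (\<lambda>y. \<pi> t (h, y) \<bind> (\<lambda>a. return (stage_space M) (y, a)))"

text \<open>The measure $P_x^\pi$ on $(X \times A)^\infty$ of the Ionescu-Tulcea theorem.\<close>

definition path_measure ::
    "('s, 'a) mdp \<Rightarrow> ('s, 'a) policy \<Rightarrow> 's \<Rightarrow> (nat \<Rightarrow> 's \<times> 'a) measure" where
  "path_measure M \<pi> x =
     projective_family.lim UNIV
       (Ionescu_Tulcea.CI (stage_kernel M \<pi> x) (\<lambda>_. stage_space M)) (\<lambda>_. stage_space M)"

definition average_cost :: "('s, 'a) mdp \<Rightarrow> ('s, 'a) policy \<Rightarrow> 's \<Rightarrow> ereal" where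
  "average_cost M \<pi> x =
     limsup (\<lambda>T. ereal (1 / real T *
       (\<integral>\<omega>. (\<Sum>t<T. cost M (fst (\<omega> t)) (snd (\<omega> t))) \<partial>path_measure M \<pi> x)))"

definition value_function :: "('s, 'a) mdp \<Rightarrow> 's \<Rightarrow> ereal" where
  "value_function M x = (INF \<pi>\<in>policies M. average_cost M \<pi> x)"

definition invariant_prob :: "('s, 'a) mdp \<Rightarrow> ('s \<Rightarrow> 'a) \<Rightarrow> 's measure \<Rightarrow> bool" where
  "invariant_prob M f \<mu> \<longleftrightarrow>
     prob_space \<mu> \<and> sets \<mu> = sets (state_space M) \<and>
     (\<forall>D\<in>sets (state_space M). emeasure \<mu> D = (\<integral>\<^sup>+y. emeasure (kernel M y (f y)) D \<partial>\<mu>))"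

text \<open>Meaningful only if the invariant probability measure of \<open>f\<close> is unique.\<close>

definition ergodic_cost :: "('s, 'a) mdp \<Rightarrow> ('s \<Rightarrow> 'a) \<Rightarrow> real" where
  "ergodic_cost M f = (\<integral>y. cost M y (f y) \<partial>(THE \<mu>. invariant_prob M f \<mu>))"

lemma Ionescu_Tulcea_stage_kernel:
  assumes M: "is_mdp M" and \<pi>: "\<pi> \<in> policies M" and x: "x \<in> space (state_space M)"
  shows "Ionescu_Tulcea (stage_kernel M \<pi> x) (\<lambda>_. stage_space M)"
proof -
  let ?S = "state_space M" and ?A = "action_space M"
  have [measurable]: "(\<lambda>z. kernel M (fst z) (snd z)) \<in> stage_space M \<rightarrow>\<^sub>M prob_algebra ?S"
    using M by (simp add: is_mdp_def case_prod_beta')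
  have [measurable]: "\<pi> t \<in> PiM {0..<t} (\<lambda>_. stage_space M) \<Otimes>\<^sub>M ?S \<rightarrow>\<^sub>M prob_algebra ?A" for t
    using \<pi> by (simp add: policies_def histories_def)
  have x': "(\<lambda>h. return ?S x) \<in> H \<rightarrow>\<^sub>M prob_algebra ?S" for H :: "(nat \<Rightarrow> 'a \<times> 'b) measure"
    using x by simp
  have 1: "(\<lambda>h. if t = 0 then return ?S x
        else kernel M (fst (h (t - 1))) (snd (h (t - 1))))
      \<in> PiM {0..<t} (\<lambda>_. stage_space M) \<rightarrow>\<^sub>M prob_algebra ?S" for t :: nat
  proof (cases t)
    case 0
    then show ?thesis using x' by simp
  next
    case (Suc n)
    have "(\<lambda>h. h n) \<in> PiM {0..<Suc n} (\<lambda>_. stage_space M) \<rightarrow>\<^sub>M stage_space M"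
      by (rule measurable_component_singleton) simp
    from measurable_compose[OF this, of "\<lambda>z. kernel M (fst z) (snd z)"] Suc
    show ?thesis by simp
  qed
  have 2: "stage_kernel M \<pi> x t
      \<in> PiM {0..<t} (\<lambda>_. stage_space M) \<rightarrow>\<^sub>M prob_algebra (stage_space M)" for t
    unfolding stage_kernel_def[abs_def]
    by (rule measurable_bind_prob_space2[OF 1], unfold split_beta',
        rule measurable_bind_prob_space2[where N = ?A]) measurable
  show ?thesis
  proof (rule Ionescu_Tulcea.intro)
    show "stage_kernel M \<pi> x i
        \<in> PiM {0..<i} (\<lambda>_. stage_space M) \<rightarrow>\<^sub>M subprob_algebra (stage_space M)" for i :: nat
      by (rule measurable_prob_algebraD[OF 2])
    show "prob_space (stage_kernel M \<pi> x i h)"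
      if "h \<in> space (PiM {0..<i} (\<lambda>_. stage_space M))" for i :: nat and h
      using measurable_space[OF 2 that] by (simp add: space_prob_algebra)
  qed
qed

lemma stationary_in_policies:
  assumes "f \<in> stationary_policies M"
  shows "stationary M f \<in> policies M"
  using assms unfolding stationary_policies_def stationary_def policies_def histories_def
  by (auto simp: split_beta')


section \<open>The compact-state model\<close>

text \<open>
  The pseudo-state \<open>\<Delta>\<close> is a point outside \<open>K\<close>, so that $K \cup \{\Delta\}$ is a subset of the
  original state space; for compact \<open>K\<close>, \<open>\<Delta>\<close> is isolated in the subspace topology. A measure
  \<open>\<mu>\<close> is lumped to $\mu(\cdot \cap K) + \mu(K^c)\,\delta_\Delta$ by sending all of $K^c$
  to \<open>\<Delta>\<close>.
\<close>

definition lumped_space :: "'s measure \<Rightarrow> 's set \<Rightarrow> 's \<Rightarrow> 's measure" where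
  "lumped_space S K \<Delta> = restrict_space S (insert \<Delta> K)"

definition lump :: "'s measure \<Rightarrow> 's set \<Rightarrow> 's \<Rightarrow> 's measure \<Rightarrow> 's measure" where
  "lump S K \<Delta> \<mu> = distr \<mu> (lumped_space S K \<Delta>) (\<lambda>y. if y \<in> K then y else \<Delta>)"

definition compact_mdp ::
    "('s, 'a) mdp \<Rightarrow> 's set \<Rightarrow> 's \<Rightarrow> 's measure \<Rightarrow> ('s, 'a) mdp" where
  "compact_mdp M K \<Delta> \<nu> =
     \<lparr> state_space = lumped_space (state_space M) K \<Delta>,
       action_space = action_space M,
       kernel = (\<lambda>x a.
         if x \<in> K then lump (state_space M) K \<Delta> (kernel M x a)
         else \<nu> \<bind> (\<lambda>z. lump (state_space M) K \<Delta> (kernel M z a))),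
       cost = (\<lambda>x a. if x \<in> K then cost M x a else (LINT z:- K|\<nu>. cost M z a)) \<rparr>"

lemma measurable_lump_map:
  assumes "K \<in> sets S" "\<Delta> \<in> space S"
  shows "(\<lambda>y. if y \<in> K then y else \<Delta>) \<in> S \<rightarrow>\<^sub>M lumped_space S K \<Delta>"
  using assms unfolding lumped_space_def
  by (intro measurable_restrict_space2) auto

lemma sets_lumped_space:
  assumes "K \<in> sets S" "{\<Delta>} \<in> sets S"
  shows "sets (lumped_space S K \<Delta>) = {D \<in> sets S. D \<subseteq> insert \<Delta> K}"
proof -
  have "insert \<Delta> K \<in> sets S"
    using sets.Un[OF assms(2,1)] by simp
  then show ?thesis
    using sets.sets_into_space[of "insert \<Delta> K" S]
    unfolding lumped_space_def by (auto simp: sets_restrict_space_iff Int_absorb2)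
qed

lemma emeasure_lump:
  assumes K: "K \<in> sets S" and \<Delta>: "{\<Delta>} \<in> sets S" "\<Delta> \<notin> K"
    and \<mu>: "sets \<mu> = sets S" and D: "D \<in> sets (lumped_space S K \<Delta>)"
  shows "emeasure (lump S K \<Delta> \<mu>) D
       = emeasure \<mu> (D \<inter> K) + emeasure \<mu> (space S - K) * indicator D \<Delta>"
proof -
  have D': "D \<in> sets S" "D \<subseteq> insert \<Delta> K"
    using D by (auto simp: sets_lumped_space[OF K \<Delta>(1)])
  have sp: "space \<mu> = space S" using \<mu> by (rule sets_eq_imp_space_eq)
  have \<Delta>S: "\<Delta> \<in> space S" using sets.sets_into_space[OF \<Delta>(1)] by auto
  have "(\<lambda>y. if y \<in> K then y else \<Delta>) \<in> \<mu> \<rightarrow>\<^sub>M lumped_space S K \<Delta>"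
    using measurable_lump_map[OF K \<Delta>S] by (simp add: measurable_cong_sets[OF \<mu> refl])
  then have "emeasure (lump S K \<Delta> \<mu>) D
      = emeasure \<mu> ((\<lambda>y. if y \<in> K then y else \<Delta>) -` D \<inter> space \<mu>)"
    unfolding lump_def using D by (rule emeasure_distr)
  also have "(\<lambda>y. if y \<in> K then y else \<Delta>) -` D \<inter> space \<mu>
      = (D \<inter> K) \<union> (if \<Delta> \<in> D then space S - K else {})"
    using sets.sets_into_space[OF D'(1)] sp by (auto split: if_splits)
  also have "emeasure \<mu> \<dots> = emeasure \<mu> (D \<inter> K) + emeasure \<mu> (space S - K) * indicator D \<Delta>"
  proof (cases "\<Delta> \<in> D")
    case True
    have "emeasure \<mu> (D \<inter> K \<union> (space S - K)) = emeasure \<mu> (D \<inter> K) + emeasure \<mu> (space S - K)"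
      by (rule plus_emeasure[symmetric]) (use K D' \<mu> in auto)
    with True show ?thesis by simp
  qed simp
  finally show ?thesis .
qed

lemma measurable_lump:
  assumes "K \<in> sets S" "\<Delta> \<in> space S"
  shows "lump S K \<Delta> \<in> prob_algebra S \<rightarrow>\<^sub>M prob_algebra (lumped_space S K \<Delta>)"
  unfolding lump_def[abs_def]
  by (rule measurable_distr_prob_space[OF measurable_lump_map[OF assms]])

text \<open>
  The transition law from the pseudo-state:
  $\int_{K^c} \bigl(p(D \cap K|z,a) + p(K^c|z,a)\,\delta_\Delta(D)\bigr)\,\nu(dz)$.
\<close>

lemma emeasure_compact_mdp_pseudo_state:
  assumes M: "is_mdp M" and a: "a \<in> space (action_space M)"
    and K: "K \<in> sets (state_space M)" and \<Delta>: "{\<Delta>} \<in> sets (state_space M)" "\<Delta> \<notin> K"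
    and \<nu>: "prob_space \<nu>" "sets \<nu> = sets (state_space M)" "emeasure \<nu> K = 0"
    and D: "D \<in> sets (lumped_space (state_space M) K \<Delta>)"
  shows "emeasure (kernel (compact_mdp M K \<Delta> \<nu>) \<Delta> a) D =
    (\<integral>\<^sup>+z\<in>- K. (emeasure (kernel M z a) (D \<inter> K)
        + emeasure (kernel M z a) (space (state_space M) - K) * indicator D \<Delta>) \<partial>\<nu>)"
proof -
  let ?S = "state_space M"
  interpret \<nu>: prob_space \<nu> by fact
  have sp: "space \<nu> = space ?S" using \<nu>(2) by (rule sets_eq_imp_space_eq)
  have \<Delta>S: "\<Delta> \<in> space ?S" using sets.sets_into_space[OF \<Delta>(1)] by auto
  have [measurable]: "(\<lambda>z. kernel M (fst z) (snd z)) \<in> stage_space M \<rightarrow>\<^sub>M prob_algebra ?S"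
    using M by (simp add: is_mdp_def case_prod_beta')
  have "(\<lambda>z. (z, a)) \<in> ?S \<rightarrow>\<^sub>M stage_space M"
    using a by simp
  from measurable_compose[OF this, of "\<lambda>z. kernel M (fst z) (snd z)"]
  have k: "(\<lambda>z. kernel M z a) \<in> ?S \<rightarrow>\<^sub>M prob_algebra ?S" by simp
  have "(\<lambda>z. lump ?S K \<Delta> (kernel M z a)) \<in> \<nu> \<rightarrow>\<^sub>M prob_algebra (lumped_space ?S K \<Delta>)"
    using measurable_compose[OF k measurable_lump[OF K \<Delta>S]]
    by (simp add: measurable_cong_sets[OF \<nu>(2) refl])
  then have l: "(\<lambda>z. lump ?S K \<Delta> (kernel M z a)) \<in> \<nu> \<rightarrow>\<^sub>M subprob_algebra (lumped_space ?S K \<Delta>)"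
    by (rule measurable_prob_algebraD)
  have "emeasure (kernel (compact_mdp M K \<Delta> \<nu>) \<Delta> a) D
      = (\<integral>\<^sup>+z. emeasure (lump ?S K \<Delta> (kernel M z a)) D \<partial>\<nu>)"
    using \<Delta>(2) D by (simp add: compact_mdp_def emeasure_bind[OF \<nu>.not_empty l])
  also have "\<dots> = (\<integral>\<^sup>+z. (emeasure (kernel M z a) (D \<inter> K)
        + emeasure (kernel M z a) (space ?S - K) * indicator D \<Delta>) \<partial>\<nu>)"
  proof (rule nn_integral_cong)
    fix z assume "z \<in> space \<nu>"
    then have "sets (kernel M z a) = sets ?S"
      using measurable_space[OF k] sp by (simp add: space_prob_algebra)
    then show "emeasure (lump ?S K \<Delta> (kernel M z a)) D = emeasure (kernel M z a) (D \<inter> K)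
        + emeasure (kernel M z a) (space ?S - K) * indicator D \<Delta>"
      using emeasure_lump[OF K \<Delta> _ D] by blast
  qed
  also have "\<dots> = (\<integral>\<^sup>+z\<in>- K. (emeasure (kernel M z a) (D \<inter> K)
        + emeasure (kernel M z a) (space ?S - K) * indicator D \<Delta>) \<partial>\<nu>)"
  proof (rule nn_integral_cong_AE)
    have "AE z in \<nu>. z \<notin> K"
      using K \<nu> by (intro AE_not_in) (auto simp: null_sets_def)
    then show "AE z in \<nu>. emeasure (kernel M z a) (D \<inter> K)
          + emeasure (kernel M z a) (space ?S - K) * indicator D \<Delta>
        = (emeasure (kernel M z a) (D \<inter> K)
          + emeasure (kernel M z a) (space ?S - K) * indicator D \<Delta>) * indicator (- K) z"
      by eventually_elim simp
  qed
  finally show ?thesis .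
qed


section \<open>Finite-state approximations\<close>

definition cell :: "('s, 'a) mdp \<Rightarrow> ('s \<Rightarrow> 's) \<Rightarrow> 's \<Rightarrow> 's set" where
  "cell N Q z = Q -` {z} \<inter> space (state_space N)"

definition finite_mdp ::
    "('s, 'a) mdp \<Rightarrow> 's set \<Rightarrow> ('s \<Rightarrow> 's) \<Rightarrow> 's measure \<Rightarrow> ('s, 'a) mdp" where
  "finite_mdp N Z Q \<nu> =
     \<lparr> state_space = count_space Z,
       action_space = action_space N,
       kernel = (\<lambda>zi a. point_measure Z (\<lambda>zj.
         ennreal (1 / measure \<nu> (cell N Q zi) *
           (LINT z:cell N Q zi|\<nu>. measure (kernel N z a) (cell N Q zj))))),
       cost = (\<lambda>zi a. 1 / measure \<nu> (cell N Q zi) * (LINT z:cell N Q zi|\<nu>. cost N z a)) \<rparr>"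

text \<open>
  \<open>f = g \<circ> Q\<close> where \<open>g\<close> is optimal for the finite model built from a \<open>\<delta>\<close>-net \<open>Z\<close>. A
  nearest-neighbour map fixes every point of \<open>Z\<close>, hence is onto \<open>Z\<close>.
\<close>

definition finite_state_policy ::
    "('s::metric_space, 'a) mdp \<Rightarrow> real \<Rightarrow> ('s \<Rightarrow> 'a) \<Rightarrow> bool" where
  "finite_state_policy N \<delta> f \<longleftrightarrow>
     (\<exists>Z Q \<nu> g.
        finite Z \<and> Z \<noteq> {} \<and> Z \<subseteq> space (state_space N) \<and>
        (\<forall>x\<in>space (state_space N). \<exists>z\<in>Z. dist x z < \<delta>) \<and>
        Q \<in> state_space N \<rightarrow>\<^sub>M count_space Z \<and>
        (\<forall>x\<in>space (state_space N). \<forall>z\<in>Z. dist x (Q x) \<le> dist x z) \<and>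
        prob_space \<nu> \<and> sets \<nu> = sets (state_space N) \<and>
        (\<forall>z\<in>Z. measure \<nu> (cell N Q z) > 0) \<and>
        g \<in> stationary_policies (finite_mdp N Z Q \<nu>) \<and>
        (\<forall>z\<in>Z. average_cost (finite_mdp N Z Q \<nu>) (stationary (finite_mdp N Z Q \<nu>) g) z
               = value_function (finite_mdp N Z Q \<nu>) z) \<and>
        (\<forall>x\<in>space (state_space N). f x = g (Q x)))"


section \<open>The weighted norm distance of two measures\<close>

text \<open>$\|\mu - \mu'\|_w$; as an extended nonnegative real, so that the supremum always exists.\<close>

definition w_dist ::
    "('s::topological_space \<Rightarrow> real) \<Rightarrow> 's measure \<Rightarrow> 's measure \<Rightarrow> ennreal" where
  "w_dist w \<mu> \<mu>' =
     (SUP g\<in>{g \<in> borel_measurable borel. \<forall>y. \<bar>g y\<bar> \<le> w y}.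
        ennreal \<bar>(\<integral>y. g y \<partial>\<mu>) - (\<integral>y. g y \<partial>\<mu>')\<bar>)"

end

theory Submission 
  imports Defs
begin

text \<open>
  Subtracting the rank-one part \<open>\<phi> x a \<cdot> \<eta>\<close> from the transition law leaves a positive kernel that contracts
  the \<open>w\<close>-norm by \<open>\<alpha>\<close>. For a stationary policy with cost \<open>u\<close> let \<open>P\<close> be this kernel and \<open>R u = \<Sum>i. P\<^sup>i u\<close>;
  then the average cost is the quotient of the \<open>\<eta>\<close>-means of \<open>R u\<close> and \<open>R 1\<close>. The optimality equation is
  the fixed point of a contraction, once \<open>\<rho>\<close> is chosen so that this fixed point has \<open>\<eta>\<close>-mean zero.
  The Bellman operator preserves continuity because \<open>\<phi>\<close> may be replaced by the smaller function
  \<open>max 0 ((\<integral>w dp - \<alpha> w) / \<integral>w d\<eta>)\<close>, which is continuous and still satisfies (A4) and (A5).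

  For large \<open>n\<close> the compact models satisfy the same drift condition with modulus \<open>(1 + \<alpha>) / 2\<close> and with the
  weight that is \<open>w\<close> on \<open>K n\<close> and \<open>\<gamma> n\<close> at the pseudo-state. For policies that agree on \<open>K n\<close> the terms
  of the two series differ little, uniformly on compact sets, so the average costs in the two models
  differ by \<open>o(1)\<close>, and near-optimality in the compact model passes to the original one.
\<close>

subsection \<open>Chains with a minorization and a drift condition\<close>

text \<open>Probabilistically \<open>\<phi> x\<close> is a chance of regenerating from
  \<open>\<eta>\<close>, \<open>R u\<close> is the cost expected up to the next regeneration, and
  the quotient of \<open>\<eta>\<close>-means is the renewal-reward formula. The series avoids this:
  each application of \<open>P\<close> integrates against \<open>\<eta>\<close> and a law
  \<open>kernel M x a\<close>, and for \<open>x\<close> in a compact set these laws have, over all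
  actions, uniformly small \<open>w\<close>-tails. All estimates are therefore uniform over
  policies. The weight \<open>\<gamma> n\<close> of the pseudo-state may grow with \<open>n\<close>;
  \<open>\<tau> n\<close> bounds exactly its product with the mass outside \<open>K n\<close>, up to
  a tail of \<open>w\<close>. History-dependent policies are covered because \<open>w\<close> has
  bounded expectation over time under every policy. No exact minimiser is selected: comparison with
  an \<open>e\<close>-optimal stationary policy of the original model suffices.\<close>

definition sub_op :: "('s \<Rightarrow> 's measure) \<Rightarrow> 's measure \<Rightarrow> ('s \<Rightarrow> real) \<Rightarrow> ('s \<Rightarrow> real) \<Rightarrow> 's \<Rightarrow> real" where
  "sub_op k \<eta> \<phi> u x = (\<integral>y. u y \<partial>k x) - \<phi> x * (\<integral>y. u y \<partial>\<eta>)"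

definition resolvent :: "('s \<Rightarrow> 's measure) \<Rightarrow> 's measure \<Rightarrow> ('s \<Rightarrow> real) \<Rightarrow> ('s \<Rightarrow> real) \<Rightarrow> 's \<Rightarrow> real" where
  "resolvent k \<eta> \<phi> u x = (\<Sum>i. (sub_op k \<eta> \<phi> ^^ i) u x)"

definition mean_cost :: "('s \<Rightarrow> 's measure) \<Rightarrow> 's measure \<Rightarrow> ('s \<Rightarrow> real) \<Rightarrow> ('s \<Rightarrow> real) \<Rightarrow> real" where
  "mean_cost k \<eta> \<phi> u =
     (\<integral>x. resolvent k \<eta> \<phi> u x \<partial>\<eta>) / (\<integral>x. resolvent k \<eta> \<phi> (\<lambda>_. 1) x \<partial>\<eta>)"

text \<open>The setwise inequality says that \<open>\<nu>\<close> scaled by \<open>c\<close> lies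
  below \<open>\<mu>\<close>; this passes from sets to nonnegative integrands and later makes
  \<open>sub_op\<close> positive.\<close>

lemma nn_integral_mono_scaled_measure:
  assumes sets: "sets \<nu> = sets \<mu>" and c: "c \<ge> 0"
    and fin: "finite_measure \<nu>" "finite_measure \<mu>"
    and le: "\<And>D. D \<in> sets \<mu> \<Longrightarrow> measure \<nu> D * c \<le> measure \<mu> D"
    and u: "u \<in> borel_measurable \<mu>"
  shows "ennreal c * (\<integral>\<^sup>+y. u y \<partial>\<nu>) \<le> (\<integral>\<^sup>+y. u y \<partial>\<mu>)"
proof -
  interpret f1: finite_measure \<nu> by fact
  interpret f2: finite_measure \<mu> by fact
  have le': "ennreal c * emeasure \<nu> D \<le> emeasure \<mu> D" if "D \<in> sets \<mu>" for D
    using le[OF that] c unfolding f1.emeasure_eq_measure f2.emeasure_eq_measure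
    by (simp add: ennreal_mult[symmetric] mult.commute)
  have [measurable]: "u \<in> borel_measurable \<nu>" using u by (simp cong: measurable_cong_sets add: sets)
  have "ennreal c * (\<integral>\<^sup>+y. u y \<partial>\<nu>) = (\<integral>\<^sup>+y. u y \<partial>scale_measure (ennreal c) \<nu>)"
    by (simp add: nn_integral_scale_measure)
  also have "\<dots> \<le> (\<integral>\<^sup>+y. u y \<partial>\<mu>)"
    by (rule nn_integral_mono_measure) (use le' sets in \<open>auto simp: le_measure\<close>)
  finally show ?thesis .
qed

text \<open>\<open>\<phi>\<close> is required to be nonnegative only, since the continuous
  substitute for it is a positive part and may vanish.\<close>

locale drift_chain =
  fixes S :: "'s measure" and k :: "'s \<Rightarrow> 's measure" and w :: "'s \<Rightarrow> real"
    and \<eta> :: "'s measure" and \<phi> :: "'s \<Rightarrow> real" and \<alpha> :: real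
  assumes k: "k \<in> S \<rightarrow>\<^sub>M prob_algebra S"
    and w_meas [measurable]: "w \<in> borel_measurable S"
    and w_ge_1: "\<And>x. x \<in> space S \<Longrightarrow> 1 \<le> w x"
    and w_int: "\<And>x. x \<in> space S \<Longrightarrow> integrable (k x) w"
    and \<eta>: "\<eta> \<in> space (prob_algebra S)" and \<eta>_int: "integrable \<eta> w"
    and \<phi>_meas [measurable]: "\<phi> \<in> borel_measurable S"
    and \<phi>_nonneg: "\<And>x. x \<in> space S \<Longrightarrow> 0 \<le> \<phi> x"
    and \<alpha>: "0 < \<alpha>" "\<alpha> < 1"
    and minor: "\<And>x D. x \<in> space S \<Longrightarrow> D \<in> sets S \<Longrightarrow> measure \<eta> D * \<phi> x \<le> measure (k x) D"
    and drift: "\<And>x. x \<in> space S \<Longrightarrow> (\<integral>y. w y \<partial>k x) \<le> \<alpha> * w x + (\<integral>y. w y \<partial>\<eta>) * \<phi> x"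
begin

text \<open>The constant is kept explicit because its decay along powers of \<open>P\<close> is what
  makes the resolvent series converge.\<close>

definition wfun :: "real \<Rightarrow> ('s \<Rightarrow> real) \<Rightarrow> bool" where
  "wfun C u \<longleftrightarrow> u \<in> borel_measurable S \<and> (\<forall>x\<in>space S. \<bar>u x\<bar> \<le> C * w x)"

abbreviation "P \<equiv> sub_op k \<eta> \<phi>"
abbreviation "R \<equiv> resolvent k \<eta> \<phi>"

lemma k_sub [measurable]: "k \<in> S \<rightarrow>\<^sub>M subprob_algebra S"
  using k by (rule measurable_prob_algebraD)

lemma prob_k: "x \<in> space S \<Longrightarrow> prob_space (k x)"
  and sets_k [measurable_cong]: "x \<in> space S \<Longrightarrow> sets (k x) = sets S"
  and space_k: "x \<in> space S \<Longrightarrow> space (k x) = space S"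
  using measurable_space[OF k] by (auto simp: space_prob_algebra dest: sets_eq_imp_space_eq)

lemma prob_\<eta>: "prob_space \<eta>" and sets_\<eta> [measurable_cong]: "sets \<eta> = sets S"
  and space_\<eta>: "space \<eta> = space S"
  using \<eta> by (auto simp: space_prob_algebra dest: sets_eq_imp_space_eq)

lemma space_nonempty: "space S \<noteq> {}"
  using prob_space.not_empty[OF prob_\<eta>] space_\<eta> by simp

lemma wfun_nonneg: "wfun C u \<Longrightarrow> 0 \<le> C"
proof -
  assume a: "wfun C u"
  obtain x where x: "x \<in> space S" using space_nonempty by auto
  from a x have "0 \<le> C * w x" unfolding wfun_def using abs_ge_zero order_trans by blast
  with w_ge_1[OF x] show "0 \<le> C" by (simp add: zero_le_mult_iff)
qed

lemma wfunD: "wfun C u \<Longrightarrow> u \<in> borel_measurable S"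
    "wfun C u \<Longrightarrow> x \<in> space S \<Longrightarrow> \<bar>u x\<bar> \<le> C * w x"
  by (auto simp: wfun_def)

lemma wfun_w: "wfun 1 w"
  using w_ge_1 by (force simp: wfun_def)

lemma wfun_one: "wfun 1 (\<lambda>_. 1)"
  using w_ge_1 by (force simp: wfun_def)

lemma wfun_mono: "wfun C u \<Longrightarrow> C \<le> D \<Longrightarrow> wfun D u"
proof -
  assume u: "wfun C u" and CD: "C \<le> D"
  have "\<bar>u x\<bar> \<le> D * w x" if x: "x \<in> space S" for x
    by (rule order_trans[OF wfunD(2)[OF u x] mult_right_mono[OF CD]]) (use w_ge_1[OF x] in simp)
  with wfunD(1)[OF u] show "wfun D u" by (simp add: wfun_def)
qed

lemma wfun_add: "wfun C u \<Longrightarrow> wfun D v \<Longrightarrow> wfun (C + D) (\<lambda>x. u x + v x)"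
  unfolding wfun_def distrib_right
  by (auto intro: order_trans[OF abs_triangle_ineq] add_mono)

lemma wfun_diff: "wfun C u \<Longrightarrow> wfun D v \<Longrightarrow> wfun (C + D) (\<lambda>x. u x - v x)"
  unfolding wfun_def distrib_right
  by (auto intro: order_trans[OF abs_triangle_ineq4] add_mono)

lemma wfun_cmult: "wfun C u \<Longrightarrow> wfun (\<bar>a\<bar> * C) (\<lambda>x. a * u x)"
  by (auto simp: wfun_def abs_mult mult.assoc intro!: mult_left_mono)

lemma wfun_int_k:
  assumes u: "wfun C u" and x: "x \<in> space S" shows "integrable (k x) u"
proof (rule Bochner_Integration.integrable_bound[where f="\<lambda>y. C * w y"])
  show "integrable (k x) (\<lambda>y. C * w y)" using w_int[OF x] by simp
  show "u \<in> borel_measurable (k x)"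
    using wfunD(1)[OF u] by (simp cong: measurable_cong_sets add: sets_k[OF x])
  show "AE y in k x. norm (u y) \<le> norm (C * w y)"
    using wfunD(2)[OF u] by (intro AE_I2) (force simp: space_k[OF x])
qed

lemma wfun_int_\<eta>:
  assumes u: "wfun C u" shows "integrable \<eta> u"
proof (rule Bochner_Integration.integrable_bound[where f="\<lambda>y. C * w y"])
  show "integrable \<eta> (\<lambda>y. C * w y)" using \<eta>_int by simp
  show "u \<in> borel_measurable \<eta>"
    using wfunD(1)[OF u] by (simp cong: measurable_cong_sets add: sets_\<eta>)
  show "AE y in \<eta>. norm (u y) \<le> norm (C * w y)"
    using wfunD(2)[OF u] by (intro AE_I2) (force simp: space_\<eta>)
qed

lemma int_k_meas [measurable]: "(u :: _ \<Rightarrow> real) \<in> borel_measurable S \<Longrightarrow> (\<lambda>x. \<integral>y. u y \<partial>k x) \<in> borel_measurable S"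
  by (rule measurable_compose[OF k_sub integral_measurable_subprob_algebra])

lemma P_meas [measurable]: "u \<in> borel_measurable S \<Longrightarrow> P u \<in> borel_measurable S"
  unfolding sub_op_def[abs_def]
  by (intro borel_measurable_diff borel_measurable_times int_k_meas \<phi>_meas borel_measurable_const)

text \<open>By the minorization \<open>k x\<close> dominates \<open>\<phi> x\<close> times
  \<open>\<eta>\<close>, so subtracting the rank-one part leaves a positive measure.\<close>

lemma P_nonneg:
  assumes u: "wfun C u" "\<And>y. y \<in> space S \<Longrightarrow> 0 \<le> u y" and x: "x \<in> space S"
  shows "0 \<le> P u x"
proof -
  interpret k: prob_space "k x" by (rule prob_k[OF x])
  interpret e: prob_space \<eta> by (rule prob_\<eta>)
  have "ennreal (\<phi> x) * (\<integral>\<^sup>+y. ennreal (u y) \<partial>\<eta>) \<le> (\<integral>\<^sup>+y. ennreal (u y) \<partial>k x)"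
    by (rule nn_integral_mono_scaled_measure)
       (use x u wfunD(1)[OF u(1)] in \<open>auto simp: sets_\<eta> sets_k \<phi>_nonneg minor k.finite_measure_axioms e.finite_measure_axioms
          measurable_cong_sets[OF sets_k refl]\<close>)
  also have "(\<integral>\<^sup>+y. ennreal (u y) \<partial>\<eta>) = ennreal (\<integral>y. u y \<partial>\<eta>)"
    by (rule nn_integral_eq_integral) (use u wfun_int_\<eta> in \<open>auto simp: space_\<eta>\<close>)
  also have "(\<integral>\<^sup>+y. ennreal (u y) \<partial>k x) = ennreal (\<integral>y. u y \<partial>k x)"
    by (rule nn_integral_eq_integral) (use u x wfun_int_k in \<open>auto simp: space_k\<close>)
  also have "ennreal (\<phi> x) * ennreal (\<integral>y. u y \<partial>\<eta>) = ennreal (\<phi> x * (\<integral>y. u y \<partial>\<eta>))"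
    by (rule ennreal_mult[symmetric]) (use x u \<phi>_nonneg in \<open>auto intro!: integral_nonneg_AE AE_I2 simp: space_\<eta>\<close>)
  finally show ?thesis
    unfolding sub_op_def
    by (subst (asm) ennreal_le_iff) (use x u in \<open>auto intro!: integral_nonneg_AE AE_I2 simp: space_k\<close>)
qed

lemma P_add: "wfun C u \<Longrightarrow> wfun D v \<Longrightarrow> x \<in> space S \<Longrightarrow> P (\<lambda>y. u y + v y) x = P u x + P v x"
  by (simp add: sub_op_def wfun_int_k wfun_int_\<eta> algebra_simps)

lemma P_diff: "wfun C u \<Longrightarrow> wfun D v \<Longrightarrow> x \<in> space S \<Longrightarrow> P (\<lambda>y. u y - v y) x = P u x - P v x"
  by (simp add: sub_op_def wfun_int_k wfun_int_\<eta> algebra_simps)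

lemma P_cmult: "P (\<lambda>y. a * u y) x = a * P u x"
  by (simp add: sub_op_def algebra_simps)

lemma P_w: "x \<in> space S \<Longrightarrow> P w x \<le> \<alpha> * w x"
  using drift by (simp add: sub_op_def algebra_simps)

text \<open>Positivity applied to \<open>C * w + u\<close> and \<open>C * w - u\<close> bounds
  \<open>P u\<close> by \<open>C * P w\<close>, and the drift condition is precisely
  \<open>P w \<le> \<alpha> w\<close>.\<close>

lemma P_wfun:
  assumes u: "wfun C u" shows "wfun (\<alpha> * C) (P u)"
  unfolding wfun_def
proof safe
  show "P u \<in> borel_measurable S" using wfunD(1)[OF u] by simp
  fix x assume x: "x \<in> space S"
  have C: "0 \<le> C" by (rule wfun_nonneg[OF u])
  have cw: "wfun C (\<lambda>y. C * w y)" using wfun_cmult[OF wfun_w, of C] C by simp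
  have 1: "C * P w x \<le> C * (\<alpha> * w x)" using P_w[OF x] C by (intro mult_left_mono)
  have "0 \<le> P (\<lambda>y. C * w y + u y) x"
    by (rule P_nonneg[OF wfun_add[OF cw u] _ x]) (use wfunD(2)[OF u] in force)
  moreover have "0 \<le> P (\<lambda>y. C * w y - u y) x"
    by (rule P_nonneg[OF wfun_diff[OF cw u] _ x]) (use wfunD(2)[OF u] in force)
  ultimately show "\<bar>P u x\<bar> \<le> \<alpha> * C * w x"
    using 1 unfolding P_add[OF cw u x] P_diff[OF cw u x] P_cmult by (simp add: abs_le_iff mult_ac)
qed

lemma P_mono:
  assumes "wfun C u" "wfun D v" "\<And>y. y \<in> space S \<Longrightarrow> u y \<le> v y" "x \<in> space S"
  shows "P u x \<le> P v x"
  using P_nonneg[OF wfun_diff[OF assms(2,1)] _ assms(4)] assms by (simp add: P_diff[OF assms(2,1,4)])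

lemma
  assumes u: "\<And>i. wfun C (u i)" and lim: "\<And>y. y \<in> space S \<Longrightarrow> (\<lambda>i. u i y) \<longlonglongrightarrow> v y"
  shows int_k_lim: "x \<in> space S \<Longrightarrow> (\<lambda>i. \<integral>y. u i y \<partial>k x) \<longlonglongrightarrow> (\<integral>y. v y \<partial>k x)"
    and int_\<eta>_lim: "(\<lambda>i. \<integral>y. u i y \<partial>\<eta>) \<longlonglongrightarrow> (\<integral>y. v y \<partial>\<eta>)"
    and wfun_lim: "wfun C v"
proof -
  have um [measurable]: "u i \<in> borel_measurable S" for i using u wfunD by blast
  have v [measurable]: "v \<in> borel_measurable S"
    by (rule borel_measurable_LIMSEQ_real[OF lim um])
  show "wfun C v" unfolding wfun_def
  proof safe
    fix x assume x: "x \<in> space S"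
    show "\<bar>v x\<bar> \<le> C * w x"
      by (rule LIMSEQ_le_const2[OF tendsto_rabs[OF lim[OF x]]]) (use u x wfunD in blast)
  qed measurable
  show "(\<lambda>i. \<integral>y. u i y \<partial>\<eta>) \<longlonglongrightarrow> (\<integral>y. v y \<partial>\<eta>)"
    by (rule integral_dominated_convergence[where w="\<lambda>y. C * w y"])
       (use lim wfunD(2)[OF u] in \<open>auto simp: \<eta>_int space_\<eta> measurable_cong_sets[OF sets_\<eta> refl]\<close>)
  show "(\<lambda>i. \<integral>y. u i y \<partial>k x) \<longlonglongrightarrow> (\<integral>y. v y \<partial>k x)" if "x \<in> space S"
    by (rule integral_dominated_convergence[where w="\<lambda>y. C * w y"])
       (use that lim wfunD(2)[OF u] in \<open>auto simp: w_int space_k measurable_cong_sets[OF sets_k refl]\<close>)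
qed

lemma P_lim:
  assumes u: "\<And>i. wfun C (u i)" and lim: "\<And>y. y \<in> space S \<Longrightarrow> (\<lambda>i. u i y) \<longlonglongrightarrow> v y"
    and x: "x \<in> space S"
  shows "(\<lambda>i. P (u i) x) \<longlonglongrightarrow> P v x"
  unfolding sub_op_def by (intro tendsto_intros int_k_lim[OF u lim x] int_\<eta>_lim[OF u lim])

lemma P_pow_wfun: "wfun C u \<Longrightarrow> wfun (\<alpha> ^ i * C) ((P ^^ i) u)"
  by (induction i) (auto dest: P_wfun simp: mult.assoc)

lemma P_pow_lim:
  assumes u: "\<And>i. wfun C (u i)" and lim: "\<And>y. y \<in> space S \<Longrightarrow> (\<lambda>i. u i y) \<longlonglongrightarrow> v y"
    and x: "x \<in> space S"
  shows "(\<lambda>i. (P ^^ j) (u i) x) \<longlonglongrightarrow> (P ^^ j) v x"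
  using x
proof (induction j arbitrary: x)
  case (Suc j)
  show ?case by simp (rule P_lim[OF P_pow_wfun[OF u] Suc.IH Suc.prems])
qed (use lim in simp)

lemma P_pow_abs: "wfun C u \<Longrightarrow> x \<in> space S \<Longrightarrow> \<bar>(P ^^ i) u x\<bar> \<le> C * w x * \<alpha> ^ i"
  using wfunD(2)[OF P_pow_wfun] by (simp add: algebra_simps)

section \<open>The resolvent series and its equation\<close>

lemma summable_bound: "summable (\<lambda>i. c * \<alpha> ^ i)"
  using \<alpha> by (intro summable_mult summable_geometric) auto

lemma R_summable: "wfun C u \<Longrightarrow> x \<in> space S \<Longrightarrow> summable (\<lambda>i. (P ^^ i) u x)"
  by (rule summable_comparison_test'[OF summable_bound[of "C * w x"]]) (auto dest: P_pow_abs)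

text \<open>The bound does not depend on \<open>n\<close>, so the partial sums share a dominating
  function and limits may be taken under the integrals.\<close>

lemma R_partial_wfun:
  assumes "wfun C u" shows "wfun (C / (1 - \<alpha>)) (\<lambda>x. \<Sum>i<n. (P ^^ i) u x)"
  unfolding wfun_def
proof safe
  show "(\<lambda>x. \<Sum>i<n. (P ^^ i) u x) \<in> borel_measurable S"
    using wfunD(1)[OF P_pow_wfun[OF assms]] by simp
  fix x assume x: "x \<in> space S"
  have "\<bar>\<Sum>i<n. (P ^^ i) u x\<bar> \<le> (\<Sum>i<n. C * w x * \<alpha> ^ i)"
    by (rule order_trans[OF sum_abs sum_mono]) (rule P_pow_abs[OF assms x])
  also have "\<dots> \<le> (\<Sum>i. C * w x * \<alpha> ^ i)"
    using wfun_nonneg[OF assms] w_ge_1[OF x] \<alpha>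
    by (intro sum_le_suminf summable_bound) auto
  also have "\<dots> = C / (1 - \<alpha>) * w x"
    using \<alpha> by (simp add: suminf_mult summable_geometric suminf_geometric)
  finally show "\<bar>\<Sum>i<n. (P ^^ i) u x\<bar> \<le> C / (1 - \<alpha>) * w x" .
qed

lemma R_partial_lim: "wfun C u \<Longrightarrow> x \<in> space S \<Longrightarrow> (\<lambda>n. \<Sum>i<n. (P ^^ i) u x) \<longlonglongrightarrow> R u x"
  unfolding resolvent_def by (rule summable_LIMSEQ[OF R_summable])

lemma R_wfun: "wfun C u \<Longrightarrow> wfun (C / (1 - \<alpha>)) (R u)"
  by (rule wfun_lim[OF R_partial_wfun R_partial_lim])

lemma P_sum:
  assumes "\<And>i. wfun (C i) (u i)" and x: "x \<in> space S"
  shows "P (\<lambda>y. \<Sum>i<n. u i y) x = (\<Sum>i<n. P (u i) x)"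
  using assms(1)[THEN wfun_int_k[OF _ x]] assms(1)[THEN wfun_int_\<eta>]
  by (simp add: sub_op_def sum_subtractf sum_distrib_left)

text \<open>Shift of the series by one index: \<open>P\<close> of a partial sum is the next partial
  sum without its first term.\<close>

lemma R_eq:
  assumes u: "wfun C u" and x: "x \<in> space S"
  shows "R u x = u x + P (R u) x"
proof -
  have "(\<lambda>n. P (\<lambda>y. \<Sum>i<n. (P ^^ i) u y) x) \<longlonglongrightarrow> P (R u) x"
    by (rule P_lim[OF R_partial_wfun[OF u] R_partial_lim[OF u] x])
  moreover have "P (\<lambda>y. \<Sum>i<n. (P ^^ i) u y) x = (\<Sum>i<Suc n. (P ^^ i) u x) - u x" for n
    by (subst P_sum[OF P_pow_wfun[OF u] x])
       (simp only: sum.lessThan_Suc_shift, simp)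
  ultimately have "(\<lambda>n. (\<Sum>i<Suc n. (P ^^ i) u x) - u x) \<longlonglongrightarrow> P (R u) x" by simp
  moreover have "(\<lambda>n. (\<Sum>i<Suc n. (P ^^ i) u x) - u x) \<longlonglongrightarrow> R u x - u x"
    by (intro tendsto_intros LIMSEQ_Suc[OF R_partial_lim[OF u x]])
  ultimately have "P (R u) x = R u x - u x" by (rule LIMSEQ_unique)
  then show ?thesis by simp
qed

text \<open>Each use of the equation improves the bound \<open>C * w\<close> by a factor
  \<open>\<alpha>\<close>.\<close>

lemma P_fixed_zero:
  assumes v: "wfun C v" and eq: "\<And>x. x \<in> space S \<Longrightarrow> v x = P v x" and x: "x \<in> space S"
  shows "v x = 0"
proof -
  have "wfun (\<alpha> ^ i * C) v" for i
  proof (induction i)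
    case (Suc i)
    from P_wfun[OF Suc] show ?case
      using eq wfunD(1)[OF v] by (auto simp: wfun_def mult.assoc)
  qed (use v in simp)
  then have "\<bar>v x\<bar> \<le> C * w x * \<alpha> ^ i" for i
    using wfunD(2)[OF _ x, of "\<alpha> ^ i * C" v for i] by (simp add: mult_ac)
  moreover have "(\<lambda>i. C * w x * \<alpha> ^ i) \<longlonglongrightarrow> C * w x * 0"
    using \<alpha> by (intro tendsto_intros LIMSEQ_power_zero) auto
  ultimately have "\<bar>v x\<bar> \<le> 0" using LIMSEQ_le_const[of _ _ "\<bar>v x\<bar>"] by force
  then show ?thesis by simp
qed

text \<open>Serves to identify resolvents without rearranging series: it is enough to check that a
  candidate solves the equation.\<close>

lemma R_unique:
  assumes u: "wfun D u" and v: "wfun C v" and eq: "\<And>x. x \<in> space S \<Longrightarrow> v x = u x + P v x"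
    and x: "x \<in> space S"
  shows "v x = R u x"
proof -
  have "(\<lambda>x. v x - R u x) x = 0"
  proof (rule P_fixed_zero[OF wfun_diff[OF v R_wfun[OF u]] _ x])
    fix y assume y: "y \<in> space S"
    show "v y - R u y = P (\<lambda>x. v x - R u x) y"
      using eq[OF y] R_eq[OF u y] by (simp add: P_diff[OF v R_wfun[OF u] y])
  qed
  then show ?thesis by simp
qed

lemma R_add:
  assumes u: "wfun C u" and v: "wfun D v" and x: "x \<in> space S"
  shows "R (\<lambda>y. u y + v y) x = R u x + R v x"
  by (rule R_unique[symmetric, OF wfun_add[OF u v] wfun_add[OF R_wfun[OF u] R_wfun[OF v]] _ x])
     (simp add: P_add[OF R_wfun[OF u] R_wfun[OF v]] R_eq[OF u] R_eq[OF v])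

lemma R_cmult:
  assumes u: "wfun C u" and x: "x \<in> space S"
  shows "R (\<lambda>y. a * u y) x = a * R u x"
  by (rule R_unique[symmetric, OF wfun_cmult[OF u] wfun_cmult[OF R_wfun[OF u]] _ x])
     (simp add: P_cmult R_eq[OF u] algebra_simps)

lemma R_nonneg:
  assumes u: "wfun C u" "\<And>y. y \<in> space S \<Longrightarrow> 0 \<le> u y" and x: "x \<in> space S"
  shows "u x \<le> R u x"
proof -
  have "0 \<le> (P ^^ i) u y" if "y \<in> space S" for i y
    using that
  proof (induction i arbitrary: y)
    case (Suc i)
    then show ?case using P_nonneg[OF P_pow_wfun[OF u(1)]] by simp
  qed (use u in simp)
  then have "(\<Sum>i<1. (P ^^ i) u x) \<le> R u x"
    unfolding resolvent_def using x by (intro sum_le_suminf R_summable[OF u(1)]) auto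
  then show ?thesis by simp
qed

text \<open>Tannery's theorem exchanges the limit with the series; the majorant is geometric,
  uniformly along the sequence.\<close>

lemma R_lim:
  assumes u: "\<And>i. wfun C (u i)" and lim: "\<And>y. y \<in> space S \<Longrightarrow> (\<lambda>i. u i y) \<longlonglongrightarrow> v y"
    and x: "x \<in> space S"
  shows "(\<lambda>i. R (u i) x) \<longlonglongrightarrow> R v x"
proof -
  have "((\<lambda>n. suminf (\<lambda>j. (P ^^ j) (u n) x)) \<longlongrightarrow> suminf (\<lambda>j. (P ^^ j) v x)) sequentially"
    by (rule tannerys_theorem[where M="\<lambda>j. C * w x * \<alpha> ^ j", THEN conjunct2, THEN conjunct2])
       (use P_pow_lim[OF u lim x] P_pow_abs[OF u x] summable_bound in \<open>auto intro!: always_eventually\<close>)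
  then show ?thesis unfolding resolvent_def .
qed

lemma R_one_ge: "x \<in> space S \<Longrightarrow> 1 \<le> R (\<lambda>_. 1) x"
  using R_nonneg[OF wfun_one] by simp

text \<open>Keeps the denominator of \<open>mean_cost\<close> away from zero, with a bound that is
  the same for all chains.\<close>

lemma mean_R_one_ge: "1 \<le> (\<integral>x. R (\<lambda>_. 1) x \<partial>\<eta>)"
proof -
  interpret e: prob_space \<eta> by (rule prob_\<eta>)
  have "(\<integral>x. 1 \<partial>\<eta>) \<le> (\<integral>x. R (\<lambda>_. 1) x \<partial>\<eta>)"
    by (rule integral_mono[OF _ wfun_int_\<eta>[OF R_wfun[OF wfun_one]]]) (auto simp: space_\<eta> R_one_ge)
  then show ?thesis by (simp add: e.prob_space)
qed

text \<open>The normalisation \<open>\<eta> h = 0\<close> turns the equation for the sub-stochastic kernel into one for \<open>k\<close>.\<close>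

lemma poisson_equation:
  assumes u: "wfun C u"
  obtains h D where "wfun D h" "\<And>x. x \<in> space S \<Longrightarrow> mean_cost k \<eta> \<phi> u + h x = u x + (\<integral>y. h y \<partial>k x)"
proof -
  let ?r = "mean_cost k \<eta> \<phi> u"
  define h where "h x = R u x - ?r * R (\<lambda>_. 1) x" for x
  have w1: "wfun (\<bar>?r\<bar> * (1 / (1 - \<alpha>))) (\<lambda>x. ?r * R (\<lambda>_. 1) x)"
    by (rule wfun_cmult[OF R_wfun[OF wfun_one]])
  have wh: "wfun (C / (1 - \<alpha>) + \<bar>?r\<bar> * (1 / (1 - \<alpha>))) h"
    unfolding h_def by (rule wfun_diff[OF R_wfun[OF u] w1])
  have "(\<integral>x. h x \<partial>\<eta>) = (\<integral>x. R u x \<partial>\<eta>) - ?r * (\<integral>x. R (\<lambda>_. 1) x \<partial>\<eta>)"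
    unfolding h_def
    using wfun_int_\<eta>[OF R_wfun[OF u]] wfun_int_\<eta>[OF R_wfun[OF wfun_one]] by simp
  also have "\<dots> = 0" using mean_R_one_ge by (simp add: mean_cost_def)
  finally have 0: "(\<integral>x. h x \<partial>\<eta>) = 0" .
  have "?r + h x = u x + (\<integral>y. h y \<partial>k x)" if x: "x \<in> space S" for x
  proof -
    have "P h x = P (R u) x - ?r * P (R (\<lambda>_. 1)) x"
      unfolding h_def by (simp add: P_diff[OF R_wfun[OF u] w1 x] P_cmult)
    moreover have "P h x = (\<integral>y. h y \<partial>k x)" by (simp add: sub_op_def 0)
    ultimately show ?thesis
      using R_eq[OF u x] R_eq[OF wfun_one x] by (simp add: h_def algebra_simps)
  qed
  with wh show ?thesis using that by blast
qed

end

text \<open>Fubini for a composed kernel and an unbounded integrand: integrability of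
  \<open>w\<close> under each \<open>\<kappa> x\<close> and of a bound \<open>v\<close> on these
  means replace boundedness. It is applied to \<open>w\<close>-bounded functions along the process
  and, with constants for \<open>w\<close> and \<open>v\<close>, to bounded ones.\<close>

lemma integral_bind_dominated:
  fixes g w v :: "_ \<Rightarrow> real"
  assumes \<kappa>: "\<kappa> \<in> q \<rightarrow>\<^sub>M subprob_algebra B" and q: "space q \<noteq> {}"
    and g: "g \<in> borel_measurable B" and w: "w \<in> borel_measurable B"
    and gw: "\<And>y. y \<in> space B \<Longrightarrow> \<bar>g y\<bar> \<le> w y"
    and wi: "\<And>x. x \<in> space q \<Longrightarrow> integrable (\<kappa> x) w"
    and wv: "\<And>x. x \<in> space q \<Longrightarrow> (\<integral>y. w y \<partial>\<kappa> x) \<le> v x"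
    and v: "integrable q v"
  shows "integrable (q \<bind> \<kappa>) g" and "integrable q (\<lambda>x. \<integral>y. g y \<partial>\<kappa> x)"
    and "(\<integral>y. g y \<partial>(q \<bind> \<kappa>)) = (\<integral>x. (\<integral>y. g y \<partial>\<kappa> x) \<partial>q)"
proof -
  have sp: "space (\<kappa> x) = space B" and st: "sets (\<kappa> x) = sets B" if "x \<in> space q" for x
    using subprob_measurableD[OF \<kappa> that] by auto
  have w0: "0 \<le> w y" if "y \<in> space B" for y using gw[OF that] by linarith
  have wb: "0 \<le> (\<integral>y. w y \<partial>\<kappa> x)" if "x \<in> space q" for x
    by (rule integral_nonneg_AE) (auto simp: sp[OF that] w0)
  \<comment> \<open>The nonnegative case, where the identity comes from
    \<open>nn_integral_bind\<close> and finiteness from \<open>v\<close>. The signed case follows by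
    splitting \<open>g\<close> into its positive and negative parts.\<close>
  have *: "integrable (q \<bind> \<kappa>) h \<and> integrable q (\<lambda>x. \<integral>y. h y \<partial>\<kappa> x) \<and>
      (\<integral>y. h y \<partial>(q \<bind> \<kappa>)) = (\<integral>x. (\<integral>y. h y \<partial>\<kappa> x) \<partial>q)"
    if h [measurable]: "h \<in> borel_measurable B" and h0: "\<And>y. y \<in> space B \<Longrightarrow> 0 \<le> h y"
      and hw: "\<And>y. y \<in> space B \<Longrightarrow> h y \<le> w y" for h
  proof -
    have hi: "integrable (\<kappa> x) h" if x: "x \<in> space q" for x
      by (rule Bochner_Integration.integrable_bound[OF wi[OF x]])
        (use x h0 hw w0 h in \<open>auto simp: sp cong: measurable_cong_sets[OF st[OF x] refl]\<close>)
    have h_le: "(\<integral>y. h y \<partial>\<kappa> x) \<le> v x" if x: "x \<in> space q" for x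
      by (rule order_trans[OF integral_mono_AE[OF hi[OF x] wi[OF x]] wv[OF x]])
        (use hw in \<open>auto simp: sp[OF x]\<close>)
    have h_ge: "0 \<le> (\<integral>y. h y \<partial>\<kappa> x)" if "x \<in> space q" for x
      by (rule integral_nonneg_AE) (auto simp: sp[OF that] h0)
    have m: "(\<lambda>x. \<integral>y. h y \<partial>\<kappa> x) \<in> borel_measurable q"
      by (rule measurable_compose[OF \<kappa> integral_measurable_subprob_algebra[OF h]])
    have qi: "integrable q (\<lambda>x. \<integral>y. h y \<partial>\<kappa> x)"
      by (rule Bochner_Integration.integrable_bound[OF v m])
        (use h_le h_ge in \<open>auto intro!: AE_I2 intro: order_trans[OF _ abs_ge_self]\<close>)
    have "(\<integral>\<^sup>+y. ennreal (h y) \<partial>(q \<bind> \<kappa>)) = (\<integral>\<^sup>+x. \<integral>\<^sup>+y. ennreal (h y) \<partial>\<kappa> x \<partial>q)"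
      by (rule nn_integral_bind[OF _ \<kappa>]) measurable
    also have "\<dots> = (\<integral>\<^sup>+x. ennreal (\<integral>y. h y \<partial>\<kappa> x) \<partial>q)"
      by (rule nn_integral_cong, rule nn_integral_eq_integral) (use hi h0 in \<open>auto simp: sp\<close>)
    also have "\<dots> = ennreal (\<integral>x. (\<integral>y. h y \<partial>\<kappa> x) \<partial>q)"
      using h_ge by (intro nn_integral_eq_integral qi) auto
    finally have nn: "(\<integral>\<^sup>+y. ennreal (h y) \<partial>(q \<bind> \<kappa>)) = ennreal (\<integral>x. (\<integral>y. h y \<partial>\<kappa> x) \<partial>q)" .
    have sb: "sets (q \<bind> \<kappa>) = sets B" by (rule sets_bind[OF st q])
    have hb: "h \<in> borel_measurable (q \<bind> \<kappa>)" by (simp cong: measurable_cong_sets[OF sb refl])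
    have h0': "AE y in q \<bind> \<kappa>. 0 \<le> h y" using h0 sets_eq_imp_space_eq[OF sb] by auto
    have "0 \<le> (\<integral>x. (\<integral>y. h y \<partial>\<kappa> x) \<partial>q)" using h_ge by (intro integral_nonneg_AE) auto
    then show ?thesis
      using integrableI_nn_integral_finite[OF hb h0' nn] integral_eq_nn_integral[OF hb h0'] nn qi by simp
  qed
  note I = *[of "\<lambda>y. max 0 (g y)"] *[of "\<lambda>y. max 0 (- g y)"]
  have pm: "(\<lambda>y. max 0 (g y)) \<in> borel_measurable B" "(\<lambda>y. max 0 (- g y)) \<in> borel_measurable B"
    using g by measurable
  have pw: "max 0 (g y) \<le> w y" "max 0 (- g y) \<le> w y" if "y \<in> space B" for y
    using gw[OF that] by auto
  have dec: "(\<lambda>y. max 0 (g y) - max 0 (- g y)) = g" by (auto simp: max_def)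
  have ks: "(\<integral>y. g y \<partial>\<kappa> x) = (\<integral>y. max 0 (g y) \<partial>\<kappa> x) - (\<integral>y. max 0 (- g y) \<partial>\<kappa> x)" if x: "x \<in> space q" for x
  proof -
    have "integrable (\<kappa> x) g"
      by (rule Bochner_Integration.integrable_bound[OF wi[OF x]])
        (use x g in \<open>auto simp: sp cong: measurable_cong_sets[OF st[OF x] refl] intro!: AE_I2 order_trans[OF gw abs_ge_self]\<close>)
    then show ?thesis by (subst Bochner_Integration.integral_diff[symmetric]) (auto simp: dec)
  qed
  note I1 = I(1)[OF pm(1) _ pw(1)] and I2 = I(2)[OF pm(2) _ pw(2)]
  show "integrable (q \<bind> \<kappa>) g"
    using Bochner_Integration.integrable_diff[OF I1[THEN conjunct1] I2[THEN conjunct1]] by (simp add: dec)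
  show "integrable q (\<lambda>x. \<integral>y. g y \<partial>\<kappa> x)"
    using Bochner_Integration.integrable_diff[of q, OF I1[THEN conjunct2, THEN conjunct1] I2[THEN conjunct2, THEN conjunct1]]
    by (simp add: ks cong: Bochner_Integration.integrable_cong)
  have "(\<integral>y. g y \<partial>(q \<bind> \<kappa>)) = (\<integral>y. max 0 (g y) \<partial>(q \<bind> \<kappa>)) - (\<integral>y. max 0 (- g y) \<partial>(q \<bind> \<kappa>))"
    by (subst Bochner_Integration.integral_diff[symmetric]) (use I1 I2 in \<open>auto simp: dec\<close>)
  also have "\<dots> = (\<integral>x. (\<integral>y. max 0 (g y) \<partial>\<kappa> x) - (\<integral>y. max 0 (- g y) \<partial>\<kappa> x) \<partial>q)"
    using I1 I2 by simp
  also have "\<dots> = (\<integral>x. (\<integral>y. g y \<partial>\<kappa> x) \<partial>q)"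
    by (rule Bochner_Integration.integral_cong) (simp_all add: ks)
  finally show "(\<integral>y. g y \<partial>(q \<bind> \<kappa>)) = (\<integral>x. (\<integral>y. g y \<partial>\<kappa> x) \<partial>q)" .
qed

context drift_chain
begin

section \<open>The average cost as an invariant positive functional\<close>

abbreviation "L \<equiv> mean_cost k \<eta> \<phi>"

lemma L_add: "wfun C u \<Longrightarrow> wfun D v \<Longrightarrow> L (\<lambda>y. u y + v y) = L u + L v"
proof -
  assume u: "wfun C u" and v: "wfun D v"
  have "(\<integral>x. R (\<lambda>y. u y + v y) x \<partial>\<eta>) = (\<integral>x. R u x + R v x \<partial>\<eta>)"
    by (rule Bochner_Integration.integral_cong) (auto simp: R_add[OF u v] space_\<eta>)
  also have "\<dots> = (\<integral>x. R u x \<partial>\<eta>) + (\<integral>x. R v x \<partial>\<eta>)"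
    by (rule Bochner_Integration.integral_add[OF wfun_int_\<eta>[OF R_wfun[OF u]] wfun_int_\<eta>[OF R_wfun[OF v]]])
  finally show ?thesis by (simp add: mean_cost_def add_divide_distrib)
qed

lemma L_cmult: "wfun C u \<Longrightarrow> L (\<lambda>y. a * u y) = a * L u"
proof -
  assume u: "wfun C u"
  have "(\<integral>x. R (\<lambda>y. a * u y) x \<partial>\<eta>) = (\<integral>x. a * R u x \<partial>\<eta>)"
    by (rule Bochner_Integration.integral_cong) (auto simp: R_cmult[OF u] space_\<eta>)
  then show ?thesis by (simp add: mean_cost_def)
qed

lemma L_one: "L (\<lambda>_. 1) = 1"
  using mean_R_one_ge by (simp add: mean_cost_def)

lemma L_nonneg:
  assumes "wfun C u" "\<And>y. y \<in> space S \<Longrightarrow> 0 \<le> u y" shows "0 \<le> L u"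
proof -
  have "0 \<le> (\<integral>x. R u x \<partial>\<eta>)"
    by (rule integral_nonneg_AE, rule AE_I2)
      (use R_nonneg[OF assms] assms(2) in \<open>auto simp: space_\<eta> intro: order_trans\<close>)
  then show ?thesis using mean_R_one_ge by (simp add: mean_cost_def)
qed

lemma L_lim:
  assumes u: "\<And>i. wfun C (u i)" and lim: "\<And>y. y \<in> space S \<Longrightarrow> (\<lambda>i. u i y) \<longlonglongrightarrow> v y"
  shows "(\<lambda>i. L (u i)) \<longlonglongrightarrow> L v"
  unfolding mean_cost_def
  by (intro tendsto_divide tendsto_const int_\<eta>_lim[OF R_wfun[OF u] R_lim[OF u lim]])
    (use mean_R_one_ge in auto)

lemma \<phi>_eq: "x \<in> space S \<Longrightarrow> \<phi> x = 1 - P (\<lambda>_. 1) x"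
  by (simp add: sub_op_def prob_space.prob_space[OF prob_k] prob_space.prob_space[OF prob_\<eta>]
      flip: space_k[of x] space_\<eta>)

lemma \<phi>_le_one: "x \<in> space S \<Longrightarrow> \<phi> x \<le> 1"
  using \<phi>_eq[of x] P_nonneg[OF wfun_one, of x] by simp

lemma wfun_\<phi>: "wfun 1 \<phi>"
  unfolding wfun_def using \<phi>_le_one \<phi>_nonneg w_ge_1 by (force intro: order_trans)

text \<open>The constant 1 solves \<open>v = \<phi> + P v\<close>, because \<open>\<phi>\<close> is
  the mass that \<open>P\<close> loses. In terms of regeneration: it occurs with probability
  one.\<close>

lemma R_\<phi>: "x \<in> space S \<Longrightarrow> R \<phi> x = 1"
  using R_unique[OF wfun_\<phi> wfun_one, of x] \<phi>_eq by simp

lemma wfun_int_k_fun: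
  assumes u: "wfun C u"
  shows "wfun (\<alpha> * C + \<bar>\<integral>y. u y \<partial>\<eta>\<bar> * 1) (\<lambda>x. \<integral>y. u y \<partial>k x)"
proof -
  have "(\<lambda>x. \<integral>y. u y \<partial>k x) = (\<lambda>x. P u x + (\<integral>y. u y \<partial>\<eta>) * \<phi> x)"
    by (auto simp: sub_op_def)
  then show ?thesis using wfun_add[OF P_wfun[OF u] wfun_cmult[OF wfun_\<phi>]] by simp
qed

text \<open>Invariance of \<open>L\<close>. The kernel is \<open>P\<close> plus the rank-one part;
  with \<open>R (P u) = R u - u\<close> and \<open>R \<phi> = 1\<close> the two correction terms
  have opposite \<open>\<eta>\<close>-means.\<close>

lemma L_kernel:
  assumes u: "wfun C u" shows "L (\<lambda>x. \<integral>y. u y \<partial>k x) = L u"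
proof -
  have e: "(\<lambda>x. \<integral>y. u y \<partial>k x) = (\<lambda>x. P u x + (\<integral>y. u y \<partial>\<eta>) * \<phi> x)"
    by (auto simp: sub_op_def)
  have RP: "R (P u) x = R u x - u x" if "x \<in> space S" for x
    by (rule R_unique[symmetric, OF P_wfun[OF u] wfun_diff[OF R_wfun[OF u] u] _ that])
       (simp add: P_diff[OF R_wfun[OF u] u] R_eq[OF u])
  have "R (\<lambda>x. \<integral>y. u y \<partial>k x) x = R u x - u x + (\<integral>y. u y \<partial>\<eta>)" if x: "x \<in> space S" for x
    unfolding e
    by (simp add: R_add[OF P_wfun[OF u] wfun_cmult[OF wfun_\<phi>] x] R_cmult[OF wfun_\<phi> x] RP[OF x] R_\<phi>[OF x])
  then have "(\<integral>x. R (\<lambda>x. \<integral>y. u y \<partial>k x) x \<partial>\<eta>) = (\<integral>x. R u x - u x + (\<integral>y. u y \<partial>\<eta>) \<partial>\<eta>)"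
    by (intro Bochner_Integration.integral_cong) (auto simp: space_\<eta>)
  also have "\<dots> = (\<integral>x. R u x \<partial>\<eta>)"
  proof -
    interpret e: prob_space \<eta> by (rule prob_\<eta>)
    show ?thesis using wfun_int_\<eta>[OF u] wfun_int_\<eta>[OF R_wfun[OF u]] by (simp add: e.prob_space)
  qed
  finally show ?thesis by (simp add: mean_cost_def)
qed

text \<open>Apply the positive functional \<open>L\<close> to the inequality: the two terms in
  \<open>h\<close> cancel by invariance, and constants are preserved.\<close>

lemma L_le:
  assumes u: "wfun C u" and h: "wfun D h"
    and le: "\<And>x. x \<in> space S \<Longrightarrow> u x + (\<integral>y. h y \<partial>k x) \<le> \<rho> + h x"
  shows "L u \<le> \<rho>"
proof -
  let ?Ph = "\<lambda>x. \<integral>y. h y \<partial>k x"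
  note w1 = wfun_add[OF wfun_cmult[OF wfun_one, of \<rho>] h]
    and w2 = wfun_cmult[OF wfun_add[OF u wfun_int_k_fun[OF h]], of "- 1"]
  have "0 \<le> (\<rho> * 1 + h x) + - 1 * (u x + ?Ph x)" if "x \<in> space S" for x
    using le[OF that] by simp
  then have "0 \<le> L (\<lambda>x. (\<rho> * 1 + h x) + - 1 * (u x + ?Ph x))"
    by (rule L_nonneg[OF wfun_add[OF w1 w2]])
  also have "\<dots> = \<rho> - L u"
    by (simp only: L_add[OF w1 w2] L_add[OF wfun_cmult[OF wfun_one] h] L_cmult[OF wfun_one] L_one
        L_cmult[OF wfun_add[OF u wfun_int_k_fun[OF h]]] L_add[OF u wfun_int_k_fun[OF h]] L_kernel[OF h]) simp
  finally show ?thesis by simp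
qed

section \<open>The invariant probability measure\<close>

definition invariant :: "'s measure \<Rightarrow> bool" where
  "invariant \<mu> \<longleftrightarrow> prob_space \<mu> \<and> sets \<mu> = sets S \<and>
     (\<forall>D\<in>sets S. emeasure \<mu> D = (\<integral>\<^sup>+y. emeasure (k y) D \<partial>\<mu>))"

lemma wfun_indicator: "D \<in> sets S \<Longrightarrow> wfun 1 (indicator D)"
  using w_ge_1 by (force simp: wfun_def split: split_indicator)

text \<open>\<open>L\<close> is positive, normalised and continuous under dominated pointwise
  limits, so its values on indicators form a probability measure that represents it.\<close>

lemma invariant_exists:
  obtains \<mu> where "invariant \<mu>"
    "\<And>u C. u \<in> borel_measurable S \<Longrightarrow> (\<And>x. 0 \<le> u x) \<Longrightarrow> wfun C u \<Longrightarrow> (\<integral>\<^sup>+x. ennreal (u x) \<partial>\<mu>) = ennreal (L u)"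
proof -
  define \<mu> where "\<mu> = measure_of (space S) (sets S) (\<lambda>D. ennreal (L (indicator D)))"
  have sets_\<mu>: "sets \<mu> = sets S" by (simp add: \<mu>_def)
  have em: "emeasure \<mu> D = ennreal (L (indicator D))" if "D \<in> sets S" for D
  proof (rule emeasure_measure_of[OF \<mu>_def])
    have "L (\<lambda>_. 0) = 0" using L_cmult[OF wfun_one, of 0] by simp
    then show "positive (sets \<mu>) (\<lambda>D. ennreal (L (indicator D)))"
      by (simp add: positive_def indicator_def[abs_def])
    show "countably_additive (sets \<mu>) (\<lambda>D. ennreal (L (indicator D)))"
      unfolding countably_additive_def
    proof safe
      fix A :: "nat \<Rightarrow> 's set"
      assume A: "range A \<subseteq> sets \<mu>" and dis: "disjoint_family A"
      have [measurable]: "A i \<in> sets S" for i using A sets_\<mu> by auto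
      \<comment> \<open>Finite additivity; countable additivity is then \<open>L_lim\<close> along
        the increasing partial unions.\<close>
      have eq: "(\<Sum>i<n. L (indicator (A i))) = L (indicator (\<Union>i<n. A i))" for n
      proof (induction n)
        case 0
        show ?case using \<open>L (\<lambda>_. 0) = 0\<close> by (simp add: indicator_def[abs_def])
      next
        case (Suc n)
        have "A n \<inter> (\<Union>i<n. A i) = {}"
          using dis by (auto simp: disjoint_family_on_def) (metis Int_iff empty_iff less_irrefl)
        then have "(indicator (\<Union>i<Suc n. A i) :: _ \<Rightarrow> real) =
            (\<lambda>y. indicator (\<Union>i<n. A i) y + indicator (A n) y)"
          by (intro ext) (auto simp: lessThan_Suc split: split_indicator)
        then show ?case
          using L_add[OF wfun_indicator[of "\<Union>i<n. A i"] wfun_indicator[of "A n"]] Suc by simp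
      qed
      have lim: "(\<lambda>n. L (indicator (\<Union>i<n. A i))) \<longlonglongrightarrow> L (indicator (\<Union>i. A i))"
        by (rule L_lim[OF wfun_indicator LIMSEQ_indicator_UN]) measurable
      have "(\<lambda>i. L (indicator (A i))) sums L (indicator (\<Union>i. A i))"
        using lim unfolding sums_def eq[symmetric] .
      moreover have "0 \<le> L (indicator (A i))" for i by (rule L_nonneg[OF wfun_indicator]) auto
      ultimately show "(\<Sum>i. ennreal (L (indicator (A i)))) = ennreal (L (indicator (\<Union>i. A i)))"
        by (intro suminf_ennreal_eq)
    qed
  qed (use that sets.space_closed sets_\<mu> in auto)
  have nn: "(\<integral>\<^sup>+x. ennreal (u x) \<partial>\<mu>) = ennreal (L u)"
    if "u \<in> borel_measurable S" "\<And>x. 0 \<le> u x" "wfun C u" for u C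
    using that
  proof (induction arbitrary: C rule: borel_measurable_induct_real)
    case (set A)
    then show ?case by (simp add: ennreal_indicator sets_\<mu> em)
  next
    case (mult u c)
    show ?case
    proof (cases "c = 0")
      case True
      then show ?thesis using L_cmult[OF wfun_one, of 0] by simp
    next
      case False
      have u: "wfun (\<bar>1/c\<bar> * C) u" using wfun_cmult[OF mult.prems, of "1/c"] False by simp
      have [measurable]: "u \<in> borel_measurable \<mu>"
        using mult(2) by (simp cong: measurable_cong_sets[OF sets_\<mu> refl])
      show ?thesis using mult L_cmult[OF u] L_nonneg[OF u]
        by (simp add: ennreal_mult nn_integral_cmult mult.IH[OF u])
    qed
  next
    case (add u v)
    \<comment> \<open>Both summands are nonnegative, so each inherits the bound on the sum and the
      induction hypotheses apply.\<close>
    have "\<bar>u x\<bar> \<le> C * w x" "\<bar>v x\<bar> \<le> C * w x" if "x \<in> space S" for x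
      using wfunD(2)[OF add.prems that] add.hyps(2,4)[of x] by auto
    then have u: "wfun C u" and v: "wfun C v"
      using add.hyps(1,3) by (auto simp: wfun_def)
    have [measurable]: "u \<in> borel_measurable \<mu>" "v \<in> borel_measurable \<mu>"
      using add by (simp_all cong: measurable_cong_sets[OF sets_\<mu> refl])
    show ?case using add L_add[OF v u] L_nonneg[OF u] L_nonneg[OF v]
      by (simp add: nn_integral_add add.IH(1)[OF u] add.IH(2)[OF v])
  next
    case (seq U)
    have le: "U i x \<le> u x" if "x \<in> space S" for i x
      using incseq_le[OF _ seq.hyps(4)[OF that], of i] seq.hyps(3) by (auto simp: incseq_def le_fun_def)
    have U: "wfun C (U i)" for i
      unfolding wfun_def
    proof safe
      fix x assume x: "x \<in> space S"
      show "\<bar>U i x\<bar> \<le> C * w x"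
        using seq.hyps(2)[of i x] le[OF x, of i] wfunD(2)[OF seq.prems x] by linarith
    qed (rule seq.hyps(1))
    have m: "U i \<in> borel_measurable \<mu>" for i
      using seq.hyps(1) by (simp cong: measurable_cong_sets[OF sets_\<mu> refl])
    have sp: "space \<mu> = space S" by (rule sets_eq_imp_space_eq[OF sets_\<mu>])
    \<comment> \<open>The approximations are known to converge only on \<open>space S\<close>,
      whereas \<open>nn_integral_LIMSEQ\<close> asks for convergence at every point; off the space
      all functions are therefore set to zero.\<close>
    have cut: "(\<integral>\<^sup>+x. ennreal (if x \<in> space S then v x else 0) \<partial>\<mu>) = (\<integral>\<^sup>+x. ennreal (v x) \<partial>\<mu>)" for v
      by (rule nn_integral_cong) (simp add: sp)
    have "(\<lambda>i. \<integral>\<^sup>+x. ennreal (if x \<in> space S then U i x else 0) \<partial>\<mu>) \<longlonglongrightarrow>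
        (\<integral>\<^sup>+x. ennreal (if x \<in> space S then u x else 0) \<partial>\<mu>)"
    proof (rule nn_integral_LIMSEQ)
      show "incseq (\<lambda>i x. ennreal (if x \<in> space S then U i x else 0))"
        using seq.hyps(3) by (auto simp: incseq_def le_fun_def intro!: ennreal_leI)
      show "(\<lambda>x. ennreal (if x \<in> space S then U i x else 0)) \<in> borel_measurable \<mu>" for i
        using m[of i] unfolding sp[symmetric] by measurable
      show "(\<lambda>i. ennreal (if x \<in> space S then U i x else 0)) \<longlonglongrightarrow>
          ennreal (if x \<in> space S then u x else 0)" for x
        using seq.hyps(4)[of x] by (auto intro!: tendsto_ennrealI)
    qed
    then have "(\<lambda>i. \<integral>\<^sup>+x. ennreal (U i x) \<partial>\<mu>) \<longlonglongrightarrow> (\<integral>\<^sup>+x. ennreal (u x) \<partial>\<mu>)"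
      unfolding cut .
    moreover have "(\<lambda>i. \<integral>\<^sup>+x. ennreal (U i x) \<partial>\<mu>) \<longlonglongrightarrow> ennreal (L u)"
      using tendsto_ennrealI[OF L_lim[OF U seq.hyps(4)]] by (simp add: seq.IH[OF U])
    ultimately show ?case by (rule LIMSEQ_unique)
  qed
  have "emeasure \<mu> (space \<mu>) = 1"
  proof -
    have "emeasure \<mu> (space \<mu>) = (\<integral>\<^sup>+x. ennreal 1 \<partial>\<mu>)" by simp
    also have "\<dots> = 1" by (subst nn[OF _ _ wfun_one]) (auto simp: L_one)
    finally show ?thesis .
  qed
  then have "prob_space \<mu>" by (rule prob_spaceI)
  moreover have "emeasure \<mu> D = (\<integral>\<^sup>+y. emeasure (k y) D \<partial>\<mu>)" if D: "D \<in> sets S" for D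
  proof -
    note w = wfun_int_k_fun[OF wfun_indicator[OF D]]
    have "(\<integral>\<^sup>+y. emeasure (k y) D \<partial>\<mu>) = (\<integral>\<^sup>+y. ennreal (measure (k y) D) \<partial>\<mu>)"
      by (rule nn_integral_cong)
        (simp add: finite_measure.emeasure_eq_measure[OF prob_space.finite_measure[OF prob_k]]
          sets_eq_imp_space_eq[OF sets_\<mu>])
    also have "\<dots> = (\<integral>\<^sup>+y. ennreal (\<integral>z. indicator D z \<partial>k y) \<partial>\<mu>)"
      by (rule nn_integral_cong) (use D sets.sets_into_space[OF D] in
          \<open>simp add: sets_eq_imp_space_eq[OF sets_\<mu>] sets_k space_k Int_absorb2\<close>)
    also have "\<dots> = ennreal (L (\<lambda>y. \<integral>z. indicator D z \<partial>k y))"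
      by (rule nn[OF wfunD(1)[OF w] _ w]) (auto intro!: integral_nonneg_AE)
    finally show ?thesis using em[OF D] L_kernel[OF wfun_indicator[OF D]] by simp
  qed
  ultimately have "invariant \<mu>" using sets_\<mu> by (simp add: invariant_def)
  then show ?thesis using that nn by blast
qed

lemma invariant_bind: "invariant \<mu> \<Longrightarrow> \<mu> = \<mu> \<bind> k"
proof (rule measure_eqI)
  assume i: "invariant \<mu>"
  then have st: "sets \<mu> = sets S" and sp: "space \<mu> = space S"
    by (auto simp: invariant_def dest: sets_eq_imp_space_eq)
  have k': "k \<in> \<mu> \<rightarrow>\<^sub>M subprob_algebra S" using k_sub by (simp cong: measurable_cong_sets[OF st refl])
  show "sets \<mu> = sets (\<mu> \<bind> k)" using sets_bind[of \<mu> k S] by (simp add: st sp sets_k space_nonempty)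
  fix D assume "D \<in> sets \<mu>"
  then show "emeasure \<mu> D = emeasure (\<mu> \<bind> k) D"
    using i emeasure_bind[OF _ k', of D] by (simp add: st sp space_nonempty invariant_def)
qed

text \<open>Bounded functions suffice for uniqueness, so that no integrability of \<open>w\<close> is needed here: with
  \<open>m\<close> the \<open>\<mu>\<close>-mean of \<open>\<phi>\<close>, invariance makes the \<open>\<mu>\<close>-mean of \<open>P\<^sup>i u\<close> drop by \<open>m\<close> times the \<open>\<eta>\<close>-mean of
  \<open>P\<^sup>i u\<close> at each step, and it tends to zero.\<close>

lemma invariant_integral_bounded:
  assumes i: "invariant \<mu>" and u [measurable]: "u \<in> borel_measurable S"
    and u01: "\<And>x. x \<in> space S \<Longrightarrow> 0 \<le> u x \<and> u x \<le> 1"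
  shows "(\<integral>x. u x \<partial>\<mu>) = (\<integral>x. \<phi> x \<partial>\<mu>) * (\<integral>x. R u x \<partial>\<eta>)"
proof -
  interpret prob_space \<mu> using i by (simp add: invariant_def)
  have st [measurable_cong]: "sets \<mu> = sets S" and sp: "space \<mu> = space S"
    using i by (auto simp: invariant_def dest: sets_eq_imp_space_eq)
  have k': "k \<in> \<mu> \<rightarrow>\<^sub>M subprob_algebra S" using k_sub by (simp cong: measurable_cong_sets[OF st refl])
  have wu: "wfun 1 u" using u u01 w_ge_1 by (force simp: wfun_def)
  note wP = P_pow_wfun[OF wu]
  have a [measurable]: "(P ^^ j) u \<in> borel_measurable S" for j by (rule wfunD(1)[OF wP])
  \<comment> \<open>Since \<open>P\<close> is positive and maps 1 to
    \<open>1 - \<phi> \<le> 1\<close>, the iterates remain in the unit interval; constants then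
    serve as dominating functions under any invariant \<open>\<mu>\<close>.\<close>
  have a01: "\<bar>(P ^^ j) u x\<bar> \<le> 1" if "x \<in> space S" for j x
  proof -
    have "0 \<le> (P ^^ j) u x \<and> (P ^^ j) u x \<le> 1" using that
    proof (induction j arbitrary: x)
      case (Suc j)
      then show ?case
        using P_nonneg[OF wP, of j x] P_mono[OF wP wfun_one, of j x] \<phi>_eq[of x] \<phi>_nonneg[of x] by simp
    qed (use u01 in simp)
    then show ?thesis by simp
  qed
  have c1: "integrable (k x) (\<lambda>_. 1 :: real)" "(\<integral>y. 1 \<partial>k x) \<le> (1 :: real)" if "x \<in> space \<mu>" for x
  proof -
    interpret kx: prob_space "k x" using that prob_k sp by simp
    show "integrable (k x) (\<lambda>_. 1 :: real)" "(\<integral>y. 1 \<partial>k x) \<le> (1 :: real)" by (simp_all add: kx.prob_space)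
  qed
  note bd = integral_bind_dominated(2-3)[OF k' not_empty a borel_measurable_const a01 c1
      finite_measure.integrable_const[OF finite_measure_axioms]]
  have \<phi>i: "integrable \<mu> \<phi>"
    by (rule integrable_const_bound[of _ 1]) (use \<phi>_le_one \<phi>_nonneg in \<open>auto simp: sp\<close>)
  have step: "(\<integral>x. (P ^^ Suc j) u x \<partial>\<mu>) = (\<integral>x. (P ^^ j) u x \<partial>\<mu>) - (\<integral>x. \<phi> x \<partial>\<mu>) * (\<integral>x. (P ^^ j) u x \<partial>\<eta>)" for j
    using bd(1)[of j] bd(2)[of j] \<phi>i unfolding invariant_bind[OF i, symmetric]
    by (simp add: sub_op_def[abs_def])
  have "(\<integral>x. (P ^^ n) u x \<partial>\<mu>) = (\<integral>x. u x \<partial>\<mu>) - (\<integral>x. \<phi> x \<partial>\<mu>) * (\<integral>x. (\<Sum>j<n. (P ^^ j) u x) \<partial>\<eta>)" for n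
  proof (induction n)
    case (Suc n)
    then show ?case unfolding step using wfun_int_\<eta>[OF wP] by (simp add: distrib_left)
  qed simp
  moreover have "(\<lambda>n. (\<integral>x. u x \<partial>\<mu>) - (\<integral>x. \<phi> x \<partial>\<mu>) * (\<integral>x. (\<Sum>j<n. (P ^^ j) u x) \<partial>\<eta>))
      \<longlonglongrightarrow> (\<integral>x. u x \<partial>\<mu>) - (\<integral>x. \<phi> x \<partial>\<mu>) * (\<integral>x. R u x \<partial>\<eta>)"
    by (intro tendsto_intros int_\<eta>_lim[OF R_partial_wfun[OF wu] R_partial_lim[OF wu]])
  moreover have "(\<lambda>n. \<integral>x. (P ^^ n) u x \<partial>\<mu>) \<longlonglongrightarrow> (\<integral>x. 0 \<partial>\<mu>)"
  proof (rule integral_dominated_convergence[where w="\<lambda>_. 1"])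
    show "AE x in \<mu>. (\<lambda>n. (P ^^ n) u x) \<longlonglongrightarrow> 0"
      using summable_LIMSEQ_zero[OF R_summable[OF wu]] by (auto simp: sp)
  qed (use a01 in \<open>auto simp: sp\<close>)
  ultimately show ?thesis using LIMSEQ_unique by fastforce
qed

text \<open>The case \<open>u = 1\<close> determines the \<open>\<mu>\<close>-mean of
  \<open>\<phi>\<close> as the reciprocal of the \<open>\<eta>\<close>-mean of \<open>R 1\<close>,
  so the formula for indicators leaves no freedom.\<close>

lemma invariant_unique: "invariant \<mu> \<Longrightarrow> invariant \<mu>' \<Longrightarrow> \<mu> = \<mu>'"
proof (rule measure_eqI)
  assume i: "invariant \<mu>" "invariant \<mu>'"
  then show "sets \<mu> = sets \<mu>'" by (simp add: invariant_def)
  fix D assume "D \<in> sets \<mu>"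
  then have D: "D \<in> sets S" using i by (simp add: invariant_def)
  have "emeasure \<nu> D = ennreal (L (indicator D))" if \<nu>: "invariant \<nu>" for \<nu>
  proof -
    interpret prob_space \<nu> using \<nu> by (simp add: invariant_def)
    have sp: "space \<nu> = space S" using \<nu> by (auto simp: invariant_def dest: sets_eq_imp_space_eq)
    have "(\<integral>x. \<phi> x \<partial>\<nu>) * (\<integral>x. R (\<lambda>_. 1) x \<partial>\<eta>) = 1"
      using invariant_integral_bounded[OF \<nu>, of "\<lambda>_. 1"] prob_space by simp
    moreover have "measure \<nu> D = (\<integral>x. \<phi> x \<partial>\<nu>) * (\<integral>x. R (indicator D) x \<partial>\<eta>)"
      using invariant_integral_bounded[OF \<nu>, of "indicator D"] D sets.sets_into_space[OF D]
      by (simp add: sp Int_absorb2)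
    ultimately have "measure \<nu> D = L (indicator D)"
      using mean_R_one_ge by (simp add: mean_cost_def eq_divide_eq mult_ac)
    then show ?thesis by (simp add: emeasure_eq_measure)
  qed
  from this[OF i(1)] this[OF i(2)] show "emeasure \<mu> D = emeasure \<mu>' D" by simp
qed

text \<open>The representation of \<open>L\<close> covers nonnegative functions; signed ones are
  split, and uniqueness evaluates the definite description.\<close>

lemma integral_the_invariant:
  assumes u: "wfun C u" shows "(\<integral>x. u x \<partial>(THE \<mu>. invariant \<mu>)) = L u"
proof -
  obtain \<mu> where \<mu>: "invariant \<mu>"
    and nn: "\<And>u C. u \<in> borel_measurable S \<Longrightarrow> (\<And>x. 0 \<le> u x) \<Longrightarrow> wfun C u \<Longrightarrow> (\<integral>\<^sup>+x. ennreal (u x) \<partial>\<mu>) = ennreal (L u)"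
    using invariant_exists by blast
  have st: "sets \<mu> = sets S" using \<mu> by (simp add: invariant_def)
  have I: "integrable \<mu> v \<and> (\<integral>x. v x \<partial>\<mu>) = L v" if v: "wfun C v" "\<And>x. 0 \<le> v x" for v
  proof -
    have vm: "v \<in> borel_measurable \<mu>" using wfunD(1)[OF v(1)] by (simp cong: measurable_cong_sets[OF st refl])
    have e: "(\<integral>\<^sup>+x. ennreal (v x) \<partial>\<mu>) = ennreal (L v)" by (rule nn[OF wfunD(1)[OF v(1)] v(2,1)])
    then show ?thesis
      using integrableI_nn_integral_finite[OF vm _ e] integral_eq_nn_integral[OF vm] L_nonneg[OF v] v(2) e by simp
  qed
  have "\<bar>max 0 (u x)\<bar> \<le> C * w x \<and> \<bar>max 0 (- u x)\<bar> \<le> C * w x" if "x \<in> space S" for x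
    using wfunD(2)[OF u that] by (simp add: max_def abs_if split: if_splits)
  then have w: "wfun C (\<lambda>x. max 0 (u x))" "wfun C (\<lambda>x. max 0 (- u x))"
    using wfunD(1)[OF u] by (simp_all add: wfun_def)
  have dec: "(\<lambda>x. max 0 (u x) - max 0 (- u x)) = u" by (auto simp: max_def)
  have "(\<integral>x. u x \<partial>\<mu>) = (\<integral>x. max 0 (u x) \<partial>\<mu>) - (\<integral>x. max 0 (- u x) \<partial>\<mu>)"
    by (subst Bochner_Integration.integral_diff[symmetric]) (use I[OF w(1)] I[OF w(2)] in \<open>auto simp: dec\<close>)
  also have "\<dots> = L (\<lambda>x. max 0 (u x)) + L (\<lambda>x. - 1 * max 0 (- u x))"
    using I[OF w(1)] I[OF w(2)] L_cmult[OF w(2), of "- 1"] by simp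
  also have "\<dots> = L u" using L_add[OF w(1) wfun_cmult[OF w(2), of "- 1"]] by (simp add: dec)
  finally show ?thesis using the_equality[of invariant, OF \<mu> invariant_unique[OF _ \<mu>]] by simp
qed

end

subsection \<open>Marginals of the controlled process\<close>

locale controlled_process =
  fixes M :: "('s, 'a) mdp" and \<pi> :: "('s, 'a) policy" and x :: 's
  assumes mdp: "is_mdp M" and pol: "\<pi> \<in> policies M" and x: "x \<in> space (state_space M)"
begin

sublocale IT: Ionescu_Tulcea "stage_kernel M \<pi> x" "\<lambda>_. stage_space M"
  by (rule Ionescu_Tulcea_stage_kernel[OF mdp pol x])

lemma kernel_meas [measurable]:
  "(\<lambda>z. kernel M (fst z) (snd z)) \<in> stage_space M \<rightarrow>\<^sub>M prob_algebra (state_space M)"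
  using mdp by (simp add: is_mdp_def case_prod_beta')

lemma path_measure_eq: "path_measure M \<pi> x = IT.PF.lim"
  by (simp add: path_measure_def)

lemma sets_path [measurable_cong]: "sets (path_measure M \<pi> x) = sets (PiM UNIV (\<lambda>_. stage_space M))"
  by (simp add: path_measure_eq)

lemma coordinate_meas: "(\<lambda>\<omega>. \<omega> t) \<in> path_measure M \<pi> x \<rightarrow>\<^sub>M stage_space M"
  by (simp cong: measurable_cong_sets[OF sets_path refl])

text \<open>The projection to no coordinates at all has a probability measure as its image, and a
  measure with such an image has total mass one itself.\<close>

lemma prob_path: "prob_space (path_measure M \<pi> x)"
proof -
  have "prob_space (distr IT.PF.lim (PiM {} (\<lambda>_. stage_space M)) (\<lambda>\<omega>. restrict \<omega> {}))"
    by (subst IT.distr_lim) (auto intro: IT.PF.prob_space_P)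
  then show ?thesis unfolding path_measure_eq
    by (rule prob_space_distrD[rotated]) (simp cong: measurable_cong_sets[OF IT.PF.sets_lim refl] add: measurable_restrict)
qed

text \<open>A functional of the first \<open>n\<close> stages can be computed in the finite
  composition \<open>IT.C 0 n\<close>, where the kernels are peeled off one at a time.\<close>

lemma nn_integral_restrict_path:
  assumes F [measurable]: "F \<in> borel_measurable (PiM {0..<n} (\<lambda>_. stage_space M))"
  shows "(\<integral>\<^sup>+\<omega>. F (restrict \<omega> {0..<n}) \<partial>path_measure M \<pi> x) = (\<integral>\<^sup>+\<omega>. F \<omega> \<partial>IT.C 0 n (\<lambda>_. undefined))"
proof -
  have u: "(\<lambda>_. undefined) \<in> space (PiM {0..<0::nat} (\<lambda>_. stage_space M))" by (simp add: space_PiM)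
  have m: "(\<lambda>\<omega>. restrict \<omega> {0..<n}) \<in> path_measure M \<pi> x \<rightarrow>\<^sub>M PiM {0..<n} (\<lambda>_. stage_space M)"
    by (simp cong: measurable_cong_sets[OF sets_path refl] add: measurable_restrict)
  \<comment> \<open>Finite projections are indexed by the least number beyond the index set; for an
    initial segment this is its length.\<close>
  have up: "IT.up_to {0..<n} = n" unfolding IT.up_to_def
  proof (rule Least_equality)
    fix y assume "\<forall>i\<ge>y. i \<notin> {0..<n}"
    then have "y \<notin> {0..<n}" by blast
    then show "n \<le> y" by simp
  qed simp
  have mC: "(\<lambda>\<omega>. restrict \<omega> {0..<n}) \<in> IT.C 0 n (\<lambda>_. undefined) \<rightarrow>\<^sub>M PiM {0..<n} (\<lambda>_. stage_space M)"
    using IT.sets_C[OF u, of n] by (simp cong: measurable_cong_sets add: measurable_restrict)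
  have "(\<integral>\<^sup>+\<omega>. F (restrict \<omega> {0..<n}) \<partial>path_measure M \<pi> x)
      = (\<integral>\<^sup>+\<omega>. F \<omega> \<partial>distr (path_measure M \<pi> x) (PiM {0..<n} (\<lambda>_. stage_space M)) (\<lambda>\<omega>. restrict \<omega> {0..<n}))"
    by (rule nn_integral_distr[symmetric, OF m]) simp
  also have "\<dots> = (\<integral>\<^sup>+\<omega>. F \<omega> \<partial>IT.CI {0..<n})"
    by (simp add: path_measure_eq IT.distr_lim)
  also have "\<dots> = (\<integral>\<^sup>+\<omega>. F (restrict \<omega> {0..<n}) \<partial>IT.C 0 n (\<lambda>_. undefined))"
    unfolding IT.CI_def up by (rule nn_integral_distr[OF mC]) simp
  also have "\<dots> = (\<integral>\<^sup>+\<omega>. F \<omega> \<partial>IT.C 0 n (\<lambda>_. undefined))"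
    by (rule nn_integral_cong) (simp add: IT.space_C[OF u] space_PiM extensional_restrict PiE_restrict)
  finally show ?thesis .
qed

text \<open>One-step disintegration: the last kernel is split off in the finite composition, and the
  outer integral is then carried back to the path space.\<close>

lemma nn_integral_coordinate:
  assumes g [measurable]: "g \<in> borel_measurable (stage_space M)"
  shows "(\<integral>\<^sup>+\<omega>. g (\<omega> t) \<partial>path_measure M \<pi> x)
    = (\<integral>\<^sup>+\<omega>. (\<integral>\<^sup>+z. g z \<partial>stage_kernel M \<pi> x t (restrict \<omega> {0..<t})) \<partial>path_measure M \<pi> x)"
proof -
  have u: "(\<lambda>_. undefined) \<in> space (PiM {0..<0::nat} (\<lambda>_. stage_space M))" by (simp add: space_PiM)
  have gt: "(\<lambda>\<omega>. g (\<omega> t)) \<in> borel_measurable (PiM {0..<Suc t} (\<lambda>_. stage_space M))"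
    by (rule measurable_compose[where f="\<lambda>\<omega>. \<omega> t", OF _ g]) (rule measurable_component_singleton, simp)
  have G: "(\<lambda>h. \<integral>\<^sup>+z. g z \<partial>stage_kernel M \<pi> x t h) \<in> borel_measurable (PiM {0..<t} (\<lambda>_. stage_space M))"
    by (rule measurable_compose[OF IT.P nn_integral_measurable_subprob_algebra[OF g]])
  have eP: "IT.eP t \<in> IT.C 0 t (\<lambda>_. undefined) \<rightarrow>\<^sub>M subprob_algebra (PiM {0..<Suc t} (\<lambda>_. stage_space M))"
    using IT.measurable_eP[of t] IT.sets_C[OF u, of t] by (simp cong: measurable_cong_sets)
  have "(\<integral>\<^sup>+\<omega>. g (\<omega> t) \<partial>path_measure M \<pi> x) = (\<integral>\<^sup>+\<omega>. g (restrict \<omega> {0..<Suc t} t) \<partial>path_measure M \<pi> x)"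
    by simp
  also have "\<dots> = (\<integral>\<^sup>+\<omega>. g (\<omega> t) \<partial>IT.C 0 (Suc t) (\<lambda>_. undefined))"
    by (rule nn_integral_restrict_path[OF gt])
  also have "\<dots> = (\<integral>\<^sup>+\<omega>. (\<integral>\<^sup>+\<omega>'. g (\<omega>' t) \<partial>IT.eP t \<omega>) \<partial>IT.C 0 t (\<lambda>_. undefined))"
    using nn_integral_bind[OF gt eP] by simp
  also have "\<dots> = (\<integral>\<^sup>+\<omega>. (\<integral>\<^sup>+z. g z \<partial>stage_kernel M \<pi> x t \<omega>) \<partial>IT.C 0 t (\<lambda>_. undefined))"
    by (rule nn_integral_cong) (simp add: IT.space_C[OF u] IT.nn_integral_eP[OF _ gt])
  also have "\<dots> = (\<integral>\<^sup>+\<omega>. (\<integral>\<^sup>+z. g z \<partial>stage_kernel M \<pi> x t (restrict \<omega> {0..<t})) \<partial>path_measure M \<pi> x)"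
    by (rule nn_integral_restrict_path[symmetric, OF G])
  finally show ?thesis .
qed

text \<open>Expected costs are sums over stages, so these one-stage laws carry all the information
  used about the process.\<close>

definition marginal :: "nat \<Rightarrow> ('s \<times> 'a) measure" where
  "marginal t = distr (path_measure M \<pi> x) (stage_space M) (\<lambda>\<omega>. \<omega> t)"

lemma sets_marginal [simp, measurable_cong]: "sets (marginal t) = sets (stage_space M)"
  by (simp add: marginal_def)

lemma space_marginal [simp]: "space (marginal t) = space (stage_space M)"
  by (simp add: marginal_def)

lemma prob_marginal: "prob_space (marginal t)"
  unfolding marginal_def by (rule prob_space.prob_space_distr[OF prob_path coordinate_meas])

lemma nn_integral_marginal:
  assumes g: "g \<in> borel_measurable (stage_space M)"
  shows "(\<integral>\<^sup>+z. g z \<partial>marginal t) = (\<integral>\<^sup>+\<omega>. g (\<omega> t) \<partial>path_measure M \<pi> x)"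
  unfolding marginal_def by (rule nn_integral_distr[OF coordinate_meas]) (use g in simp)

text \<open>The first factor of \<open>stage_kernel\<close>, that is, the law of the state before
  the action is drawn.\<close>

definition current_law :: "nat \<Rightarrow> (nat \<Rightarrow> 's \<times> 'a) \<Rightarrow> 's measure" where
  "current_law t h = (if t = 0 then return (state_space M) x else kernel M (fst (h (t - 1))) (snd (h (t - 1))))"

lemma current_law_space:
  assumes h: "h \<in> space (PiM {0..<t} (\<lambda>_. stage_space M))"
  shows "current_law t h \<in> space (prob_algebra (state_space M))"
proof (cases t)
  case 0
  then show ?thesis using x by (simp add: current_law_def space_prob_algebra prob_space_return)
next
  case (Suc n)
  then have "h n \<in> space (stage_space M)" using h by (auto simp: space_PiM PiE_iff)
  from measurable_space[OF kernel_meas this] Suc show ?thesis by (simp add: current_law_def)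
qed

lemma policy_meas: "(\<lambda>y. \<pi> t (h, y)) \<in> state_space M \<rightarrow>\<^sub>M prob_algebra (action_space M)"
  if h: "h \<in> space (PiM {0..<t} (\<lambda>_. stage_space M))"
proof -
  have p: "\<pi> t \<in> PiM {0..<t} (\<lambda>_. stage_space M) \<Otimes>\<^sub>M state_space M \<rightarrow>\<^sub>M prob_algebra (action_space M)"
    using pol by (simp add: policies_def histories_def)
  show ?thesis by (rule measurable_compose[OF measurable_Pair1'[OF h] p])
qed

lemma nn_integral_stage_kernel:
  assumes h: "h \<in> space (PiM {0..<t} (\<lambda>_. stage_space M))"
    and g [measurable]: "g \<in> borel_measurable (stage_space M)"
  shows "(\<integral>\<^sup>+z. g z \<partial>stage_kernel M \<pi> x t h) = (\<integral>\<^sup>+y. (\<integral>\<^sup>+a. g (y, a) \<partial>\<pi> t (h, y)) \<partial>current_law t h)"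
proof -
  note [measurable] = policy_meas[OF h]
  have cl: "sets (current_law t h) = sets (state_space M)"
    using current_law_space[OF h] by (simp add: space_prob_algebra)
  have 1: "(\<lambda>y. \<pi> t (h, y) \<bind> (\<lambda>a. return (stage_space M) (y, a)))
      \<in> state_space M \<rightarrow>\<^sub>M subprob_algebra (stage_space M)"
    by (rule measurable_prob_algebraD, rule measurable_bind_prob_space2[where N="action_space M"]) measurable
  then have 1: "(\<lambda>y. \<pi> t (h, y) \<bind> (\<lambda>a. return (stage_space M) (y, a)))
      \<in> current_law t h \<rightarrow>\<^sub>M subprob_algebra (stage_space M)"
    by (simp cong: measurable_cong_sets[OF cl refl])
  have "(\<integral>\<^sup>+z. g z \<partial>stage_kernel M \<pi> x t h)
      = (\<integral>\<^sup>+y. (\<integral>\<^sup>+z. g z \<partial>(\<pi> t (h, y) \<bind> (\<lambda>a. return (stage_space M) (y, a)))) \<partial>current_law t h)"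
    unfolding stage_kernel_def current_law_def[symmetric] by (rule nn_integral_bind[OF g 1])
  also have "\<dots> = (\<integral>\<^sup>+y. (\<integral>\<^sup>+a. g (y, a) \<partial>\<pi> t (h, y)) \<partial>current_law t h)"
  proof (rule nn_integral_cong)
    fix y assume "y \<in> space (current_law t h)"
    then have y: "y \<in> space (state_space M)" using sets_eq_imp_space_eq[OF cl] by simp
    have st: "sets (\<pi> t (h, y)) = sets (action_space M)"
      using measurable_space[OF policy_meas[OF h] y] by (simp add: space_prob_algebra)
    have "(\<lambda>a. return (stage_space M) (y, a)) \<in> \<pi> t (h, y) \<rightarrow>\<^sub>M subprob_algebra (stage_space M)"
      using y by (simp cong: measurable_cong_sets[OF st refl])
    from nn_integral_bind[OF g this]
    have "(\<integral>\<^sup>+z. g z \<partial>(\<pi> t (h, y) \<bind> (\<lambda>a. return (stage_space M) (y, a))))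
        = (\<integral>\<^sup>+a. (\<integral>\<^sup>+z. g z \<partial>return (stage_space M) (y, a)) \<partial>\<pi> t (h, y))" .
    also have "\<dots> = (\<integral>\<^sup>+a. g (y, a) \<partial>\<pi> t (h, y))"
      by (rule nn_integral_cong, rule nn_integral_return)
        (use y sets_eq_imp_space_eq[OF st] in \<open>auto simp: space_pair_measure\<close>)
    finally show "(\<integral>\<^sup>+z. g z \<partial>(\<pi> t (h, y) \<bind> (\<lambda>a. return (stage_space M) (y, a))))
        = (\<integral>\<^sup>+a. g (y, a) \<partial>\<pi> t (h, y))" .
  qed
  finally show ?thesis .
qed

lemma restrict_in_space:
  "\<omega> \<in> space (path_measure M \<pi> x) \<Longrightarrow> restrict \<omega> {0..<t} \<in> space (PiM {0..<t} (\<lambda>_. stage_space M))"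
  using sets_eq_imp_space_eq[OF sets_path] by (auto simp: space_PiM PiE_iff)

text \<open>The action average has to be independent of the history. This holds when
  \<open>g\<close> ignores the action and when the policy is stationary; these are the two
  uses.\<close>

lemma nn_integral_marginal_current_law:
  assumes g: "g \<in> borel_measurable (stage_space M)"
    and g': "\<And>h y. y \<in> space (state_space M) \<Longrightarrow> h \<in> space (PiM {0..<t} (\<lambda>_. stage_space M)) \<Longrightarrow>
        (\<integral>\<^sup>+a. g (y, a) \<partial>\<pi> t (h, y)) = g' y"
  shows "(\<integral>\<^sup>+z. g z \<partial>marginal t)
    = (\<integral>\<^sup>+\<omega>. (\<integral>\<^sup>+y. g' y \<partial>current_law t (restrict \<omega> {0..<t})) \<partial>path_measure M \<pi> x)"
  unfolding nn_integral_marginal[OF g] nn_integral_coordinate[OF g]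
proof (rule nn_integral_cong)
  fix \<omega> assume "\<omega> \<in> space (path_measure M \<pi> x)"
  note h = restrict_in_space[OF this, of t]
  have "y \<in> space (state_space M)" if "y \<in> space (current_law t (restrict \<omega> {0..<t}))" for y
    using that current_law_space[OF h] by (auto simp: space_prob_algebra dest: sets_eq_imp_space_eq)
  then show "(\<integral>\<^sup>+z. g z \<partial>stage_kernel M \<pi> x t (restrict \<omega> {0..<t}))
      = (\<integral>\<^sup>+y. g' y \<partial>current_law t (restrict \<omega> {0..<t}))"
    unfolding nn_integral_stage_kernel[OF h g] by (intro nn_integral_cong g' h)
qed

lemma nn_integral_current_state:
  assumes g [measurable]: "g \<in> borel_measurable (state_space M)"
  shows "(\<integral>\<^sup>+z. g (fst z) \<partial>marginal t)
    = (\<integral>\<^sup>+\<omega>. (\<integral>\<^sup>+y. g y \<partial>current_law t (restrict \<omega> {0..<t})) \<partial>path_measure M \<pi> x)"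
proof (rule nn_integral_marginal_current_law)
  fix h y assume "y \<in> space (state_space M)" "h \<in> space (PiM {0..<t} (\<lambda>_. stage_space M))"
  from measurable_space[OF policy_meas[OF this(2)] this(1)]
  show "(\<integral>\<^sup>+a. g (fst (y, a)) \<partial>\<pi> t (h, y)) = g y"
    by (simp add: space_prob_algebra prob_space.emeasure_space_1)
qed measurable

lemma distr_fst_marginal_0: "distr (marginal 0) (state_space M) fst = return (state_space M) x"
proof (rule measure_eqI)
  fix D assume "D \<in> sets (distr (marginal 0) (state_space M) fst)"
  then have D [measurable]: "D \<in> sets (state_space M)" by simp
  interpret prob_space "path_measure M \<pi> x" by (rule prob_path)
  have "emeasure (distr (marginal 0) (state_space M) fst) D
      = (\<integral>\<^sup>+y. indicator D y \<partial>distr (marginal 0) (state_space M) fst)" by simp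
  also have "\<dots> = (\<integral>\<^sup>+z. indicator D (fst z) \<partial>marginal 0)"
    by (rule nn_integral_distr) measurable
  also have "\<dots> = indicator D x"
    by (subst nn_integral_current_state) (use x in \<open>auto simp: current_law_def nn_integral_return emeasure_space_1\<close>)
  finally show "emeasure (distr (marginal 0) (state_space M) fst) D = emeasure (return (state_space M) x) D" by simp
qed simp

text \<open>The policy acts on the state law only through the preceding stage law. Hence the drift
  condition can be iterated for history-dependent policies, without a Markov property.\<close>

lemma distr_fst_marginal_Suc:
  "distr (marginal (Suc t)) (state_space M) fst = marginal t \<bind> (\<lambda>z. kernel M (fst z) (snd z))"
proof (rule measure_eqI)
  note k = measurable_prob_algebraD[OF kernel_meas]
  have k': "(\<lambda>z. kernel M (fst z) (snd z)) \<in> marginal t \<rightarrow>\<^sub>M subprob_algebra (state_space M)"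
    using k by (simp cong: measurable_cong_sets)
  have ne: "space (marginal t) \<noteq> {}" by (rule prob_space.not_empty[OF prob_marginal])
  have "sets (marginal t \<bind> (\<lambda>z. kernel M (fst z) (snd z))) = sets (state_space M)"
    by (rule sets_bind[OF _ ne]) (use subprob_measurableD(2)[OF k'] in simp)
  then show "sets (distr (marginal (Suc t)) (state_space M) fst) = sets (marginal t \<bind> (\<lambda>z. kernel M (fst z) (snd z)))"
    by simp
  fix D assume "D \<in> sets (distr (marginal (Suc t)) (state_space M) fst)"
  then have D [measurable]: "D \<in> sets (state_space M)" by simp
  have kD: "(\<lambda>z. emeasure (kernel M (fst z) (snd z)) D) \<in> borel_measurable (stage_space M)"
    by (rule measurable_compose[OF k measurable_emeasure_subprob_algebra[OF D]])
  have "emeasure (distr (marginal (Suc t)) (state_space M) fst) D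
      = (\<integral>\<^sup>+y. indicator D y \<partial>distr (marginal (Suc t)) (state_space M) fst)" by simp
  also have "\<dots> = (\<integral>\<^sup>+z. indicator D (fst z) \<partial>marginal (Suc t))"
    by (rule nn_integral_distr) measurable
  also have "\<dots> = (\<integral>\<^sup>+\<omega>. (\<integral>\<^sup>+y. indicator D y \<partial>current_law (Suc t) (restrict \<omega> {0..<Suc t})) \<partial>path_measure M \<pi> x)"
    by (rule nn_integral_current_state) measurable
  also have "\<dots> = (\<integral>\<^sup>+\<omega>. emeasure (kernel M (fst (\<omega> t)) (snd (\<omega> t))) D \<partial>path_measure M \<pi> x)"
  proof (rule nn_integral_cong)
    fix \<omega> assume "\<omega> \<in> space (path_measure M \<pi> x)"
    from current_law_space[OF restrict_in_space[OF this, of "Suc t"]]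
    have "sets (kernel M (fst (\<omega> t)) (snd (\<omega> t))) = sets (state_space M)"
      by (simp add: current_law_def space_prob_algebra)
    then show "(\<integral>\<^sup>+y. indicator D y \<partial>current_law (Suc t) (restrict \<omega> {0..<Suc t}))
        = emeasure (kernel M (fst (\<omega> t)) (snd (\<omega> t))) D"
      by (simp add: current_law_def)
  qed
  also have "\<dots> = (\<integral>\<^sup>+z. emeasure (kernel M (fst z) (snd z)) D \<partial>marginal t)"
    by (rule nn_integral_marginal[OF kD, symmetric])
  also have "\<dots> = emeasure (marginal t \<bind> (\<lambda>z. kernel M (fst z) (snd z))) D"
    by (rule emeasure_bind[OF ne k' D, symmetric])
  finally show "emeasure (distr (marginal (Suc t)) (state_space M) fst) D
      = emeasure (marginal t \<bind> (\<lambda>z. kernel M (fst z) (snd z))) D" .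
qed

end

text \<open>The stage laws of a stationary policy are concentrated on the graph of \<open>f\<close>,
  here in integrated form.\<close>

lemma stationary_marginal:
  assumes M: "is_mdp M" and f: "f \<in> stationary_policies M" and x: "x \<in> space (state_space M)"
    and g [measurable]: "g \<in> borel_measurable (stage_space M)"
  shows "(\<integral>\<^sup>+z. g z \<partial>controlled_process.marginal M (stationary M f) x t)
    = (\<integral>\<^sup>+z. g (fst z, f (fst z)) \<partial>controlled_process.marginal M (stationary M f) x t)"
proof -
  interpret controlled_process M "stationary M f" x
    using M stationary_in_policies[OF f] x by unfold_locales
  have [measurable]: "f \<in> state_space M \<rightarrow>\<^sub>M action_space M" using f by (simp add: stationary_policies_def)
  have gf: "(\<lambda>y. g (y, f y)) \<in> borel_measurable (state_space M)" by measurable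
  have "(\<integral>\<^sup>+z. g z \<partial>marginal t)
      = (\<integral>\<^sup>+\<omega>. (\<integral>\<^sup>+y. g (y, f y) \<partial>current_law t (restrict \<omega> {0..<t})) \<partial>path_measure M (stationary M f) x)"
  proof (rule nn_integral_marginal_current_law[OF g])
    fix h y assume y: "y \<in> space (state_space M)"
    then have "f y \<in> space (action_space M)" by (rule measurable_space[rotated]) measurable
    then show "(\<integral>\<^sup>+a. g (y, a) \<partial>stationary M f t (h, y)) = g (y, f y)"
      using y by (simp add: stationary_def nn_integral_return)
  qed
  also have "\<dots> = (\<integral>\<^sup>+z. g (fst z, f (fst z)) \<partial>marginal t)"
    by (rule nn_integral_current_state[OF gf, symmetric])
  finally show ?thesis .
qed

subsection \<open>Average cost under a drift condition\<close>

text \<open>Made to be instantiated by the original model and by the compact ones, with different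
  weights and moduli but the same cost constant \<open>B\<close>.\<close>

locale drift_mdp =
  fixes M :: "('s, 'a) mdp" and w :: "'s \<Rightarrow> real" and \<eta> :: "'s measure"
    and \<phi> :: "'s \<Rightarrow> 'a \<Rightarrow> real" and \<alpha> B :: real
  assumes mdp: "is_mdp M"
    and w_meas [measurable]: "w \<in> borel_measurable (state_space M)"
    and w_ge_1: "\<And>x. x \<in> space (state_space M) \<Longrightarrow> 1 \<le> w x"
    and w_int: "\<And>x a. x \<in> space (state_space M) \<Longrightarrow> a \<in> space (action_space M) \<Longrightarrow> integrable (kernel M x a) w"
    and \<eta>: "\<eta> \<in> space (prob_algebra (state_space M))" and \<eta>_int: "integrable \<eta> w"
    and \<phi>_meas: "(\<lambda>(x, a). \<phi> x a) \<in> borel_measurable (stage_space M)"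
    and \<phi>_nonneg: "\<And>x a. x \<in> space (state_space M) \<Longrightarrow> a \<in> space (action_space M) \<Longrightarrow> 0 \<le> \<phi> x a"
    and \<alpha>: "0 < \<alpha>" "\<alpha> < 1"
    and minor: "\<And>x a D. x \<in> space (state_space M) \<Longrightarrow> a \<in> space (action_space M) \<Longrightarrow>
        D \<in> sets (state_space M) \<Longrightarrow> measure \<eta> D * \<phi> x a \<le> measure (kernel M x a) D"
    and drift: "\<And>x a. x \<in> space (state_space M) \<Longrightarrow> a \<in> space (action_space M) \<Longrightarrow>
        (\<integral>y. w y \<partial>kernel M x a) \<le> \<alpha> * w x + (\<integral>y. w y \<partial>\<eta>) * \<phi> x a"
    and cost_bound: "\<And>x a. x \<in> space (state_space M) \<Longrightarrow> a \<in> space (action_space M) \<Longrightarrow>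
        \<bar>cost M x a\<bar> \<le> B * w x"
begin

lemma kernel_meas [measurable]:
  "(\<lambda>z. kernel M (fst z) (snd z)) \<in> stage_space M \<rightarrow>\<^sub>M prob_algebra (state_space M)"
  using mdp by (simp add: is_mdp_def case_prod_beta')

lemma cost_meas [measurable]: "(\<lambda>z. cost M (fst z) (snd z)) \<in> borel_measurable (stage_space M)"
  using mdp by (simp add: is_mdp_def case_prod_beta')

lemma stationary_chain:
  assumes f: "f \<in> stationary_policies M"
  shows "drift_chain (state_space M) (\<lambda>y. kernel M y (f y)) w \<eta> (\<lambda>y. \<phi> y (f y)) \<alpha>"
proof -
  have f' [measurable]: "f \<in> state_space M \<rightarrow>\<^sub>M action_space M" using f by (simp add: stationary_policies_def)
  have fs: "f y \<in> space (action_space M)" if "y \<in> space (state_space M)" for y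
    using measurable_space[OF f' that] .
  have g: "(\<lambda>y. (y, f y)) \<in> state_space M \<rightarrow>\<^sub>M stage_space M" by measurable
  show ?thesis
  proof
    show "(\<lambda>y. kernel M y (f y)) \<in> state_space M \<rightarrow>\<^sub>M prob_algebra (state_space M)"
      using measurable_compose[OF g kernel_meas] by simp
    show "(\<lambda>y. \<phi> y (f y)) \<in> borel_measurable (state_space M)"
      using measurable_compose[OF g \<phi>_meas] by simp
  qed (use fs w_ge_1 w_int \<eta> \<eta>_int \<phi>_nonneg \<alpha> minor drift in auto)
qed

lemma cost_stationary_wfun:
  assumes f: "f \<in> stationary_policies M"
  shows "drift_chain.wfun (state_space M) w B (\<lambda>y. cost M y (f y))"
proof -
  interpret c: drift_chain "state_space M" "\<lambda>y. kernel M y (f y)" w \<eta> "\<lambda>y. \<phi> y (f y)" \<alpha>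
    by (rule stationary_chain[OF f])
  have f' [measurable]: "f \<in> state_space M \<rightarrow>\<^sub>M action_space M" using f by (simp add: stationary_policies_def)
  have g: "(\<lambda>y. (y, f y)) \<in> state_space M \<rightarrow>\<^sub>M stage_space M" by measurable
  show ?thesis
    unfolding c.wfun_def
    using measurable_compose[OF g cost_meas] cost_bound measurable_space[OF f'] by simp
qed

lemma ergodic_cost_eq_mean_cost:
  assumes f: "f \<in> stationary_policies M"
  shows "ergodic_cost M f = mean_cost (\<lambda>y. kernel M y (f y)) \<eta> (\<lambda>y. \<phi> y (f y)) (\<lambda>y. cost M y (f y))"
proof -
  interpret c: drift_chain "state_space M" "\<lambda>y. kernel M y (f y)" w \<eta> "\<lambda>y. \<phi> y (f y)" \<alpha>
    by (rule stationary_chain[OF f])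
  have "invariant_prob M f = c.invariant"
    by (intro ext) (simp add: invariant_prob_def c.invariant_def)
  then show ?thesis
    unfolding ergodic_cost_def using c.integral_the_invariant[OF cost_stationary_wfun[OF f]] by simp
qed

definition b :: real where "b = (\<integral>y. w y \<partial>\<eta>)"

lemma b_nonneg: "0 \<le> b"
proof -
  have "space \<eta> = space (state_space M)" using \<eta> by (auto simp: space_prob_algebra dest: sets_eq_imp_space_eq)
  then show ?thesis unfolding b_def by (intro integral_nonneg_AE AE_I2) (use w_ge_1 in force)
qed

lemma kernel_w_le:
  assumes x: "x \<in> space (state_space M)" and a: "a \<in> space (action_space M)"
  shows "(\<integral>y. w y \<partial>kernel M x a) \<le> \<alpha> * w x + b"
proof -
  have "kernel M x a \<in> space (prob_algebra (state_space M))"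
    using measurable_space[OF kernel_meas, of "(x, a)"] x a by (simp add: space_pair_measure)
  then interpret k: prob_space "kernel M x a" by (simp add: space_prob_algebra)
  interpret e: prob_space \<eta> using \<eta> by (simp add: space_prob_algebra)
  have "space \<eta> = space (state_space M)" using \<eta> by (auto simp: space_prob_algebra dest: sets_eq_imp_space_eq)
  \<comment> \<open>The minorization for the whole space compares two masses that are equal to
    one.\<close>
  then have "\<phi> x a \<le> 1" using minor[OF x a sets.top] e.prob_space k.prob_le_1 by (metis mult_1 order_trans)
  then have "b * \<phi> x a \<le> b" using b_nonneg mult_left_mono[of "\<phi> x a" 1 b] by simp
  then show ?thesis using drift[OF x a] by (simp add: b_def)
qed

end

locale controlled_drift = drift_mdp M w \<eta> \<phi> \<alpha> B + controlled_process M \<pi> x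
  for M :: "('s, 'a) mdp" and w \<eta> \<phi> \<alpha> B \<pi> x
begin

text \<open>Iterating the drift bound gives \<open>\<alpha> ^ t * w x\<close> plus a partial
  geometric series with first term \<open>b\<close>; \<open>W\<close> dominates this for every
  \<open>t\<close>.\<close>

definition W :: real where "W = w x + b / (1 - \<alpha>)"

lemma kernel_sub: "(\<lambda>z. kernel M (fst z) (snd z)) \<in> marginal t \<rightarrow>\<^sub>M subprob_algebra (state_space M)"
  using measurable_prob_algebraD[OF kernel_meas] by (simp cong: measurable_cong_sets)

lemma in_stage: "z \<in> space (marginal t) \<Longrightarrow> fst z \<in> space (state_space M)"
    "z \<in> space (marginal t) \<Longrightarrow> snd z \<in> space (action_space M)"
  by (auto simp: space_pair_measure)

lemma marginal_w: "integrable (marginal t) (\<lambda>z. w (fst z)) \<and> (\<integral>z. w (fst z) \<partial>marginal t) \<le> W"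
proof (induction t)
  case 0
  have m: "(fst :: 's \<times> 'a \<Rightarrow> 's) \<in> marginal 0 \<rightarrow>\<^sub>M state_space M" by measurable
  have "(\<integral>\<^sup>+z. ennreal (w (fst z)) \<partial>marginal 0) = (\<integral>\<^sup>+y. ennreal (w y) \<partial>distr (marginal 0) (state_space M) fst)"
    by (rule nn_integral_distr[OF m, symmetric]) simp
  also have "\<dots> = ennreal (w x)" unfolding distr_fst_marginal_0 using x by (simp add: nn_integral_return)
  finally have e: "(\<integral>\<^sup>+z. ennreal (w (fst z)) \<partial>marginal 0) = ennreal (w x)" .
  have n: "AE z in marginal 0. 0 \<le> w (fst z)" by (rule AE_I2) (use w_ge_1 in_stage in force)
  have "integrable (marginal 0) (\<lambda>z. w (fst z))"
    using e by (intro integrableI_nn_integral_finite[OF _ n]) auto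
  moreover have "(\<integral>z. w (fst z) \<partial>marginal 0) = w x"
    using e w_ge_1[OF x] by (subst integral_eq_nn_integral[OF _ n]) auto
  ultimately show ?case using b_nonneg \<alpha> by (simp add: W_def)
next
  case (Suc t)
  interpret prob_space "marginal t" by (rule prob_marginal)
  have m: "(fst :: 's \<times> 'a \<Rightarrow> 's) \<in> marginal (Suc t) \<rightarrow>\<^sub>M state_space M" by measurable
  have v: "integrable (marginal t) (\<lambda>z. \<alpha> * w (fst z) + b)" using Suc by simp
  have 1: "\<bar>w y\<bar> \<le> w y" if "y \<in> space (state_space M)" for y
    using w_ge_1[OF that] by simp
  have 2: "integrable (kernel M (fst z) (snd z)) w" "(\<integral>y. w y \<partial>kernel M (fst z) (snd z)) \<le> \<alpha> * w (fst z) + b"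
    if "z \<in> space (marginal t)" for z
    using w_int kernel_w_le in_stage[OF that] by auto
  note bd = integral_bind_dominated[OF kernel_sub[of t] not_empty w_meas w_meas 1 2 v]
  have i: "integrable (distr (marginal (Suc t)) (state_space M) fst) w"
    unfolding distr_fst_marginal_Suc by (rule bd(1))
  have ii: "integrable (marginal t) (\<lambda>z. \<integral>y. w y \<partial>kernel M (fst z) (snd z))" by (rule bd(2))
  have "(\<integral>z. w (fst z) \<partial>marginal (Suc t)) = (\<integral>y. w y \<partial>distr (marginal (Suc t)) (state_space M) fst)"
    by (rule integral_distr[OF m, symmetric]) simp
  also have "\<dots> = (\<integral>z. (\<integral>y. w y \<partial>kernel M (fst z) (snd z)) \<partial>marginal t)"
    unfolding distr_fst_marginal_Suc
    by (rule bd(3))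
  also have "\<dots> \<le> (\<integral>z. \<alpha> * w (fst z) + b \<partial>marginal t)"
    by (rule integral_mono[OF ii v]) (use kernel_w_le in_stage in blast)
  also have "\<dots> = \<alpha> * (\<integral>z. w (fst z) \<partial>marginal t) + b" using Suc by (simp add: prob_space[simplified])
  also have "\<dots> \<le> \<alpha> * W + b" using Suc \<alpha> by simp
  also have "\<dots> \<le> W"
  proof -
    have "\<alpha> * (b / (1 - \<alpha>)) + b = b / (1 - \<alpha>)" using \<alpha> by (simp add: field_simps)
    moreover have "\<alpha> * w x \<le> w x" using \<alpha> w_ge_1[OF x] by simp
    ultimately show ?thesis by (simp add: W_def distrib_left)
  qed
  finally have le: "(\<integral>z. w (fst z) \<partial>marginal (Suc t)) \<le> W" .
  have "integrable (marginal (Suc t)) (\<lambda>z. w (fst z))"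
    using integrable_distr[OF m i] by simp
  with le show ?case by simp
qed

lemma marginal_integrable:
  assumes g: "g \<in> borel_measurable (stage_space M)"
    and le: "\<And>y a. y \<in> space (state_space M) \<Longrightarrow> a \<in> space (action_space M) \<Longrightarrow> \<bar>g (y, a)\<bar> \<le> D * w y"
  shows "integrable (marginal t) g"
proof (rule Bochner_Integration.integrable_bound[where f="\<lambda>z. D * w (fst z)"])
  show "integrable (marginal t) (\<lambda>z. D * w (fst z))" using marginal_w by simp
  show "g \<in> borel_measurable (marginal t)" using g by (simp cong: measurable_cong_sets)
  show "AE z in marginal t. norm (g z) \<le> norm (D * w (fst z))"
    using le by (intro AE_I2) (force simp: space_pair_measure)
qed

lemma expected_cost:
  "(\<integral>\<omega>. (\<Sum>t<T. cost M (fst (\<omega> t)) (snd (\<omega> t))) \<partial>path_measure M \<pi> x)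
    = (\<Sum>t<T. \<integral>z. cost M (fst z) (snd z) \<partial>marginal t)"
proof -
  have i: "integrable (marginal t) (\<lambda>z. cost M (fst z) (snd z))" for t
    by (rule marginal_integrable[OF cost_meas, where D=B]) (simp add: cost_bound)
  have "integrable (path_measure M \<pi> x) (\<lambda>\<omega>. cost M (fst (\<omega> t)) (snd (\<omega> t)))" for t
    using integrable_distr[OF coordinate_meas i[of t, unfolded marginal_def]] by simp
  then have "(\<integral>\<omega>. (\<Sum>t<T. cost M (fst (\<omega> t)) (snd (\<omega> t))) \<partial>path_measure M \<pi> x)
      = (\<Sum>t<T. \<integral>\<omega>. cost M (fst (\<omega> t)) (snd (\<omega> t)) \<partial>path_measure M \<pi> x)"
    by (intro Bochner_Integration.integral_sum)
  also have "\<dots> = (\<Sum>t<T. \<integral>z. cost M (fst z) (snd z) \<partial>marginal t)"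
    unfolding marginal_def
    by (intro sum.cong refl integral_distr[OF coordinate_meas, symmetric]) measurable
  finally show ?thesis .
qed

section \<open>Telescoping along the process\<close>

context
  fixes h :: "'s \<Rightarrow> real" and D \<rho> :: real
  assumes h [measurable]: "h \<in> borel_measurable (state_space M)"
    and h_le: "\<And>y. y \<in> space (state_space M) \<Longrightarrow> \<bar>h y\<bar> \<le> D * w y"
begin

text \<open>Mandl's discrepancy function: the amount by which a stage violates the equation with
  constant \<open>\<rho>\<close> and relative value \<open>h\<close>.\<close>

definition gap :: "'s \<times> 'a \<Rightarrow> real" where
  "gap z = cost M (fst z) (snd z) + (\<integral>y. h y \<partial>kernel M (fst z) (snd z)) - h (fst z) - \<rho>"

lemma D_nonneg: "0 \<le> D"
proof -
  have "0 \<le> D * w x" using h_le[OF x] by linarith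
  then show ?thesis using w_ge_1[OF x] by (simp add: zero_le_mult_iff)
qed

lemma h_marginal_bound: "\<bar>\<integral>z. h (fst z) \<partial>marginal t\<bar> \<le> D * W"
proof -
  have "\<bar>\<integral>z. h (fst z) \<partial>marginal t\<bar> \<le> (\<integral>z. \<bar>h (fst z)\<bar> \<partial>marginal t)"
    by (rule integral_abs_bound)
  also have "\<dots> \<le> (\<integral>z. D * w (fst z) \<partial>marginal t)"
  proof (rule integral_mono)
    show "integrable (marginal t) (\<lambda>z. \<bar>h (fst z)\<bar>)"
      by (rule marginal_integrable[where D=D]) (use h_le in auto)
    show "integrable (marginal t) (\<lambda>z. D * w (fst z))" using marginal_w by simp
  qed (use h_le in_stage in blast)
  also have "\<dots> \<le> D * W" using marginal_w D_nonneg by (simp add: mult_left_mono)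
  finally show ?thesis .
qed

lemma
  shows h_kernel_int: "integrable (marginal t) (\<lambda>z. \<integral>y. h y \<partial>kernel M (fst z) (snd z))"
    and h_kernel_eq: "(\<integral>z. h (fst z) \<partial>marginal (Suc t)) = (\<integral>z. (\<integral>y. h y \<partial>kernel M (fst z) (snd z)) \<partial>marginal t)"
proof -
  interpret prob_space "marginal t" by (rule prob_marginal)
  have m: "(fst :: 's \<times> 'a \<Rightarrow> 's) \<in> marginal (Suc t) \<rightarrow>\<^sub>M state_space M" by measurable
  have Dw: "(\<lambda>y. D * w y) \<in> borel_measurable (state_space M)" by measurable
  have v: "integrable (marginal t) (\<lambda>z. D * (\<alpha> * w (fst z) + b))" using marginal_w[of t] by simp
  have 1: "integrable (kernel M (fst z) (snd z)) (\<lambda>y. D * w y)" if "z \<in> space (marginal t)" for z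
    using w_int in_stage[OF that] by simp
  have 2: "(\<integral>y. D * w y \<partial>kernel M (fst z) (snd z)) \<le> D * (\<alpha> * w (fst z) + b)"
    if "z \<in> space (marginal t)" for z
    using kernel_w_le in_stage[OF that] D_nonneg by (simp add: mult_left_mono)
  note bd = integral_bind_dominated[OF kernel_sub[of t] not_empty h Dw h_le 1 2 v]
  show "integrable (marginal t) (\<lambda>z. \<integral>y. h y \<partial>kernel M (fst z) (snd z))" by (rule bd(2))
  have "(\<integral>z. h (fst z) \<partial>marginal (Suc t)) = (\<integral>y. h y \<partial>distr (marginal (Suc t)) (state_space M) fst)"
    by (rule integral_distr[OF m, symmetric]) simp
  also have "\<dots> = (\<integral>z. (\<integral>y. h y \<partial>kernel M (fst z) (snd z)) \<partial>marginal t)"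
    unfolding distr_fst_marginal_Suc by (rule bd(3))
  finally show "(\<integral>z. h (fst z) \<partial>marginal (Suc t)) = (\<integral>z. (\<integral>y. h y \<partial>kernel M (fst z) (snd z)) \<partial>marginal t)" .
qed

lemma gap_marginal:
  "(\<integral>z. gap z \<partial>marginal t) = (\<integral>z. cost M (fst z) (snd z) \<partial>marginal t)
     + (\<integral>z. h (fst z) \<partial>marginal (Suc t)) - (\<integral>z. h (fst z) \<partial>marginal t) - \<rho>"
proof -
  interpret prob_space "marginal t" by (rule prob_marginal)
  have 1: "integrable (marginal t) (\<lambda>z. cost M (fst z) (snd z))"
    by (rule marginal_integrable[OF cost_meas, where D=B]) (simp add: cost_bound)
  have 2: "integrable (marginal t) (\<lambda>z. h (fst z))"
    by (rule marginal_integrable[where D=D]) (use h_le in auto)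
  show ?thesis unfolding gap_def using 1 2 h_kernel_int by (simp add: prob_space[simplified] h_kernel_eq)
qed

lemma gap_meas: "gap \<in> borel_measurable (stage_space M)"
proof -
  have "(\<lambda>z. \<integral>y. h y \<partial>kernel M (fst z) (snd z)) \<in> borel_measurable (stage_space M)"
    by (rule measurable_compose[OF measurable_prob_algebraD[OF kernel_meas] integral_measurable_subprob_algebra[OF h]])
  then show ?thesis unfolding gap_def[abs_def] by measurable
qed

text \<open>The \<open>h\<close>-terms telescope, leaving only the first and the last, each bounded
  by \<open>D * W\<close> uniformly in time; after division by \<open>T\<close> they vanish in the
  limit.\<close>

lemma sum_gap:
  "\<bar>(\<Sum>t<T. \<integral>z. cost M (fst z) (snd z) \<partial>marginal t) - (real T * \<rho> + (\<Sum>t<T. \<integral>z. gap z \<partial>marginal t))\<bar> \<le> 2 * D * W"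
proof -
  define H where "H t = (\<integral>z. h (fst z) \<partial>marginal t)" for t
  have "(\<Sum>t<T. \<integral>z. cost M (fst z) (snd z) \<partial>marginal t)
      = real T * \<rho> + (\<Sum>t<T. \<integral>z. gap z \<partial>marginal t) + H 0 - H T"
    by (induction T) (auto simp: gap_marginal H_def algebra_simps)
  moreover have "\<bar>H t\<bar> \<le> D * W" for t unfolding H_def by (rule h_marginal_bound)
  then have "\<bar>H 0\<bar> \<le> D * W" "\<bar>H T\<bar> \<le> D * W" by blast+
  ultimately show ?thesis by linarith
qed

lemma average_cost_ge_gap:
  assumes "\<And>t. 0 \<le> (\<integral>z. gap z \<partial>marginal t)"
  shows "ereal \<rho> \<le> average_cost M \<pi> x"
proof -
  have "(\<lambda>T. \<rho> - 2 * D * W * inverse (real T)) \<longlonglongrightarrow> \<rho> - 2 * D * W * 0"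
    by (intro tendsto_intros lim_inverse_n)
  then have "limsup (\<lambda>T. ereal (\<rho> - 2 * D * W * inverse (real T))) = ereal \<rho>"
    by (intro lim_imp_Limsup) auto
  moreover have "limsup (\<lambda>T. ereal (\<rho> - 2 * D * W * inverse (real T))) \<le> average_cost M \<pi> x"
    unfolding average_cost_def expected_cost
  proof (rule Limsup_mono)
    show "\<forall>\<^sub>F T in sequentially. ereal (\<rho> - 2 * D * W * inverse (real T))
        \<le> ereal (1 / real T * (\<Sum>t<T. \<integral>z. cost M (fst z) (snd z) \<partial>marginal t))"
      using eventually_gt_at_top[of 0]
    proof eventually_elim
      case (elim T)
      have "0 \<le> (\<Sum>t<T. \<integral>z. gap z \<partial>marginal t)" by (intro sum_nonneg assms)
      then have "real T * \<rho> - 2 * D * W \<le> (\<Sum>t<T. \<integral>z. cost M (fst z) (snd z) \<partial>marginal t)"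
        using sum_gap[of T] by linarith
      then have "1 / real T * (real T * \<rho> - 2 * D * W) \<le> 1 / real T * (\<Sum>t<T. \<integral>z. cost M (fst z) (snd z) \<partial>marginal t)"
        by (rule mult_left_mono) simp
      moreover have "1 / real T * (real T * \<rho> - 2 * D * W) = \<rho> - 2 * D * W * inverse (real T)"
        using elim by (simp add: field_simps)
      ultimately show ?case by simp
    qed
  qed
  ultimately show ?thesis by simp
qed

lemma average_cost_eq_gap:
  assumes "\<And>t. (\<integral>z. gap z \<partial>marginal t) = 0"
  shows "average_cost M \<pi> x = ereal \<rho>"
proof -
  define S where "S T = (\<Sum>t<T. \<integral>z. cost M (fst z) (snd z) \<partial>marginal t)" for T
  have "(\<lambda>T. 1 / real T * S T - \<rho>) \<longlonglongrightarrow> 0"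
  proof (rule Lim_null_comparison)
    show "(\<lambda>T. 2 * D * W * inverse (real T)) \<longlonglongrightarrow> 0"
      using tendsto_mult_left[OF lim_inverse_n, of "2 * D * W"] by simp
    show "\<forall>\<^sub>F T in sequentially. norm (1 / real T * S T - \<rho>) \<le> 2 * D * W * inverse (real T)"
      using eventually_gt_at_top[of 0]
    proof eventually_elim
      case (elim T)
      have "\<bar>S T - real T * \<rho>\<bar> \<le> 2 * D * W" using sum_gap[of T] by (simp add: assms S_def)
      then have "\<bar>S T - real T * \<rho>\<bar> / real T \<le> 2 * D * W / real T" by (rule divide_right_mono) simp
      moreover have "1 / real T * S T - \<rho> = (S T - real T * \<rho>) / real T" using elim by (simp add: field_simps)
      then have "norm (1 / real T * S T - \<rho>) = \<bar>S T - real T * \<rho>\<bar> / real T" by simp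
      ultimately show ?case by (simp add: divide_inverse)
    qed
  qed
  then have "(\<lambda>T. 1 / real T * S T) \<longlonglongrightarrow> \<rho>" by (rule LIM_zero_cancel)
  then show ?thesis
    unfolding average_cost_def expected_cost S_def[symmetric] by (intro lim_imp_Limsup tendsto_ereal) auto
qed

end

end

context drift_mdp
begin

text \<open>Lower half of the verification argument: the hypothesis makes the discrepancy
  nonnegative at every stage, whatever policy generates the stages.\<close>

lemma average_cost_ge:
  assumes \<pi>: "\<pi> \<in> policies M" and x: "x \<in> space (state_space M)"
    and h: "h \<in> borel_measurable (state_space M)" "\<And>y. y \<in> space (state_space M) \<Longrightarrow> \<bar>h y\<bar> \<le> D * w y"
    and le: "\<And>y a. y \<in> space (state_space M) \<Longrightarrow> a \<in> space (action_space M) \<Longrightarrow>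
        \<rho> + h y \<le> cost M y a + (\<integral>z. h z \<partial>kernel M y a)"
  shows "ereal \<rho> \<le> average_cost M \<pi> x"
proof -
  interpret controlled_drift M w \<eta> \<phi> \<alpha> B \<pi> x
    using mdp \<pi> x by unfold_locales
  show ?thesis
  proof (rule average_cost_ge_gap[OF h])
    show "0 \<le> (\<integral>z. gap h \<rho> z \<partial>marginal t)" for t
      by (rule integral_nonneg_AE, rule AE_I2)
        (use le in \<open>auto simp: gap_def[OF h] space_pair_measure algebra_simps\<close>)
  qed
qed

lemma integral_stationary_marginal:
  fixes g :: "_ \<Rightarrow> real"
  assumes f: "f \<in> stationary_policies M" and x: "x \<in> space (state_space M)"
    and g [measurable]: "g \<in> borel_measurable (stage_space M)"
  shows "(\<integral>z. g z \<partial>controlled_process.marginal M (stationary M f) x t)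
    = (\<integral>z. g (fst z, f (fst z)) \<partial>controlled_process.marginal M (stationary M f) x t)"
proof -
  interpret controlled_process M "stationary M f" x
    using mdp stationary_in_policies[OF f] x by unfold_locales
  have [measurable]: "f \<in> state_space M \<rightarrow>\<^sub>M action_space M" using f by (simp add: stationary_policies_def)
  have m: "(\<lambda>z. (fst z, f (fst z))) \<in> marginal t \<rightarrow>\<^sub>M stage_space M" by measurable
  have eq: "marginal t = distr (marginal t) (stage_space M) (\<lambda>z. (fst z, f (fst z)))"
  proof (rule measure_eqI)
    fix D assume "D \<in> sets (marginal t)"
    then have D [measurable]: "D \<in> sets (stage_space M)" by simp
    have "emeasure (marginal t) D = (\<integral>\<^sup>+z. indicator D z \<partial>marginal t)" by simp
    also have "\<dots> = (\<integral>\<^sup>+z. indicator D (fst z, f (fst z)) \<partial>marginal t)"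
      by (rule stationary_marginal[OF mdp f x]) measurable
    also have "\<dots> = (\<integral>\<^sup>+z. indicator D z \<partial>distr (marginal t) (stage_space M) (\<lambda>z. (fst z, f (fst z))))"
      by (rule nn_integral_distr[OF m, symmetric]) simp
    also have "\<dots> = emeasure (distr (marginal t) (stage_space M) (\<lambda>z. (fst z, f (fst z)))) D" by simp
    finally show "emeasure (marginal t) D = emeasure (distr (marginal t) (stage_space M) (\<lambda>z. (fst z, f (fst z)))) D" .
  qed simp
  show ?thesis by (subst eq) (rule integral_distr[OF m g])
qed

text \<open>The Poisson equation makes the discrepancy zero on the graph of \<open>f\<close>, which
  carries the stage laws. So the upper limit defining the average cost is a limit, is the same from
  every initial state, and is given by the quotient formula.\<close>

lemma average_cost_stationary:
  assumes f: "f \<in> stationary_policies M" and x: "x \<in> space (state_space M)"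
  shows "average_cost M (stationary M f) x
    = ereal (mean_cost (\<lambda>y. kernel M y (f y)) \<eta> (\<lambda>y. \<phi> y (f y)) (\<lambda>y. cost M y (f y)))" (is "_ = ereal ?r")
proof -
  interpret c: drift_chain "state_space M" "\<lambda>y. kernel M y (f y)" w \<eta> "\<lambda>y. \<phi> y (f y)" \<alpha>
    by (rule stationary_chain[OF f])
  obtain h D where h: "c.wfun D h"
    and eq: "\<And>y. y \<in> space (state_space M) \<Longrightarrow> ?r + h y = cost M y (f y) + (\<integral>z. h z \<partial>kernel M y (f y))"
    using c.poisson_equation[OF cost_stationary_wfun[OF f]] by blast
  interpret controlled_drift M w \<eta> \<phi> \<alpha> B "stationary M f" x
    using mdp stationary_in_policies[OF f] x by unfold_locales
  note h = c.wfunD[OF h]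
  show ?thesis
  proof (rule average_cost_eq_gap[OF h])
    fix t
    have "(\<integral>z. gap h ?r (fst z, f (fst z)) \<partial>marginal t) = (\<integral>z. 0 \<partial>marginal t)"
    proof (rule Bochner_Integration.integral_cong[OF refl])
      fix z assume "z \<in> space (marginal t)"
      from eq[OF in_stage(1)[OF this]] show "gap h ?r (fst z, f (fst z)) = 0" by (simp add: gap_def[OF h])
    qed
    then show "(\<integral>z. gap h ?r z \<partial>marginal t) = 0"
      using integral_stationary_marginal[OF f x gap_meas[OF h], of t ?r] by simp
  qed
qed

lemma average_cost_stationary_le:
  assumes f: "f \<in> stationary_policies M" and x: "x \<in> space (state_space M)"
    and h: "h \<in> borel_measurable (state_space M)" "\<And>y. y \<in> space (state_space M) \<Longrightarrow> \<bar>h y\<bar> \<le> D * w y"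
    and le: "\<And>y. y \<in> space (state_space M) \<Longrightarrow> cost M y (f y) + (\<integral>z. h z \<partial>kernel M y (f y)) \<le> \<rho> + h y"
  shows "average_cost M (stationary M f) x \<le> ereal \<rho>"
proof -
  interpret c: drift_chain "state_space M" "\<lambda>y. kernel M y (f y)" w \<eta> "\<lambda>y. \<phi> y (f y)" \<alpha>
    by (rule stationary_chain[OF f])
  have "c.wfun D h" using h by (simp add: c.wfun_def)
  from c.L_le[OF cost_stationary_wfun[OF f] this le] show ?thesis
    by (simp add: average_cost_stationary[OF f x])
qed

end

subsection \<open>The average-cost optimality equation\<close>

lemma abs_diff_INF_le:
  fixes F G :: "'b \<Rightarrow> real"
  assumes F: "bdd_below (range F)" and G: "bdd_below (range G)" and le: "\<And>a. \<bar>F a - G a\<bar> \<le> e"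
  shows "\<bar>(INF a. F a) - (INF a. G a)\<bar> \<le> e"
proof -
  have "(INF a. F a) \<le> (INF a. G a) + e" if F: "bdd_below (range F)" and le: "\<And>a. F a \<le> G a + e"
    for F G :: "'b \<Rightarrow> real"
  proof -
    have "(INF a. F a) - e \<le> (INF a. G a)"
    proof (rule cINF_greatest)
      fix a show "(INF a. F a) - e \<le> G a"
        using cINF_lower[OF F, of a] le[of a] by simp
    qed simp
    then show ?thesis by simp
  qed
  from this[OF F, of G] this[OF G, of F] show ?thesis
    using le by (simp add: abs_le_iff algebra_simps)
qed

text \<open>Compactness of the parameter space makes continuity in \<open>x\<close> uniform in
  \<open>a\<close>, so near \<open>x0\<close> the infima differ as little as the functions
  do.\<close>

lemma continuous_on_INF_compact:
  fixes F :: "'b::t2_space \<times> 'c::topological_space \<Rightarrow> real"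
  assumes comp: "compact (UNIV :: 'c set)" and F: "continuous_on UNIV F"
  shows "continuous_on UNIV (\<lambda>x. INF a. F (x, a))"
proof -
  have bdd: "bdd_below (range (\<lambda>a. F (x, a)))" for x
  proof -
    have "continuous_on UNIV (\<lambda>a. F (x, a))"
      by (rule continuous_on_compose2[OF F]) (auto intro!: continuous_intros)
    from compact_continuous_image[OF this comp] show ?thesis
      by (rule bounded_imp_bdd_below[OF compact_imp_bounded])
  qed
  have "isCont (\<lambda>x. INF a. F (x, a)) x0" for x0
    unfolding isCont_def
  proof (rule tendstoI)
    fix e :: real assume e: "e > 0"
    have F': "continuous_on (UNIV \<times> UNIV) F" using F by simp
    obtain X0 where X0: "x0 \<in> X0" "open X0"
      "\<forall>x\<in>X0 \<inter> UNIV. \<forall>t\<in>UNIV. dist (F (x, t)) (F (x0, t)) \<le> e / 2"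
      using continuous_on_prod_compactE[OF F' comp UNIV_I, of "e/2" x0] e by auto
    have "dist (INF a. F (x, a)) (INF a. F (x0, a)) < e" if "x \<in> X0" for x
    proof -
      have "\<bar>(INF a. F (x, a)) - (INF a. F (x0, a))\<bar> \<le> e / 2"
        by (rule abs_diff_INF_le[OF bdd bdd]) (use X0 that in \<open>auto simp: dist_real_def\<close>)
      then show ?thesis using e by (simp add: dist_real_def)
    qed
    then show "\<forall>\<^sub>F x in at x0. dist (INF a. F (x, a)) (INF a. F (x0, a)) < e"
      using X0(1,2) eventually_at_topological by blast
  qed
  then show ?thesis by (simp add: continuous_at_imp_continuous_on)
qed

text \<open>\<open>kernel_cont\<close> is demanded for measurable \<open>u\<close>, not only for
  continuous ones: it is applied later to \<open>w\<close> restricted to the complement of a compact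
  set.\<close>

locale continuous_drift_mdp = drift_mdp M w \<eta> \<phi> \<alpha> B
  for M :: "('x::{metric_space, second_countable_topology},
               'a::{metric_space, second_countable_topology}) mdp"
    and w \<eta> \<phi> \<alpha> B +
  assumes state_borel: "state_space M = borel" and action_borel: "action_space M = borel"
    and compact_actions: "compact (UNIV :: 'a set)"
    and w_cont: "continuous_on UNIV w"
    and cost_cont: "continuous_on UNIV (\<lambda>z. cost M (fst z) (snd z))"
    and \<phi>_cont: "continuous_on UNIV (\<lambda>z. \<phi> (fst z) (snd z))"
    and kernel_cont: "\<And>u. u \<in> borel_measurable borel \<Longrightarrow> (\<And>y. \<bar>u y\<bar> \<le> w y) \<Longrightarrow>
        continuous_on UNIV (\<lambda>z. \<integral>y. u y \<partial>kernel M (fst z) (snd z))"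
begin

text \<open>The predicate \<open>wfun\<close> freed from a fixed chain, since a different action may
  be chosen at every state.\<close>

definition wb :: "real \<Rightarrow> ('x \<Rightarrow> real) \<Rightarrow> bool" where
  "wb C u \<longleftrightarrow> u \<in> borel_measurable borel \<and> (\<forall>x. \<bar>u x\<bar> \<le> C * w x)"

text \<open>The operator \<open>P\<close> of the constant policy \<open>a\<close>. At a single state
  only the current action matters, so pointwise facts about \<open>P\<close> carry over.\<close>

definition q :: "'x \<Rightarrow> 'a \<Rightarrow> ('x \<Rightarrow> real) \<Rightarrow> real" where
  "q x a u = sub_op (\<lambda>y. kernel M y a) \<eta> (\<lambda>y. \<phi> y a) u x"

lemma const_chain: "drift_chain borel (\<lambda>y. kernel M y a) w \<eta> (\<lambda>y. \<phi> y a) \<alpha>"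
  using stationary_chain[of "\<lambda>_. a"] by (simp add: stationary_policies_def state_borel action_borel)

lemma wb_eq_wfun: "wb = drift_chain.wfun borel w"
proof -
  interpret drift_chain borel "\<lambda>y. kernel M y a" w \<eta> "\<lambda>y. \<phi> y a" \<alpha> for a by (rule const_chain)
  show ?thesis by (intro ext) (simp add: wb_def wfun_def)
qed

lemma
  shows wb_diff: "wb C u \<Longrightarrow> wb D v \<Longrightarrow> wb (C + D) (\<lambda>x. u x - v x)"
    and wb_nonneg: "wb C u \<Longrightarrow> 0 \<le> C"
    and wb_w: "wb 1 w"
    and q_diff: "wb C u \<Longrightarrow> wb D v \<Longrightarrow> q x a (\<lambda>y. u y - v y) = q x a u - q x a v"
    and q_mono: "wb C u \<Longrightarrow> wb D v \<Longrightarrow> (\<And>y. u y \<le> v y) \<Longrightarrow> q x a u \<le> q x a v"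
    and q_bound: "wb C u \<Longrightarrow> \<bar>q x a u\<bar> \<le> \<alpha> * C * w x"
    and q_cmult: "q x a (\<lambda>y. r * u y) = r * q x a u"
    and q_w: "q x a w \<le> \<alpha> * w x"
    and wb_int: "wb C u \<Longrightarrow> integrable \<eta> u"
proof -
  interpret c: drift_chain borel "\<lambda>y. kernel M y a" w \<eta> "\<lambda>y. \<phi> y a" \<alpha> for a by (rule const_chain)
  show "wb C u \<Longrightarrow> wb D v \<Longrightarrow> wb (C + D) (\<lambda>x. u x - v x)"
    and "wb C u \<Longrightarrow> 0 \<le> C" and "wb 1 w" and "wb C u \<Longrightarrow> integrable \<eta> u"
    unfolding wb_eq_wfun by (rule c.wfun_diff c.wfun_nonneg c.wfun_w c.wfun_int_\<eta>; assumption)+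
  show "wb C u \<Longrightarrow> wb D v \<Longrightarrow> q x a (\<lambda>y. u y - v y) = q x a u - q x a v"
    and "wb C u \<Longrightarrow> wb D v \<Longrightarrow> (\<And>y. u y \<le> v y) \<Longrightarrow> q x a u \<le> q x a v"
    and "q x a (\<lambda>y. r * u y) = r * q x a u"
    and "q x a w \<le> \<alpha> * w x"
    unfolding wb_eq_wfun q_def using c.P_diff c.P_mono c.P_cmult c.P_w by auto
  show "\<bar>q x a u\<bar> \<le> \<alpha> * C * w x" if "wb C u"
    using c.wfunD(2)[OF c.P_wfun] that unfolding wb_eq_wfun q_def by simp
qed

lemma w_ge1: "1 \<le> w x" using w_ge_1[of x] by (simp add: state_borel)

lemma kernel_cont': 
  assumes u: "wb C u" shows "continuous_on UNIV (\<lambda>z. \<integral>y. u y \<partial>kernel M (fst z) (snd z))"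
proof -
  have C: "0 \<le> C" by (rule wb_nonneg[OF u])
  \<comment> \<open>The divisor \<open>C + 1\<close> instead of \<open>C\<close> covers the case
    \<open>C = 0\<close>.\<close>
  have "continuous_on UNIV (\<lambda>z. \<integral>y. u y / (C + 1) \<partial>kernel M (fst z) (snd z))"
  proof (rule kernel_cont)
    have [measurable]: "u \<in> borel_measurable borel" using u by (simp add: wb_def)
    show "(\<lambda>y. u y / (C + 1)) \<in> borel_measurable borel" by measurable
    fix y
    have "\<bar>u y\<bar> \<le> C * w y" using u by (simp add: wb_def)
    also have "\<dots> \<le> (C + 1) * w y" using w_ge1[of y] by (simp add: distrib_right)
    finally show "\<bar>u y / (C + 1)\<bar> \<le> w y" using C by (simp add: field_simps)
  qed
  then have "continuous_on UNIV (\<lambda>z. (C + 1) * (\<integral>y. u y / (C + 1) \<partial>kernel M (fst z) (snd z)))"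
    by (intro continuous_intros)
  then show ?thesis using C by simp
qed

section \<open>The Bellman operator and its fixed point\<close>

definition E :: "real \<Rightarrow> ('x \<Rightarrow> real) \<Rightarrow> 'x \<times> 'a \<Rightarrow> real" where
  "E \<rho> u z = cost M (fst z) (snd z) - \<rho> + q (fst z) (snd z) u"

lemma E_cont: "wb C u \<Longrightarrow> continuous_on UNIV (E \<rho> u)"
  unfolding E_def[abs_def] q_def sub_op_def
  by (intro continuous_intros cost_cont \<phi>_cont kernel_cont')

lemma E_bound: "wb C u \<Longrightarrow> \<bar>E \<rho> u (x, a)\<bar> \<le> (B + \<bar>\<rho>\<bar> + \<alpha> * C) * w x"
proof -
  assume u: "wb C u"
  have "\<bar>cost M x a\<bar> \<le> B * w x" using cost_bound by (simp add: state_borel action_borel)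
  moreover have "\<bar>\<rho>\<bar> \<le> \<bar>\<rho>\<bar> * w x" using mult_left_mono[OF w_ge1[of x], of "\<bar>\<rho>\<bar>"] by simp
  moreover note q_bound[OF u, of x a]
  ultimately show ?thesis unfolding E_def distrib_right fst_conv snd_conv by linarith
qed

lemma E_bdd: "wb C u \<Longrightarrow> bdd_below (range (\<lambda>a. E \<rho> u (x, a)))"
proof (rule bdd_belowI2)
  fix a assume "wb C u"
  from E_bound[OF this, of \<rho> x a] show "- ((B + \<bar>\<rho>\<bar> + \<alpha> * C) * w x) \<le> E \<rho> u (x, a)" by linarith
qed

definition T :: "real \<Rightarrow> ('x \<Rightarrow> real) \<Rightarrow> 'x \<Rightarrow> real" where
  "T \<rho> u x = (INF a. E \<rho> u (x, a))"

lemma T_lower: "wb C u \<Longrightarrow> T \<rho> u x \<le> E \<rho> u (x, a)"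
  unfolding T_def by (rule cINF_lower[OF E_bdd]) auto

lemma T_near: "e > 0 \<Longrightarrow> \<exists>a. E \<rho> u (x, a) < T \<rho> u x + e"
proof (rule ccontr)
  assume e: "e > 0" and "\<nexists>a. E \<rho> u (x, a) < T \<rho> u x + e"
  then have "T \<rho> u x + e \<le> T \<rho> u x"
    unfolding T_def by (intro cINF_greatest) (auto simp: not_less T_def)
  with e show False by simp
qed

lemma T_cont: "wb C u \<Longrightarrow> continuous_on UNIV (T \<rho> u)"
  unfolding T_def[abs_def] by (rule continuous_on_INF_compact[OF compact_actions E_cont])

lemma T_bound: "wb C u \<Longrightarrow> \<bar>T \<rho> u x\<bar> \<le> (B + \<bar>\<rho>\<bar> + \<alpha> * C) * w x"
  using abs_diff_INF_le[OF E_bdd[of C u \<rho> x], of "\<lambda>_. 0" "(B + \<bar>\<rho>\<bar> + \<alpha> * C) * w x"] E_bound[of C u \<rho> x]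
  by (simp add: T_def)

lemma T_contract:
  assumes u: "wb C u" and v: "wb D v" and le: "\<And>y. \<bar>u y - v y\<bar> \<le> d * w y"
  shows "\<bar>T \<rho> u x - T \<rho> v x\<bar> \<le> \<alpha> * d * w x"
  unfolding T_def
proof (rule abs_diff_INF_le[OF E_bdd[OF u] E_bdd[OF v]])
  fix a
  have "wb d (\<lambda>y. u y - v y)" using wb_diff[OF u v] le by (simp add: wb_def)
  then have "\<bar>q x a u - q x a v\<bar> \<le> \<alpha> * d * w x"
    using q_bound[of d "\<lambda>y. u y - v y" x a] q_diff[OF u v] by simp
  then show "\<bar>E \<rho> u (x, a) - E \<rho> v (x, a)\<bar> \<le> \<alpha> * d * w x" by (simp add: E_def)
qed

text \<open>Multiplication by \<open>w\<close> identifies bounded continuous functions with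
  continuous functions of finite weighted norm. The sup metric of a complete space thus becomes the
  weighted one, and the Banach fixed point theorem applies.\<close>

definition scaled :: "('x \<Rightarrow>\<^sub>C real) \<Rightarrow> 'x \<Rightarrow> real" where
  "scaled v x = apply_bcontfun v x * w x"

lemma scaled_wb: "wb (norm v) (scaled v)"
proof -
  have "\<bar>apply_bcontfun v x * w x\<bar> \<le> norm v * w x" for x
    using norm_bounded[of v x] w_ge1[of x] by (simp add: abs_mult mult_right_mono)
  moreover have "continuous_on UNIV (scaled v)"
    unfolding scaled_def[abs_def] by (intro continuous_intros w_cont) auto
  ultimately show ?thesis by (auto simp: wb_def scaled_def intro: borel_measurable_continuous_onI)
qed

definition bellman :: "real \<Rightarrow> ('x \<Rightarrow>\<^sub>C real) \<Rightarrow> ('x \<Rightarrow>\<^sub>C real)" where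
  "bellman \<rho> v = Bcontfun (\<lambda>x. T \<rho> (scaled v) x / w x)"

lemma bellman_apply: "apply_bcontfun (bellman \<rho> v) x = T \<rho> (scaled v) x / w x"
proof -
  have w0: "w x \<noteq> 0" for x using w_ge1[of x] by linarith
  have "(\<lambda>x. T \<rho> (scaled v) x / w x) \<in> bcontfun"
  proof (rule bcontfun_normI)
    show "continuous_on UNIV (\<lambda>x. T \<rho> (scaled v) x / w x)"
      using w0 by (intro continuous_intros T_cont[OF scaled_wb] w_cont) auto
    show "norm (T \<rho> (scaled v) x / w x) \<le> B + \<bar>\<rho>\<bar> + \<alpha> * norm v" for x
      using T_bound[OF scaled_wb, of \<rho> v x] w_ge1[of x] by (simp add: field_simps)
  qed
  then show ?thesis unfolding bellman_def by (simp add: Bcontfun_inverse)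
qed

lemma scaled_diff: "\<bar>scaled u y - scaled v y\<bar> \<le> dist u v * w y"
proof -
  have "\<bar>scaled u y - scaled v y\<bar> = dist (apply_bcontfun u y) (apply_bcontfun v y) * w y"
    using w_ge1[of y] by (simp add: scaled_def dist_real_def abs_mult flip: left_diff_distrib)
  also have "\<dots> \<le> dist u v * w y"
    using dist_bounded[of u y v] w_ge1[of y] by (intro mult_right_mono) auto
  finally show ?thesis .
qed

lemma bellman_contract: "dist (bellman \<rho> u) (bellman \<rho> v) \<le> \<alpha> * dist u v"
proof (rule dist_bound)
  fix x
  have "\<bar>T \<rho> (scaled u) x - T \<rho> (scaled v) x\<bar> \<le> \<alpha> * dist u v * w x"
    by (rule T_contract[OF scaled_wb scaled_wb scaled_diff])
  then show "dist (apply_bcontfun (bellman \<rho> u) x) (apply_bcontfun (bellman \<rho> v) x) \<le> \<alpha> * dist u v"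
    using w_ge1[of x] by (simp add: bellman_apply dist_real_def field_simps flip: diff_divide_distrib)
qed

lemma bellman_shift: "dist (bellman \<rho> u) (bellman \<rho>' u) \<le> \<bar>\<rho> - \<rho>'\<bar>"
proof (rule dist_bound)
  fix x
  have "\<bar>T \<rho> (scaled u) x - T \<rho>' (scaled u) x\<bar> \<le> \<bar>\<rho> - \<rho>'\<bar>"
    unfolding T_def by (rule abs_diff_INF_le[OF E_bdd[OF scaled_wb] E_bdd[OF scaled_wb]]) (simp add: E_def)
  also have "\<dots> \<le> \<bar>\<rho> - \<rho>'\<bar> * w x" using mult_left_mono[OF w_ge1[of x], of "\<bar>\<rho> - \<rho>'\<bar>"] by simp
  finally show "dist (apply_bcontfun (bellman \<rho> u) x) (apply_bcontfun (bellman \<rho>' u) x) \<le> \<bar>\<rho> - \<rho>'\<bar>"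
    using w_ge1[of x] by (simp add: bellman_apply dist_real_def field_simps flip: diff_divide_distrib)
qed

lemma bellman_fixed: "\<exists>v. bellman \<rho> v = v"
  using banach_fix_type[of \<alpha> "bellman \<rho>"] bellman_contract \<alpha> by auto

definition vfix :: "real \<Rightarrow> 'x \<Rightarrow>\<^sub>C real" where "vfix \<rho> = (SOME v. bellman \<rho> v = v)"

definition h :: "real \<Rightarrow> 'x \<Rightarrow> real" where "h \<rho> = scaled (vfix \<rho>)"

lemma bellman_vfix: "bellman \<rho> (vfix \<rho>) = vfix \<rho>"
  unfolding vfix_def by (rule someI_ex[OF bellman_fixed])

lemma h_wb: "wb (norm (vfix \<rho>)) (h \<rho>)"
  unfolding h_def by (rule scaled_wb)

lemma h_eq: "h \<rho> x = T \<rho> (h \<rho>) x"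
proof -
  have "apply_bcontfun (vfix \<rho>) x = T \<rho> (h \<rho>) x / w x"
    using bellman_apply[of \<rho> "vfix \<rho>" x] by (simp add: bellman_vfix h_def)
  then show ?thesis using w_ge1[of x] by (simp add: h_def scaled_def field_simps)
qed

text \<open>The usual perturbation bound for fixed points of contractions; it yields the continuity
  in \<open>\<rho>\<close> needed for the intermediate value theorem.\<close>

lemma vfix_lipschitz: "dist (vfix \<rho>) (vfix \<rho>') \<le> \<bar>\<rho> - \<rho>'\<bar> / (1 - \<alpha>)"
proof -
  have "dist (vfix \<rho>) (vfix \<rho>') \<le> dist (bellman \<rho> (vfix \<rho>)) (bellman \<rho> (vfix \<rho>')) + dist (bellman \<rho> (vfix \<rho>')) (bellman \<rho>' (vfix \<rho>'))"
    by (simp add: bellman_vfix dist_triangle)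
  also have "\<dots> \<le> \<alpha> * dist (vfix \<rho>) (vfix \<rho>') + \<bar>\<rho> - \<rho>'\<bar>"
    by (intro add_mono bellman_contract bellman_shift)
  finally show ?thesis using \<alpha> by (simp add: field_simps)
qed

lemma h_integral_lipschitz: "\<bar>(\<integral>x. h \<rho> x \<partial>\<eta>) - (\<integral>x. h \<rho>' x \<partial>\<eta>)\<bar> \<le> b / (1 - \<alpha>) * \<bar>\<rho> - \<rho>'\<bar>"
proof -
  have "\<bar>(\<integral>x. h \<rho> x \<partial>\<eta>) - (\<integral>x. h \<rho>' x \<partial>\<eta>)\<bar> = \<bar>\<integral>x. h \<rho> x - h \<rho>' x \<partial>\<eta>\<bar>"
    using wb_int[OF h_wb] by simp
  also have "\<dots> \<le> (\<integral>x. \<bar>h \<rho> x - h \<rho>' x\<bar> \<partial>\<eta>)" by (rule integral_abs_bound)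
  also have "\<dots> \<le> (\<integral>x. \<bar>\<rho> - \<rho>'\<bar> / (1 - \<alpha>) * w x \<partial>\<eta>)"
  proof (rule integral_mono)
    show "integrable \<eta> (\<lambda>x. \<bar>h \<rho> x - h \<rho>' x\<bar>)" using wb_int[OF h_wb] by simp
    show "integrable \<eta> (\<lambda>x. \<bar>\<rho> - \<rho>'\<bar> / (1 - \<alpha>) * w x)" using \<eta>_int by simp
    fix x
    have "\<bar>h \<rho> x - h \<rho>' x\<bar> \<le> dist (vfix \<rho>) (vfix \<rho>') * w x" unfolding h_def by (rule scaled_diff)
    also have "\<dots> \<le> \<bar>\<rho> - \<rho>'\<bar> / (1 - \<alpha>) * w x"
      using w_ge1[of x] by (intro mult_right_mono vfix_lipschitz) auto
    finally show "\<bar>h \<rho> x - h \<rho>' x\<bar> \<le> \<bar>\<rho> - \<rho>'\<bar> / (1 - \<alpha>) * w x" .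
  qed
  also have "\<dots> = b / (1 - \<alpha>) * \<bar>\<rho> - \<rho>'\<bar>" by (simp add: b_def)
  finally show ?thesis .
qed

section \<open>Choice of the constant that normalises the fixed point\<close>

text \<open>A maximum principle: iterating the hypothesis gives \<open>u \<le> C \<alpha>\<^sup>i w\<close> for every \<open>i\<close>.\<close>

lemma subsolution_nonpos:
  assumes u: "wb C u" and sub: "\<And>x e. e > 0 \<Longrightarrow> \<exists>a. u x \<le> q x a u + e"
  shows "u x \<le> 0"
proof -
  have C: "0 \<le> C" by (rule wb_nonneg[OF u])
  have le: "u y \<le> \<alpha> ^ i * C * w y" for i y
  proof (induction i arbitrary: y)
    case 0
    then show ?case using u by (auto simp: wb_def abs_le_iff)
  next
    case (Suc i)
    have wi: "wb (\<alpha> ^ i * C) (\<lambda>y. \<alpha> ^ i * C * w y)"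
      using wb_w w_ge1 C \<alpha> by (auto simp: wb_def abs_mult)
    show ?case
    proof (rule field_le_epsilon)
      fix e :: real assume "e > 0"
      then obtain a where a: "u y \<le> q y a u + e" using sub by blast
      have "q y a u \<le> q y a (\<lambda>y. \<alpha> ^ i * C * w y)" by (rule q_mono[OF u wi Suc.IH])
      also have "\<dots> = \<alpha> ^ i * C * q y a w" by (rule q_cmult)
      also have "\<dots> \<le> \<alpha> ^ i * C * (\<alpha> * w y)" using q_w C \<alpha> by (intro mult_left_mono) auto
      finally show "u y \<le> \<alpha> ^ Suc i * C * w y + e" using a by (simp add: mult_ac)
    qed
  qed
  have "(\<lambda>i. \<alpha> ^ i * C * w x) \<longlonglongrightarrow> 0 * C * w x"
    using \<alpha> by (intro tendsto_intros LIMSEQ_power_zero) auto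
  then show ?thesis using LIMSEQ_le_const[of _ "0 * C * w x" "u x"] le by auto
qed

text \<open>Using a near-minimiser for \<open>\<rho>\<close> also for \<open>\<rho>'\<close> shows
  that the difference \<open>d\<close> is a subsolution with slack \<open>\<rho>' - \<rho>\<close>.
  The maximum principle first gives \<open>d \<le> 0\<close>; then positivity of \<open>q\<close>
  removes the term in \<open>d\<close>, and the slack remains.\<close>

lemma h_decreasing:
  assumes "\<rho> \<le> \<rho>'" shows "h \<rho>' x \<le> h \<rho> x - (\<rho>' - \<rho>)"
proof -
  define d where "d y = h \<rho>' y - h \<rho> y" for y
  have d: "wb (norm (vfix \<rho>') + norm (vfix \<rho>)) d"
    unfolding d_def by (rule wb_diff[OF h_wb h_wb])
  have step: "\<exists>a. d y \<le> q y a d + e - (\<rho>' - \<rho>)" if e: "e > 0" for y e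
  proof -
    obtain a where a: "E \<rho> (h \<rho>) (y, a) < h \<rho> y + e" using T_near[OF e, of \<rho> "h \<rho>" y] h_eq[of \<rho> y] by auto
    have "h \<rho>' y \<le> E \<rho>' (h \<rho>') (y, a)" using T_lower[OF h_wb, of \<rho>' \<rho>' y a] h_eq[of \<rho>' y] by simp
    then have "d y \<le> q y a (h \<rho>') - q y a (h \<rho>) + e - (\<rho>' - \<rho>)"
      using a by (simp add: d_def E_def)
    then show ?thesis unfolding d_def[abs_def] q_diff[OF h_wb h_wb] by blast
  qed
  have "\<exists>a. d y \<le> q y a d + e" if e: "e > 0" for y e
  proof -
    obtain a where "d y \<le> q y a d + e - (\<rho>' - \<rho>)" using step[OF e] by blast
    with assms have "d y \<le> q y a d + e" by linarith
    then show ?thesis ..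
  qed
  then have neg: "d y \<le> 0" for y by (rule subsolution_nonpos[OF d])
  have "d x \<le> - (\<rho>' - \<rho>)"
  proof (rule field_le_epsilon)
    fix e :: real assume "e > 0"
    then obtain a where a: "d x \<le> q x a d + e - (\<rho>' - \<rho>)" using step by blast
    have "q x a d \<le> q x a (\<lambda>y. 0 * w y)"
      by (rule q_mono[OF d, of 0]) (use neg in \<open>auto simp: wb_def\<close>)
    also have "\<dots> = 0" by (simp only: q_cmult)
    finally show "d x \<le> - (\<rho>' - \<rho>) + e" using a by simp
  qed
  then show ?thesis by (simp add: d_def)
qed

lemma h_integral_zero: "\<exists>\<rho>. (\<integral>x. h \<rho> x \<partial>\<eta>) = 0"
proof -
  interpret e: prob_space \<eta> using \<eta> by (simp add: space_prob_algebra)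
  define G where "G \<rho> = (\<integral>x. h \<rho> x \<partial>\<eta>)" for \<rho>
  have dec: "G \<rho>' \<le> G \<rho> - (\<rho>' - \<rho>)" if "\<rho> \<le> \<rho>'" for \<rho> \<rho>'
  proof -
    have "G \<rho>' \<le> (\<integral>x. h \<rho> x - (\<rho>' - \<rho>) \<partial>\<eta>)"
      unfolding G_def using wb_int[OF h_wb] h_decreasing[OF that] by (intro integral_mono) auto
    also have "\<dots> = G \<rho> - (\<rho>' - \<rho>)" using wb_int[OF h_wb] by (simp add: G_def e.prob_space)
    finally show ?thesis .
  qed
  have cont: "isCont G \<rho>" for \<rho>
  proof -
    have "((\<lambda>r. b / (1 - \<alpha>) * \<bar>r - \<rho>\<bar>) \<longlongrightarrow> b / (1 - \<alpha>) * \<bar>\<rho> - \<rho>\<bar>) (at \<rho>)" by (intro tendsto_intros)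
    then have "((\<lambda>r. b / (1 - \<alpha>) * \<bar>r - \<rho>\<bar>) \<longlongrightarrow> 0) (at \<rho>)" by simp
    then have "((\<lambda>r. G r - G \<rho>) \<longlongrightarrow> 0) (at \<rho>)"
      by (rule Lim_null_comparison[rotated]) (use h_integral_lipschitz in \<open>simp add: G_def\<close>)
    then show ?thesis unfolding isCont_def using LIM_zero_cancel by blast
  qed
  \<comment> \<open>The mean falls with slope at least 1 in absolute value, so moving by
    \<open>\<bar>G 0\<bar>\<close> to either side of 0 is enough for a change of sign.\<close>
  have "G \<bar>G 0\<bar> \<le> 0" "0 \<le> G (- \<bar>G 0\<bar>)" using dec[of 0 "\<bar>G 0\<bar>"] dec[of "- \<bar>G 0\<bar>" 0] by auto
  then show ?thesis
    using IVT2[of G "\<bar>G 0\<bar>" 0 "- \<bar>G 0\<bar>"] cont by (auto simp: G_def)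
qed

text \<open>The constant is the one whose fixed point has \<open>\<eta>\<close>-mean zero. The lower
  bound is verification against all policies; the upper bound takes an \<open>e\<close>-minimising
  selector and lets \<open>e\<close> tend to zero.\<close>

lemma stationary_near_optimal:
  obtains \<rho> where "\<And>x. value_function M x = ereal \<rho>"
    "\<And>e. e > 0 \<Longrightarrow> \<exists>f\<in>stationary_policies M. \<forall>x. average_cost M (stationary M f) x \<le> ereal (\<rho> + e)"
proof -
  obtain \<rho> where zero: "(\<integral>x. h \<rho> x \<partial>\<eta>) = 0" using h_integral_zero by blast
  have hm: "h \<rho> \<in> borel_measurable (state_space M)" and hb: "\<bar>h \<rho> y\<bar> \<le> norm (vfix \<rho>) * w y" for y
    using h_wb[of \<rho>] by (auto simp: wb_def state_borel)
  define G where "G z = cost M (fst z) (snd z) + (\<integral>y. h \<rho> y \<partial>kernel M (fst z) (snd z))" for z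
  have GE: "G z = E \<rho> (h \<rho>) z + \<rho>" for z by (simp add: G_def E_def q_def sub_op_def zero)
  have Gc: "continuous_on UNIV G" unfolding G_def by (intro continuous_intros cost_cont kernel_cont'[OF h_wb])
  have lower: "\<rho> + h \<rho> y \<le> G (y, a)" for y a
    using T_lower[OF h_wb, of \<rho> \<rho> y a] h_eq[of \<rho> y] by (simp add: GE)
  have near: "\<exists>f\<in>stationary_policies M. \<forall>x. average_cost M (stationary M f) x \<le> ereal (\<rho> + e)" if e: "e > 0" for e
  proof -
    \<comment> \<open>An elementary measurable selection: by continuity the strict
      \<open>e\<close>-minimisers form a nonempty open set, which meets the countable dense set, and
      the least index of a hit depends measurably on the state.\<close>
    obtain A :: "'a set" where A: "countable A" "\<And>X. open X \<Longrightarrow> X \<noteq> {} \<Longrightarrow> \<exists>d\<in>A. d \<in> X"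
      using countable_dense_exists by blast
    have "A \<noteq> {}" using A(2)[of UNIV] by auto
    define d where "d = from_nat_into A"
    have ex: "\<exists>i. G (y, d i) < \<rho> + h \<rho> y + e" for y
    proof -
      have "open {a. G (y, a) < \<rho> + h \<rho> y + e}"
        by (intro open_Collect_less continuous_on_compose2[OF Gc] continuous_intros) auto
      moreover obtain a where "G (y, a) < \<rho> + h \<rho> y + e"
        using T_near[OF e, of \<rho> "h \<rho>" y] h_eq[of \<rho> y] by (auto simp: GE algebra_simps)
      ultimately obtain a where "a \<in> A" "G (y, a) < \<rho> + h \<rho> y + e" using A(2) by blast
      then show ?thesis using from_nat_into_surj[OF A(1)] unfolding d_def by metis
    qed
    define f where "f y = d (LEAST i. G (y, d i) < \<rho> + h \<rho> y + e)" for y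
    have fG: "G (y, f y) < \<rho> + h \<rho> y + e" for y unfolding f_def by (rule LeastI_ex[OF ex])
    have f: "f \<in> stationary_policies M"
    proof -
      have Gm: "(\<lambda>y. G (y, d i)) \<in> borel_measurable borel" for i
        by (intro borel_measurable_continuous_onI continuous_on_compose2[OF Gc] continuous_intros) auto
      have "(\<lambda>y. LEAST i. G (y, d i) < \<rho> + h \<rho> y + e) \<in> borel \<rightarrow>\<^sub>M count_space UNIV"
        using Gm hm unfolding state_borel by measurable
      then show ?thesis
        unfolding stationary_policies_def state_borel action_borel f_def[abs_def]
        by (rule measurable_compose) simp
    qed
    have "average_cost M (stationary M f) x \<le> ereal (\<rho> + e)" for x
      by (rule average_cost_stationary_le[OF f _ hm hb])
        (use fG in \<open>auto simp: state_borel G_def algebra_simps less_imp_le\<close>)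
    then show ?thesis using f by blast
  qed
  have "value_function M x = ereal \<rho>" for x
  proof (rule antisym)
    show "ereal \<rho> \<le> value_function M x"
      unfolding value_function_def
      by (intro INF_greatest average_cost_ge[OF _ _ hm hb]) (use lower in \<open>auto simp: state_borel G_def\<close>)
    show "value_function M x \<le> ereal \<rho>"
    proof (rule ereal_le_epsilon2)
      fix e :: real assume "0 < e"
      then obtain f where f: "f \<in> stationary_policies M" "average_cost M (stationary M f) x \<le> ereal (\<rho> + e)"
        using near by blast
      then have "value_function M x \<le> average_cost M (stationary M f) x"
        unfolding value_function_def by (intro INF_lower stationary_in_policies)
      with f(2) show "value_function M x \<le> ereal \<rho> + ereal e" by simp
    qed
  qed
  with near show ?thesis using that by blast
qed

end

subsection \<open>Truncation to a compact set\<close>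

text \<open>\<open>\<tau>\<close> is an upper bound rather than the supremum itself, which keeps
  suprema out of the estimates.\<close>

locale truncation = continuous_drift_mdp M w \<eta> \<phi> \<alpha> B
  for M :: "('x::{metric_space, second_countable_topology},
               'a::{metric_space, second_countable_topology}) mdp"
    and w \<eta> \<phi> \<alpha> B +
  fixes K :: "'x set" and \<Delta> :: 'x and \<nu> :: "'x measure" and \<gamma> \<tau> \<sigma> :: real
  assumes K: "compact K" and \<Delta>: "\<Delta> \<notin> K"
    and \<nu>: "prob_space \<nu>" "sets \<nu> = sets borel" "measure \<nu> (- K) = 1" "set_integrable \<nu> (- K) w"
    and \<gamma>: "\<gamma> = (LINT y:- K|\<nu>. w y)"
    and \<tau>: "\<And>x a. (LINT y:- K|kernel M x a. \<gamma> - w y) \<le> \<tau>" "0 \<le> \<tau>"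
    and \<sigma>: "\<sigma> = (LINT y:- K|\<eta>. w y)"
begin

definition N :: "('x, 'a) mdp" where "N = compact_mdp M K \<Delta> \<nu>"
definition \<eta>' :: "'x measure" where "\<eta>' = lump borel K \<Delta> \<eta>"
text \<open>Off \<open>K\<close> both this weight and \<open>\<phi>'\<close> take the
  \<open>\<nu>\<close>-mean of the original function, so that drift and minorization at the
  pseudo-state arise by integrating the original ones against \<open>\<nu>\<close>. Being constant
  in the state off \<open>K\<close>, they satisfy these inequalities at every
  \<open>x\<close>.\<close>

definition w' :: "'x \<Rightarrow> real" where "w' x = (if x \<in> K then w x else \<gamma>)"
definition \<phi>' :: "'x \<Rightarrow> 'a \<Rightarrow> real" where "\<phi>' x a = (if x \<in> K then \<phi> x a else (\<integral>z. \<phi> z a \<partial>\<nu>))"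
definition l :: "'x \<Rightarrow> 'x" where "l y = (if y \<in> K then y else \<Delta>)"

abbreviation "S' \<equiv> lumped_space borel K \<Delta>"

lemma K_sets [measurable]: "K \<in> sets borel" using K by (simp add: compact_imp_closed borel_closed)

lemma state_N: "state_space N = S'" and action_N: "action_space N = borel"
  by (simp_all add: N_def compact_mdp_def state_borel action_borel)

lemma space_S': "space S' = insert \<Delta> K" by (simp add: lumped_space_def space_restrict_space)

lemma l_meas [measurable]: "l \<in> borel \<rightarrow>\<^sub>M S'"
  using measurable_lump_map[of K borel \<Delta>] by (simp add: l_def[abs_def])

lemma id_meas: "(\<lambda>x. x) \<in> S' \<rightarrow>\<^sub>M borel"
  unfolding lumped_space_def by (rule measurable_restrict_space1) simp

lemma K_S' [measurable]: "K \<in> sets S'"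
  by (subst sets_lumped_space) auto

lemma lump_eq: "lump borel K \<Delta> \<mu> = distr \<mu> S' l"
  by (simp add: lump_def l_def[abs_def])

lemma lump_meas: "lump borel K \<Delta> \<in> prob_algebra borel \<rightarrow>\<^sub>M prob_algebra S'"
  by (rule measurable_lump) auto

lemma kernel_borel: "(\<lambda>z. kernel M (fst z) (snd z)) \<in> borel \<Otimes>\<^sub>M borel \<rightarrow>\<^sub>M prob_algebra borel"
  using kernel_meas by (simp add: state_borel action_borel)

lemma kernel_space: "kernel M x a \<in> space (prob_algebra borel)"
  using measurable_space[OF kernel_borel, of "(x, a)"] by (simp add: space_pair_measure)

lemma prob_kernel: "prob_space (kernel M x a)" and sets_kernel_M [measurable_cong, simp]: "sets (kernel M x a) = sets borel"
  and space_kernel_M [simp]: "space (kernel M x a) = UNIV"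
  using kernel_space[of x a] by (auto simp: space_prob_algebra dest: sets_eq_imp_space_eq)

lemma prob_\<eta>: "prob_space \<eta>" and sets_\<eta> [measurable_cong, simp]: "sets \<eta> = sets borel"
  and space_\<eta> [simp]: "space \<eta> = UNIV"
  using \<eta> by (auto simp: space_prob_algebra state_borel dest: sets_eq_imp_space_eq)

lemma w_borel [measurable]: "w \<in> borel_measurable borel" using w_meas by (simp add: state_borel)

lemma w_int_kernel: "integrable (kernel M x a) w" using w_int by (simp add: state_borel action_borel)

lemma \<nu>_space: "\<nu> \<in> space (prob_algebra borel)" using \<nu> by (simp add: space_prob_algebra)

lemma space_\<nu> [simp]: "space \<nu> = UNIV" using sets_eq_imp_space_eq[OF \<nu>(2)] by simp

declare \<nu>(2) [measurable_cong, simp]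

lemma AE_\<nu>: "AE z in \<nu>. z \<notin> K"
proof -
  interpret prob_space \<nu> by (rule \<nu>(1))
  have "AE z in \<nu>. z \<in> - K" using \<nu>(3) by (subst (asm) prob_eq_1) auto
  then show ?thesis by simp
qed

lemma set_integral_\<nu>:
  fixes g :: "'x \<Rightarrow> real"
  assumes [measurable]: "g \<in> borel_measurable borel"
  shows "(LINT z:- K|\<nu>. g z) = (\<integral>z. g z \<partial>\<nu>)"
  unfolding set_lebesgue_integral_def
  by (rule integral_cong_AE) (use AE_\<nu> in \<open>auto elim!: eventually_mono\<close>)

lemma w_int_\<nu>: "integrable \<nu> w"
proof -
  have "integrable \<nu> (\<lambda>z. indicator (- K) z *\<^sub>R w z)" using \<nu>(4) by (simp add: set_integrable_def)
  moreover have "AE z in \<nu>. indicator (- K) z *\<^sub>R w z = w z"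
    using AE_\<nu> by eventually_elim simp
  ultimately show ?thesis by (subst (asm) integrable_cong_AE) auto
qed

lemma \<gamma>_eq: "\<gamma> = (\<integral>z. w z \<partial>\<nu>)" using \<gamma> set_integral_\<nu>[OF w_borel] by simp

lemma \<gamma>_ge1: "1 \<le> \<gamma>"
proof -
  interpret prob_space \<nu> by (rule \<nu>(1))
  have "(\<integral>z. 1 \<partial>\<nu>) \<le> (\<integral>z. w z \<partial>\<nu>)"
    by (rule integral_mono[OF _ w_int_\<nu>]) (auto simp: w_ge1)
  then show ?thesis using \<gamma>_eq prob_space by simp
qed

lemma w'_ge1: "1 \<le> w' x" using w_ge1 \<gamma>_ge1 by (simp add: w'_def)

lemma w'_meas: "w' \<in> borel_measurable S'"
proof -
  have "w \<in> borel_measurable S'" using measurable_compose[OF id_meas w_borel] by simp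
  then show ?thesis unfolding w'_def[abs_def] by measurable
qed

lemma bounded_on_S': "\<exists>C. \<forall>x. \<bar>w' x\<bar> \<le> C"
proof -
  obtain C where C: "\<And>x. x \<in> K \<Longrightarrow> \<bar>w x\<bar> \<le> C"
    using compact_imp_bounded[OF compact_continuous_image[OF continuous_on_subset[OF w_cont] K]]
    by (auto simp: bounded_iff)
  then have "\<bar>w' x\<bar> \<le> max C \<bar>\<gamma>\<bar>" for x by (auto simp: w'_def le_max_iff_disj)
  then show ?thesis by blast
qed

lemma w'_integrable:
  assumes "prob_space \<mu>" "sets \<mu> = sets S'" shows "integrable \<mu> w'"
proof -
  interpret prob_space \<mu> by fact
  obtain C where "\<And>x. \<bar>w' x\<bar> \<le> C" using bounded_on_S' by blast
  then show ?thesis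
    by (intro integrable_const_bound[of _ C])
      (use w'_meas in \<open>auto simp: measurable_cong_sets[OF assms(2) refl]\<close>)
qed

lemma kernel_N_K: "x \<in> K \<Longrightarrow> kernel N x a = lump borel K \<Delta> (kernel M x a)"
  and kernel_N_\<Delta>: "x \<notin> K \<Longrightarrow> kernel N x a = \<nu> \<bind> (\<lambda>z. lump borel K \<Delta> (kernel M z a))"
  by (simp_all add: N_def compact_mdp_def state_borel)

lemma cost_N_K: "x \<in> K \<Longrightarrow> cost N x a = cost M x a"
  and cost_N_\<Delta>: "x \<notin> K \<Longrightarrow> cost N x a = (LINT z:- K|\<nu>. cost M z a)"
  by (simp_all add: N_def compact_mdp_def)

lemma Pair_id_meas: "(\<lambda>z. (fst z, snd z)) \<in> S' \<Otimes>\<^sub>M borel \<rightarrow>\<^sub>M borel \<Otimes>\<^sub>M (borel :: 'a measure)"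
  by (intro measurable_Pair measurable_compose[OF measurable_fst id_meas] measurable_snd)

lemma fst_in_K: "{z \<in> space (S' \<Otimes>\<^sub>M (borel :: 'a measure)). fst z \<in> K} \<in> sets (S' \<Otimes>\<^sub>M borel)"
  by measurable

lemma cost_borel: "(\<lambda>z. cost M (fst z) (snd z)) \<in> borel_measurable (borel \<Otimes>\<^sub>M borel)"
  using cost_meas by (simp add: state_borel action_borel)

lemma \<phi>_borel: "(\<lambda>z. \<phi> (fst z) (snd z)) \<in> borel_measurable (borel \<Otimes>\<^sub>M borel)"
  using \<phi>_meas by (simp add: state_borel action_borel case_prod_beta')

lemma integral_\<nu>_meas:
  fixes g :: "'x \<Rightarrow> 'a \<Rightarrow> real"
  assumes g: "(\<lambda>z. g (fst z) (snd z)) \<in> borel_measurable (borel \<Otimes>\<^sub>M borel)"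
  shows "(\<lambda>a. \<integral>z. g z a \<partial>\<nu>) \<in> borel_measurable borel"
proof -
  interpret prob_space \<nu> by (rule \<nu>(1))
  have "(\<lambda>z. g (snd z) (fst z)) \<in> borel_measurable (borel \<Otimes>\<^sub>M borel)"
    using measurable_compose[OF measurable_Pair[OF measurable_snd measurable_fst] g] by simp
  then have "(\<lambda>(a, z). g z a) \<in> borel_measurable (borel \<Otimes>\<^sub>M \<nu>)"
    by (simp add: case_prod_beta' cong: measurable_cong_sets)
  then show ?thesis by (rule borel_measurable_lebesgue_integral)
qed

lemma section_meas:
  fixes g :: "'x \<Rightarrow> 'a \<Rightarrow> real"
  assumes g: "(\<lambda>z. g (fst z) (snd z)) \<in> borel_measurable (borel \<Otimes>\<^sub>M borel)"
  shows "(\<lambda>z. g z a) \<in> borel_measurable borel"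
proof -
  have "(\<lambda>z. (z, a)) \<in> borel \<rightarrow>\<^sub>M borel \<Otimes>\<^sub>M borel" by measurable
  from measurable_compose[OF this g] show ?thesis by simp
qed

lemma truncated_meas:
  fixes g :: "'x \<Rightarrow> 'a \<Rightarrow> real"
  assumes g: "(\<lambda>z. g (fst z) (snd z)) \<in> borel_measurable (borel \<Otimes>\<^sub>M borel)"
  shows "(\<lambda>z. if fst z \<in> K then g (fst z) (snd z) else (\<integral>y. g y (snd z) \<partial>\<nu>)) \<in> borel_measurable (S' \<Otimes>\<^sub>M borel)"
proof (rule measurable_If)
  show "(\<lambda>z. g (fst z) (snd z)) \<in> borel_measurable (S' \<Otimes>\<^sub>M borel)"
    using measurable_compose[OF Pair_id_meas g] by simp
  show "(\<lambda>z. \<integral>y. g y (snd z) \<partial>\<nu>) \<in> borel_measurable (S' \<Otimes>\<^sub>M borel)"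
    by (rule measurable_compose[OF measurable_snd integral_\<nu>_meas[OF g]])
qed (rule fst_in_K)

lemma lump_kernel_meas: "(\<lambda>z. lump borel K \<Delta> (kernel M z a)) \<in> borel \<rightarrow>\<^sub>M prob_algebra S'"
proof -
  have "(\<lambda>z. (z, a)) \<in> borel \<rightarrow>\<^sub>M borel \<Otimes>\<^sub>M borel" by measurable
  from measurable_compose[OF measurable_compose[OF this kernel_borel] lump_meas] show ?thesis by simp
qed

lemma mdp_N: "is_mdp N"
  unfolding is_mdp_def state_N action_N
proof
  have k1: "(\<lambda>z. lump borel K \<Delta> (kernel M (fst z) (snd z))) \<in> borel \<Otimes>\<^sub>M borel \<rightarrow>\<^sub>M prob_algebra S'"
    by (rule measurable_compose[OF kernel_borel lump_meas])
  have "(\<lambda>z. lump borel K \<Delta> (kernel M (snd z) (fst z))) \<in> borel \<Otimes>\<^sub>M borel \<rightarrow>\<^sub>M prob_algebra S'"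
    using measurable_compose[OF measurable_Pair[OF measurable_snd measurable_fst] k1] by simp
  then have k2: "(\<lambda>(a, z). lump borel K \<Delta> (kernel M z a)) \<in> borel \<Otimes>\<^sub>M borel \<rightarrow>\<^sub>M prob_algebra S'"
    by (simp add: case_prod_beta')
  have k3: "(\<lambda>a. \<nu> \<bind> (\<lambda>z. lump borel K \<Delta> (kernel M z a))) \<in> borel \<rightarrow>\<^sub>M prob_algebra S'"
    by (rule measurable_bind_prob_space2[OF _ k2]) (use \<nu>_space in simp)
  have "(\<lambda>z. if fst z \<in> K then lump borel K \<Delta> (kernel M (fst z) (snd z))
      else \<nu> \<bind> (\<lambda>y. lump borel K \<Delta> (kernel M y (snd z)))) \<in> S' \<Otimes>\<^sub>M borel \<rightarrow>\<^sub>M prob_algebra S'"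
  proof (rule measurable_If)
    show "(\<lambda>z. lump borel K \<Delta> (kernel M (fst z) (snd z))) \<in> S' \<Otimes>\<^sub>M borel \<rightarrow>\<^sub>M prob_algebra S'"
      using measurable_compose[OF Pair_id_meas k1] by simp
    show "(\<lambda>z. \<nu> \<bind> (\<lambda>y. lump borel K \<Delta> (kernel M y (snd z)))) \<in> S' \<Otimes>\<^sub>M borel \<rightarrow>\<^sub>M prob_algebra S'"
      by (rule measurable_compose[OF measurable_snd k3])
  qed (rule fst_in_K)
  then show "(\<lambda>(x, a). kernel N x a) \<in> S' \<Otimes>\<^sub>M borel \<rightarrow>\<^sub>M prob_algebra S'"
    by (simp add: N_def compact_mdp_def state_borel case_prod_beta' cong: if_cong)
  have "(\<lambda>(x, a). cost N x a) = (\<lambda>z. if fst z \<in> K then cost M (fst z) (snd z) else (\<integral>y. cost M y (snd z) \<partial>\<nu>))"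
    by (auto simp: fun_eq_iff cost_N_K cost_N_\<Delta> set_integral_\<nu>[OF section_meas[of "cost M", OF cost_borel]])
  then show "(\<lambda>(x, a). cost N x a) \<in> borel_measurable (S' \<Otimes>\<^sub>M borel)"
    using truncated_meas[OF cost_borel] by simp
qed

lemma \<phi>_01: "0 \<le> \<phi> x a" "\<phi> x a \<le> 1"
proof -
  interpret drift_chain borel "\<lambda>y. kernel M y a" w \<eta> "\<lambda>y. \<phi> y a" \<alpha> by (rule const_chain)
  show "0 \<le> \<phi> x a" "\<phi> x a \<le> 1" using \<phi>_nonneg \<phi>_le_one by auto
qed

lemma \<phi>_int_\<nu>: "integrable \<nu> (\<lambda>z. \<phi> z a)"
proof -
  interpret prob_space \<nu> by (rule \<nu>(1))
  show ?thesis
    by (rule integrable_const_bound[of _ 1])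
      (use \<phi>_01 section_meas[of \<phi>, OF \<phi>_borel] in \<open>auto cong: measurable_cong_sets\<close>)
qed

section \<open>Integration over lumped measures\<close>

lemma integral_lump:
  assumes \<mu>: "sets \<mu> = sets borel" and u: "u \<in> borel_measurable S'"
  shows "(\<integral>y. u y \<partial>lump borel K \<Delta> \<mu>) = (\<integral>y. (u (l y) :: real) \<partial>\<mu>)"
  unfolding lump_eq
  by (rule integral_distr[OF _ u]) (use l_meas in \<open>simp cong: measurable_cong_sets[OF \<mu> refl]\<close>)

lemma integral_kernel_N_\<Delta>:
  fixes g :: "'x \<Rightarrow> real"
  assumes x: "x \<notin> K" and g: "g \<in> borel_measurable S'" and bnd: "\<And>y. y \<in> space S' \<Longrightarrow> \<bar>g y\<bar> \<le> C"
  shows "(\<integral>y. g y \<partial>kernel N x a) = (\<integral>z. (\<integral>y. g (l y) \<partial>kernel M z a) \<partial>\<nu>)"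
    and "integrable \<nu> (\<lambda>z. \<integral>y. g (l y) \<partial>kernel M z a)"
proof -
  interpret prob_space \<nu> by (rule \<nu>(1))
  have \<kappa>: "(\<lambda>z. lump borel K \<Delta> (kernel M z a)) \<in> \<nu> \<rightarrow>\<^sub>M subprob_algebra S'"
    using measurable_prob_algebraD[OF lump_kernel_meas] by (simp cong: measurable_cong_sets)
  have pl: "prob_space (lump borel K \<Delta> (kernel M z a))" for z
    using measurable_space[OF lump_kernel_meas, of z] by (simp add: space_prob_algebra)
  have 1: "integrable (lump borel K \<Delta> (kernel M z a)) (\<lambda>_. C)"
    and 2: "(\<integral>y. C \<partial>lump borel K \<Delta> (kernel M z a)) \<le> C" for z
  proof -
    interpret p: prob_space "lump borel K \<Delta> (kernel M z a)" by (rule pl)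
    show "integrable (lump borel K \<Delta> (kernel M z a)) (\<lambda>_. C)"
      "(\<integral>y. C \<partial>lump borel K \<Delta> (kernel M z a)) \<le> C" by (simp_all add: p.prob_space)
  qed
  note bd = integral_bind_dominated[OF \<kappa> not_empty g borel_measurable_const bnd 1 2
      finite_measure.integrable_const[OF finite_measure_axioms]]
  show "(\<integral>y. g y \<partial>kernel N x a) = (\<integral>z. (\<integral>y. g (l y) \<partial>kernel M z a) \<partial>\<nu>)"
    unfolding kernel_N_\<Delta>[OF x] using bd(3) by (simp add: integral_lump g)
  show "integrable \<nu> (\<lambda>z. \<integral>y. g (l y) \<partial>kernel M z a)"
    using bd(2) by (simp add: integral_lump g)
qed

section \<open>Drift and minorization in the compact model\<close>

lemma w'_l: "w' (l y) = w y + indicator (- K) y * (\<gamma> - w y)"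
  using \<Delta> by (simp add: w'_def l_def)

text \<open>Lumping replaces \<open>w\<close> by \<open>\<gamma>\<close> off \<open>K\<close>; the
  resulting excess is the very integral that \<open>\<tau>\<close> bounds.\<close>

lemma w'_kernel_le: "(\<integral>y. w' (l y) \<partial>kernel M x a) \<le> \<alpha> * w x + (\<integral>y. w y \<partial>\<eta>) * \<phi> x a + \<tau>"
proof -
  interpret k: prob_space "kernel M x a" by (rule prob_kernel)
  have i: "integrable (kernel M x a) (\<lambda>y. indicator (- K) y * (\<gamma> - w y))"
    using integrable_mult_indicator[of "- K" "kernel M x a" "\<lambda>y. \<gamma> - w y"] w_int_kernel by auto
  have "(\<integral>y. w' (l y) \<partial>kernel M x a) = (\<integral>y. w y \<partial>kernel M x a) + (LINT y:- K|kernel M x a. \<gamma> - w y)"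
    unfolding w'_l set_lebesgue_integral_def using i w_int_kernel by simp
  then show ?thesis using \<tau>(1)[of x a] drift[of x a] by (simp add: state_borel action_borel)
qed

lemma \<eta>'_space: "\<eta>' \<in> space (prob_algebra S')"
  unfolding \<eta>'_def using measurable_space[OF lump_meas, of \<eta>] \<eta> by (simp add: state_borel)

lemma prob_\<eta>': "prob_space \<eta>'" and sets_\<eta>': "sets \<eta>' = sets S'"
  using \<eta>'_space by (auto simp: space_prob_algebra)

text \<open>Off \<open>K\<close> the lumped weight is nonnegative, so at worst the part
  \<open>\<sigma>\<close> of the mean of \<open>w\<close> is lost.\<close>

lemma w'_\<eta>'_ge: "(\<integral>y. w y \<partial>\<eta>) - \<sigma> \<le> (\<integral>y. w' y \<partial>\<eta>')"
proof -
  interpret e: prob_space \<eta> by (rule prob_\<eta>)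
  have i: "integrable \<eta> (\<lambda>y. indicator (- K) y * w y)"
    using integrable_mult_indicator[of "- K" \<eta> w] \<eta>_int by auto
  have j: "integrable \<eta> (\<lambda>y. indicator (- K) y * (\<gamma> - w y))"
    using integrable_mult_indicator[of "- K" \<eta> "\<lambda>y. \<gamma> - w y"] \<eta>_int by auto
  have "(\<integral>y. w y \<partial>\<eta>) - \<sigma> = (\<integral>y. w y - indicator (- K) y * w y \<partial>\<eta>)"
    unfolding \<sigma> set_lebesgue_integral_def using \<eta>_int i by simp
  also have "\<dots> \<le> (\<integral>y. w' (l y) \<partial>\<eta>)"
    unfolding w'_l using \<eta>_int i j \<gamma>_ge1 by (intro integral_mono) (auto split: split_indicator)
  also have "\<dots> = (\<integral>y. w' y \<partial>\<eta>')" unfolding \<eta>'_def by (simp add: integral_lump w'_meas)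
  finally show ?thesis .
qed

lemma \<sigma>_nonneg: "0 \<le> \<sigma>"
  unfolding \<sigma> set_lebesgue_integral_def
  by (rule integral_nonneg_AE)
    (use w_ge1 in \<open>auto intro!: AE_I2 intro: order_trans[OF zero_le_one] split: split_indicator\<close>)

lemma \<phi>'_01: "0 \<le> \<phi>' x a" "\<phi>' x a \<le> 1"
proof -
  interpret prob_space \<nu> by (rule \<nu>(1))
  have "(\<integral>z. \<phi> z a \<partial>\<nu>) \<le> (\<integral>z. 1 \<partial>\<nu>)" using \<phi>_01 \<phi>_int_\<nu> by (intro integral_mono) auto
  moreover have "0 \<le> (\<integral>z. \<phi> z a \<partial>\<nu>)" using \<phi>_01 by (intro integral_nonneg_AE) auto
  ultimately show "0 \<le> \<phi>' x a" "\<phi>' x a \<le> 1" using \<phi>_01 prob_space[simplified] by (auto simp: \<phi>'_def)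
qed

text \<open>Two errors occur: the additive \<open>\<tau>\<close>, and at most
  \<open>\<sigma>\<close> from exchanging the mean of \<open>w\<close> for that of the lumped
  weight. Both are absorbed into the modulus because the weight is at least 1.\<close>

lemma drift_N:
  "(\<integral>y. w' y \<partial>kernel N x a) \<le> (\<alpha> + \<tau> + \<sigma>) * w' x + (\<integral>y. w' y \<partial>\<eta>') * \<phi>' x a" (is "?L \<le> _")
proof -
  have L: "?L \<le> \<alpha> * w' x + (\<integral>y. w y \<partial>\<eta>) * \<phi>' x a + \<tau>"
  proof (cases "x \<in> K")
    case True
    then have "?L = (\<integral>y. w' (l y) \<partial>kernel M x a)"
      by (simp add: kernel_N_K integral_lump w'_meas)
    with True w'_kernel_le[of x a] show ?thesis by (simp add: w'_def \<phi>'_def)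
  next
    case False
    interpret prob_space \<nu> by (rule \<nu>(1))
    obtain C where C: "\<And>x. \<bar>w' x\<bar> \<le> C" using bounded_on_S' by blast
    note i = integral_kernel_N_\<Delta>[OF False w'_meas C]
    have "?L = (\<integral>z. (\<integral>y. w' (l y) \<partial>kernel M z a) \<partial>\<nu>)" by (rule i(1))
    also have "\<dots> \<le> (\<integral>z. \<alpha> * w z + (\<integral>y. w y \<partial>\<eta>) * \<phi> z a + \<tau> \<partial>\<nu>)"
      using w_int_\<nu> \<phi>_int_\<nu> w'_kernel_le by (intro integral_mono[OF i(2)]) auto
    also have "\<dots> = \<alpha> * \<gamma> + (\<integral>y. w y \<partial>\<eta>) * (\<integral>z. \<phi> z a \<partial>\<nu>) + \<tau>"
      using w_int_\<nu> \<phi>_int_\<nu> prob_space by (simp add: \<gamma>_eq)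
    finally show ?thesis using False by (simp add: w'_def \<phi>'_def)
  qed
  have "(\<integral>y. w y \<partial>\<eta>) * \<phi>' x a \<le> ((\<integral>y. w' y \<partial>\<eta>') + \<sigma>) * \<phi>' x a"
    using w'_\<eta>'_ge \<phi>'_01 by (intro mult_right_mono) auto
  moreover have "\<sigma> * \<phi>' x a \<le> \<sigma> * 1" using \<phi>'_01 \<sigma>_nonneg by (intro mult_left_mono) auto
  moreover have "(\<tau> + \<sigma>) * 1 \<le> (\<tau> + \<sigma>) * w' x"
    using w'_ge1 \<sigma>_nonneg \<tau>(2) by (intro mult_left_mono) auto
  ultimately show ?thesis using L by (simp add: algebra_simps)
qed

lemma measure_lump:
  assumes "sets \<mu> = sets borel" "D \<in> sets S'"
  shows "measure (lump borel K \<Delta> \<mu>) D = measure \<mu> (l -` D)"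
  using measure_distr[of l \<mu> S' D] assms sets_eq_imp_space_eq[OF assms(1)]
  by (simp add: lump_eq cong: measurable_cong_sets[OF assms(1) refl])

lemma minor_N:
  assumes D: "D \<in> sets S'"
  shows "measure \<eta>' D * \<phi>' x a \<le> measure (kernel N x a) D"
proof -
  have lD: "l -` D \<in> sets borel" using measurable_sets[OF l_meas D] by simp
  have e: "measure \<eta>' D = measure \<eta> (l -` D)" unfolding \<eta>'_def by (rule measure_lump[OF _ D]) simp
  have base: "measure \<eta> (l -` D) * \<phi> z a \<le> measure (kernel M z a) (l -` D)" for z
    using minor lD by (simp add: state_borel action_borel)
  show ?thesis
  proof (cases "x \<in> K")
    case True
    then show ?thesis using base[of x] by (simp add: \<phi>'_def e kernel_N_K measure_lump D)
  next
    case False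
    interpret prob_space \<nu> by (rule \<nu>(1))
    have \<kappa>: "(\<lambda>z. lump borel K \<Delta> (kernel M z a)) \<in> \<nu> \<rightarrow>\<^sub>M subprob_algebra S'"
      using measurable_prob_algebraD[OF lump_kernel_meas] by (simp cong: measurable_cong_sets)
    have sN: "space (kernel N x a) = space S'"
      unfolding kernel_N_\<Delta>[OF False] by (rule space_bind[OF _ not_empty]) (simp add: lump_eq)
    have ind: "(indicator D :: _ \<Rightarrow> real) \<in> borel_measurable S'" using D by simp
    note i = integral_kernel_N_\<Delta>[OF False ind, of 1 a]
    have li: "(\<lambda>y. indicator D (l y) :: real) = indicator (l -` D)" by (auto simp: indicator_def)
    have "measure \<eta>' D * \<phi>' x a = (\<integral>z. measure \<eta> (l -` D) * \<phi> z a \<partial>\<nu>)" using False by (simp add: e \<phi>'_def)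
    also have "\<dots> \<le> (\<integral>z. (\<integral>y. indicator D (l y) \<partial>kernel M z a) \<partial>\<nu>)"
      using \<phi>_int_\<nu> base i(2) by (intro integral_mono) (auto simp: li lD)
    also have "\<dots> = (\<integral>y. indicator D y \<partial>kernel N x a)" using i(1) by simp
    also have "\<dots> = measure (kernel N x a) D"
      using sets.sets_into_space[OF D] by (simp add: sN Int_absorb2)
    finally show ?thesis .
  qed
qed

lemma cost_bound_N: "\<bar>cost N x a\<bar> \<le> B * w' x"
proof (cases "x \<in> K")
  case True
  then show ?thesis using cost_bound by (simp add: cost_N_K w'_def state_borel action_borel)
next
  case False
  have cm: "(\<lambda>z. cost M z a) \<in> borel_measurable borel" by (rule section_meas[of "cost M", OF cost_borel])
  have cb: "\<bar>cost M z a\<bar> \<le> B * w z" for z using cost_bound by (simp add: state_borel action_borel)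
  have ci: "integrable \<nu> (\<lambda>z. cost M z a)"
    by (rule Bochner_Integration.integrable_bound[of \<nu> "\<lambda>z. B * w z"])
      (use w_int_\<nu> cm in \<open>auto intro!: AE_I2 order_trans[OF cb abs_ge_self] cong: measurable_cong_sets\<close>)
  have "\<bar>\<integral>z. cost M z a \<partial>\<nu>\<bar> \<le> (\<integral>z. \<bar>cost M z a\<bar> \<partial>\<nu>)" by (rule integral_abs_bound)
  also have "\<dots> \<le> (\<integral>z. B * w z \<partial>\<nu>)" using ci w_int_\<nu> cb by (intro integral_mono) auto
  also have "\<dots> = B * \<gamma>" by (simp add: \<gamma>_eq)
  finally show ?thesis using False by (simp add: cost_N_\<Delta> w'_def set_integral_\<nu>[OF cm])
qed

lemma drift_mdp_N:
  assumes le: "\<alpha> + \<tau> + \<sigma> \<le> \<alpha>'" and lt: "\<alpha>' < 1"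
  shows "drift_mdp N w' \<eta>' \<phi>' \<alpha>' B"
proof
  show "is_mdp N" by (rule mdp_N)
  show "w' \<in> borel_measurable (state_space N)" using w'_meas by (simp add: state_N)
  show "1 \<le> w' x" for x by (rule w'_ge1)
  show "integrable \<eta>' w'" by (rule w'_integrable[OF prob_\<eta>' sets_\<eta>'])
  show "\<eta>' \<in> space (prob_algebra (state_space N))" using \<eta>'_space by (simp add: state_N)
  show "0 < \<alpha>'" "\<alpha>' < 1" using le lt \<alpha> \<tau>(2) \<sigma>_nonneg by auto
  show "0 \<le> \<phi>' x a" for x a by (rule \<phi>'_01)
  show "\<bar>cost N x a\<bar> \<le> B * w' x" for x a by (rule cost_bound_N)
  show "measure \<eta>' D * \<phi>' x a \<le> measure (kernel N x a) D" if "D \<in> sets (state_space N)" for x a D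
    using minor_N that by (simp add: state_N)
  show "(\<lambda>(x, a). \<phi>' x a) \<in> borel_measurable (stage_space N)"
    using truncated_meas[OF \<phi>_borel] by (simp add: state_N action_N \<phi>'_def case_prod_beta')
  show "(\<integral>y. w' y \<partial>kernel N x a) \<le> \<alpha>' * w' x + (\<integral>y. w' y \<partial>\<eta>') * \<phi>' x a" for x a
    using drift_N[of x a] mult_right_mono[OF le, of "w' x"] w'_ge1[of x] by linarith
  show "integrable (kernel N x a) w'" if "x \<in> space (state_space N)" "a \<in> space (action_space N)" for x a
  proof (rule w'_integrable)
    have "(\<lambda>z. kernel N (fst z) (snd z)) \<in> stage_space N \<rightarrow>\<^sub>M prob_algebra S'"
      using mdp_N by (simp add: is_mdp_def case_prod_beta' state_N)
    from measurable_space[OF this, of "(x, a)"] that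
    show "prob_space (kernel N x a)" "sets (kernel N x a) = sets S'"
      by (simp_all add: space_pair_measure space_prob_algebra)
  qed
qed

end

subsection \<open>Uniform tails and comparison of integrals\<close>

text \<open>The remainder after \<open>n\<close> terms is \<open>R\<close> applied to
  \<open>(P ^^ n) u\<close>, whose weighted bound has shrunk by \<open>\<alpha> ^ n\<close>.\<close>

lemma (in drift_chain) R_tail:
  assumes u: "wfun C u" and x: "x \<in> space S"
  shows "\<bar>R u x - (\<Sum>i<n. (P ^^ i) u x)\<bar> \<le> \<alpha> ^ n * C / (1 - \<alpha>) * w x"
proof -
  have "R u x - (\<Sum>i<n. (P ^^ i) u x) = R ((P ^^ n) u) x"
    unfolding resolvent_def
    using suminf_minus_initial_segment[OF R_summable[OF u x], of n] by (simp add: funpow_add)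
  then show ?thesis using wfunD(2)[OF R_wfun[OF P_pow_wfun[OF u]] x] by simp
qed

locale approximation = continuous_drift_mdp M w \<eta> \<phi> \<alpha> B
  for M :: "('x::{metric_space, second_countable_topology},
               'a::{metric_space, second_countable_topology}) mdp"
    and w \<eta> \<phi> \<alpha> B +
  fixes K :: "nat \<Rightarrow> 'x set" and \<Delta> :: "nat \<Rightarrow> 'x" and \<nu> :: "nat \<Rightarrow> 'x measure" and \<gamma> \<tau> \<sigma> :: "nat \<Rightarrow> real"
  assumes trunc: "\<And>n. truncation M w \<eta> \<phi> \<alpha> B (K n) (\<Delta> n) (\<nu> n) (\<gamma> n) (\<tau> n) (\<sigma> n)"
    and K_Suc: "\<And>n. K n \<subseteq> K (Suc n)" and K_UN: "(\<Union>n. K n) = UNIV"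
    and lim_\<tau>_\<sigma>: "(\<lambda>n. \<tau> n + \<sigma> n) \<longlonglongrightarrow> 0"
    and positive_minor: "\<exists>x a r. r > 0 \<and> (\<forall>D\<in>sets borel. measure \<eta> D * r \<le> measure (kernel M x a) D)"
begin

sublocale t: truncation M w \<eta> \<phi> \<alpha> B "K n" "\<Delta> n" "\<nu> n" "\<gamma> n" "\<tau> n" "\<sigma> n" for n
  by (rule trunc)

lemma K_mono: "m \<le> n \<Longrightarrow> K m \<subseteq> K n"
  using lift_Suc_mono_le[of K] K_Suc by blast

lemma lim_\<tau>: "\<tau> \<longlonglongrightarrow> 0"
  by (rule tendsto_sandwich[OF _ _ tendsto_const lim_\<tau>_\<sigma>]) (use t.\<tau>(2) t.\<sigma>_nonneg in auto)

definition \<alpha>' :: real where "\<alpha>' = (1 + \<alpha>) / 2"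

lemma \<alpha>': "\<alpha> \<le> \<alpha>'" "0 < \<alpha>'" "\<alpha>' < 1" using \<alpha> by (auto simp: \<alpha>'_def)

text \<open>Marks the indices at which the compact model has the modulus \<open>\<alpha>'\<close>;
  for the others no drift condition is at hand, hence the guards below.\<close>

definition good :: "nat \<Rightarrow> bool" where "good n \<longleftrightarrow> \<alpha> + \<tau> n + \<sigma> n \<le> \<alpha>'"

lemma eventually_good: "\<forall>\<^sub>F n in sequentially. good n"
proof -
  have "\<forall>\<^sub>F n in sequentially. \<tau> n + \<sigma> n < (1 - \<alpha>) / 2"
    by (rule order_tendstoD(2)[OF lim_\<tau>_\<sigma>]) (use \<alpha> in simp)
  then show ?thesis by eventually_elim (simp add: good_def \<alpha>'_def field_simps)
qed

lemma drift_mdp_N: "good n \<Longrightarrow> drift_mdp (t.N n) (t.w' n) (t.\<eta>' n) (t.\<phi>' n) \<alpha>' B"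
  by (rule t.drift_mdp_N) (use \<alpha>' in \<open>auto simp: good_def\<close>)

lemma K_borel [measurable]: "K n \<in> sets borel" by (rule t.K_sets)

section \<open>Uniformly small tails\<close>

definition tail :: "nat \<Rightarrow> 'x measure \<Rightarrow> real" where
  "tail j \<mu> = (\<integral>y. indicator (- K j) y * w y \<partial>\<mu>)"

lemma tail_integrable:
  assumes "sets \<mu> = sets borel" "integrable \<mu> w"
  shows "integrable \<mu> (\<lambda>y. indicator (- K j) y * w y)"
  using integrable_mult_indicator[of "- K j" \<mu> w] assms by auto

lemma tail_antimono:
  assumes "sets \<mu> = sets borel" "integrable \<mu> w" "i \<le> j"
  shows "tail j \<mu> \<le> tail i \<mu>"
  unfolding tail_def
  by (rule integral_mono[OF tail_integrable[OF assms(1,2)] tail_integrable[OF assms(1,2)]])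
    (use K_mono[OF assms(3)] w_ge1 in \<open>auto intro: order_trans[OF zero_le_one] split: split_indicator\<close>)

lemma tail_lim:
  assumes "sets \<mu> = sets borel" "integrable \<mu> w"
  shows "(\<lambda>j. tail j \<mu>) \<longlonglongrightarrow> 0"
proof -
  have "(\<lambda>j. tail j \<mu>) \<longlonglongrightarrow> (\<integral>y. 0 \<partial>\<mu>)"
    unfolding tail_def
  proof (rule integral_dominated_convergence[where w=w])
    show "AE y in \<mu>. (\<lambda>j. indicator (- K j) y * w y) \<longlonglongrightarrow> 0"
    proof (rule AE_I2)
      fix y
      obtain m where "y \<in> K m" using K_UN by blast
      then have "\<forall>\<^sub>F j in sequentially. indicator (- K j) y * w y = 0"
        using K_mono by (intro eventually_sequentiallyI[of m]) (auto split: split_indicator)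
      then show "(\<lambda>j. indicator (- K j) y * w y) \<longlonglongrightarrow> 0" by (rule tendsto_eventually)
    qed
    show "AE y in \<mu>. norm (indicator (- K j) y * w y) \<le> w y" for j
      using w_ge1 by (intro AE_I2) (auto intro: order_trans[OF zero_le_one] split: split_indicator)
  qed (use assms in \<open>auto cong: measurable_cong_sets\<close>)
  then show ?thesis by simp
qed

text \<open>Two ways of escaping are controlled uniformly over \<open>Q\<close>: far out, a function
  on the original space can be of the size of \<open>w\<close>, and at the pseudo-state a function
  on the truncated one can be of the size of \<open>\<gamma> n\<close>.\<close>

definition tight :: "'x measure set \<Rightarrow> bool" where
  "tight Q \<longleftrightarrow> (\<forall>\<mu>\<in>Q. prob_space \<mu> \<and> sets \<mu> = sets borel \<and> integrable \<mu> w) \<and>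
     (\<forall>e>0. \<exists>j. \<forall>\<mu>\<in>Q. tail j \<mu> \<le> e) \<and>
     (\<forall>e>0. \<forall>\<^sub>F n in sequentially. \<forall>\<mu>\<in>Q. \<gamma> n * measure \<mu> (- K n) \<le> e)"

text \<open>Only the product has to be small, while \<open>\<gamma> n\<close> itself may be
  unbounded in \<open>n\<close>. Solving the bound by \<open>\<tau> n\<close> for the product gives
  the estimate.\<close>

lemma \<gamma>_kernel: "\<gamma> n * measure (kernel M x a) (- K n) \<le> \<tau> n + tail n (kernel M x a)"
proof -
  interpret k: prob_space "kernel M x a" by (rule t.prob_kernel)
  have i: "integrable (kernel M x a) (\<lambda>y. indicator (- K n) y * w y)"
    by (rule tail_integrable[OF t.sets_kernel_M t.w_int_kernel])
  have "(LINT y:- K n|kernel M x a. \<gamma> n - w y)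
      = (\<integral>y. \<gamma> n * indicator (- K n) y - indicator (- K n) y * w y \<partial>kernel M x a)"
    unfolding set_lebesgue_integral_def
    by (rule Bochner_Integration.integral_cong) (auto split: split_indicator)
  also have "\<dots> = \<gamma> n * measure (kernel M x a) (- K n) - tail n (kernel M x a)"
    using i integrable_real_indicator[of "- K n" "kernel M x a"] by (simp add: tail_def k.emeasure_eq_measure)
  finally show ?thesis using t.\<tau>(1)[of x a n] by simp
qed

text \<open>A Dini argument: the tails are continuous in state and action and decrease pointwise to
  zero, hence uniformly on \<open>K m\<close> times the compact action space. The condition on the
  pseudo-state then follows from \<open>\<gamma>_kernel\<close>.\<close>

lemma tight_kernel: "tight {kernel M x a | x a. x \<in> K m}"
  unfolding tight_def
proof (intro conjI allI impI)
  show "\<forall>\<mu>\<in>{kernel M x a | x a. x \<in> K m}. prob_space \<mu> \<and> sets \<mu> = sets borel \<and> integrable \<mu> w"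
    using t.prob_kernel t.w_int_kernel by auto
  have unif: "\<exists>j. \<forall>\<mu>\<in>{kernel M x a | x a. x \<in> K m}. tail j \<mu> \<le> e" if e: "e > 0" for e
  proof -
    define U where "U j = {z. tail j (kernel M (fst z) (snd z)) < e}" for j
    have "compact (K m \<times> (UNIV :: 'a set))" by (rule compact_Times[OF t.K compact_actions])
    moreover have "open (U j)" for j
      unfolding U_def
    proof (intro open_Collect_less continuous_on_const)
      show "continuous_on UNIV (\<lambda>z. tail j (kernel M (fst z) (snd z)))"
        unfolding tail_def
        by (rule kernel_cont) (use w_ge1 in \<open>auto intro: order_trans[OF zero_le_one] split: split_indicator\<close>)
    qed
    moreover have "K m \<times> UNIV \<subseteq> (\<Union>j\<in>UNIV. U j)"
    proof
      fix z assume "z \<in> K m \<times> (UNIV :: 'a set)"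
      have "\<forall>\<^sub>F j in sequentially. tail j (kernel M (fst z) (snd z)) < e"
        by (rule order_tendstoD(2)[OF tail_lim[OF t.sets_kernel_M t.w_int_kernel] e])
      then obtain j where "z \<in> U j" by (auto simp: U_def eventually_sequentially)
      then show "z \<in> (\<Union>j\<in>UNIV. U j)" by blast
    qed
    ultimately obtain J where J: "finite J" "K m \<times> UNIV \<subseteq> (\<Union>j\<in>J. U j)"
      by (rule compactE_image)
    \<comment> \<open>Inserting 0 keeps the maximum defined when \<open>J\<close> is empty.\<close>
    have "tail (Max (insert 0 J)) (kernel M x a) \<le> e" if x: "x \<in> K m" for x a
    proof -
      obtain j where j: "j \<in> J" "(x, a) \<in> U j" using J(2) x by blast
      have "j \<le> Max (insert 0 J)" using J(1) j(1) by simp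
      then have "tail (Max (insert 0 J)) (kernel M x a) \<le> tail j (kernel M x a)"
        by (rule tail_antimono[OF t.sets_kernel_M t.w_int_kernel])
      then show ?thesis using j(2) by (simp add: U_def)
    qed
    then show ?thesis by blast
  qed
  fix e :: real assume e: "e > 0"
  show "\<exists>j. \<forall>\<mu>\<in>{kernel M x a | x a. x \<in> K m}. tail j \<mu> \<le> e" by (rule unif[OF e])
  obtain j where j: "\<And>x a. x \<in> K m \<Longrightarrow> tail j (kernel M x a) \<le> e / 2"
    using unif[of "e / 2"] e by auto
  have "\<forall>\<^sub>F n in sequentially. \<tau> n < e / 2" by (rule order_tendstoD(2)[OF lim_\<tau>]) (use e in simp)
  then show "\<forall>\<^sub>F n in sequentially. \<forall>\<mu>\<in>{kernel M x a | x a. x \<in> K m}. \<gamma> n * measure \<mu> (- K n) \<le> e"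
    using eventually_ge_at_top[of j]
  proof eventually_elim
    case (elim n)
    have "\<gamma> n * measure (kernel M x a) (- K n) \<le> e" if "x \<in> K m" for x a
      using \<gamma>_kernel[of n x a] tail_antimono[OF t.sets_kernel_M t.w_int_kernel[of x a] elim(2)] j[OF that, of a] elim(1)
      by linarith
    then show ?case by blast
  qed
qed

text \<open>The function \<open>\<phi>\<close> of this locale may vanish, so a separate minorization with a positive constant
  carries the bound on \<open>\<gamma> n * measure p (- K n)\<close> from one transition law over to \<open>\<eta>\<close>.\<close>

lemma tight_\<eta>: "tight {\<eta>}"
  unfolding tight_def
proof (intro conjI allI impI)
  show "\<forall>\<mu>\<in>{\<eta>}. prob_space \<mu> \<and> sets \<mu> = sets borel \<and> integrable \<mu> w"
    using t.prob_\<eta> \<eta>_int by simp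
  fix e :: real assume e: "e > 0"
  have "\<forall>\<^sub>F j in sequentially. tail j \<eta> < e"
    by (rule order_tendstoD(2)[OF tail_lim[OF t.sets_\<eta> \<eta>_int] e])
  then show "\<exists>j. \<forall>\<mu>\<in>{\<eta>}. tail j \<mu> \<le> e" by (auto simp: eventually_sequentially intro: less_imp_le)
  obtain x a r where r: "r > 0" "\<And>D. D \<in> sets borel \<Longrightarrow> measure \<eta> D * r \<le> measure (kernel M x a) D"
    using positive_minor by blast
  have "(\<lambda>n. (\<tau> n + tail n (kernel M x a)) / r) \<longlonglongrightarrow> (0 + 0) / r"
    using r(1) by (intro tendsto_intros lim_\<tau> tail_lim t.w_int_kernel) auto
  then have "\<forall>\<^sub>F n in sequentially. (\<tau> n + tail n (kernel M x a)) / r < e"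
    by (rule order_tendstoD(2)) (use e in simp)
  then show "\<forall>\<^sub>F n in sequentially. \<forall>\<mu>\<in>{\<eta>}. \<gamma> n * measure \<mu> (- K n) \<le> e"
  proof eventually_elim
    case (elim n)
    have "\<gamma> n * (measure \<eta> (- K n) * r) \<le> \<gamma> n * measure (kernel M x a) (- K n)"
      using r(2) t.\<gamma>_ge1[of n] by (intro mult_left_mono) auto
    also have "\<dots> \<le> \<tau> n + tail n (kernel M x a)" by (rule \<gamma>_kernel)
    finally have "\<gamma> n * measure \<eta> (- K n) \<le> (\<tau> n + tail n (kernel M x a)) / r"
      using r(1) by (simp add: field_simps)
    with elim show ?case by simp
  qed
qed

section \<open>Locally uniform closeness of functions on the two state spaces\<close>

definition close :: "(nat \<Rightarrow> 'x \<Rightarrow> real) \<Rightarrow> (nat \<Rightarrow> 'x \<Rightarrow> real) \<Rightarrow> bool" where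
  "close u v \<longleftrightarrow> (\<forall>m. \<forall>e>0. \<forall>\<^sub>F n in sequentially. \<forall>x\<in>K m. \<bar>u n x - v n x\<bar> \<le> e)"

definition dominated :: "real \<Rightarrow> (nat \<Rightarrow> 'x \<Rightarrow> real) \<Rightarrow> (nat \<Rightarrow> 'x \<Rightarrow> real) \<Rightarrow> bool" where
  "dominated C u v \<longleftrightarrow> (\<forall>n. good n \<longrightarrow> u n \<in> borel_measurable borel \<and> (\<forall>x. \<bar>u n x\<bar> \<le> C * w x) \<and>
     v n \<in> borel_measurable (t.S' n) \<and> (\<forall>x\<in>space (t.S' n). \<bar>v n x\<bar> \<le> C * t.w' n x))"

text \<open>The space is cut into three regions: on \<open>K j\<close> closeness acts, between
  \<open>K j\<close> and \<open>K n\<close> both functions are controlled by \<open>w\<close>, and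
  beyond \<open>K n\<close> the second one only sees the pseudo-state. The threshold for
  \<open>n\<close> is common to all measures in \<open>Q\<close>, and so later to all
  actions.\<close>

lemma tight_integral:
  assumes Q: "tight Q" and dom: "dominated C u v" and cl: "close u v" and e: "e > 0"
  shows "\<forall>\<^sub>F n in sequentially. \<forall>\<mu>\<in>Q. \<bar>(\<integral>y. u n y \<partial>\<mu>) - (\<integral>y. v n (t.l n y) \<partial>\<mu>)\<bar> \<le> e"
proof -
  \<comment> \<open>A strictly positive constant, because the error budget divides by it.\<close>
  define C' where "C' = \<bar>C\<bar> + 1"
  have C': "0 < C'" "C \<le> C'" by (auto simp: C'_def)
  have e1: "e / (6 * C') > 0" and e2: "e / (3 * C') > 0" and e3: "e / 3 > 0" using e C' by simp_all
  obtain j where j: "\<And>\<mu>. \<mu> \<in> Q \<Longrightarrow> tail j \<mu> \<le> e / (6 * C')"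
    using Q e1 unfolding tight_def by blast
  have "\<forall>\<^sub>F n in sequentially. \<forall>\<mu>\<in>Q. \<gamma> n * measure \<mu> (- K n) \<le> e / (3 * C')"
    using Q e2 unfolding tight_def by blast
  moreover have "\<forall>\<^sub>F n in sequentially. \<forall>x\<in>K j. \<bar>u n x - v n x\<bar> \<le> e / 3"
    using cl e3 unfolding close_def by blast
  ultimately show ?thesis
    using eventually_good eventually_ge_at_top[of j]
  proof eventually_elim
    case (elim n)
    have un [measurable]: "u n \<in> borel_measurable borel" and ub: "\<bar>u n y\<bar> \<le> C' * w y" for y
    proof -
      show "u n \<in> borel_measurable borel" using dom elim(3) by (simp add: dominated_def)
      have "\<bar>u n y\<bar> \<le> C * w y" using dom elim(3) by (simp add: dominated_def)
      also have "\<dots> \<le> C' * w y" using C' w_ge1[of y] by (intro mult_right_mono) auto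
      finally show "\<bar>u n y\<bar> \<le> C' * w y" .
    qed
    have vn: "v n \<in> borel_measurable (t.S' n)" using dom elim(3) by (simp add: dominated_def)
    have vl [measurable]: "(\<lambda>y. v n (t.l n y)) \<in> borel_measurable borel"
      by (rule measurable_compose[OF t.l_meas vn])
    have vb: "\<bar>v n (t.l n y)\<bar> \<le> C' * t.w' n (t.l n y)" for y
    proof -
      have "t.l n y \<in> space (t.S' n)" by (simp add: t.l_def t.space_S')
      then have "\<bar>v n (t.l n y)\<bar> \<le> C * t.w' n (t.l n y)" using dom elim(3) by (simp add: dominated_def)
      also have "\<dots> \<le> C' * t.w' n (t.l n y)" using C' t.w'_ge1[where n=n and x="t.l n y"] by (intro mult_right_mono) auto
      finally show ?thesis .
    qed
    \<comment> \<open>The factor 2 is for the middle region, where both functions are bounded by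
      \<open>C' * w\<close>; it explains the 6 in the choice of \<open>j\<close>. Beyond
      \<open>K n\<close> the same tail term pays for \<open>u\<close> and the last term for
      \<open>v\<close>.\<close>
    have pw: "\<bar>u n y - v n (t.l n y)\<bar> \<le> e / 3 + 2 * C' * (indicator (- K j) y * w y) + C' * \<gamma> n * indicator (- K n) y" for y
    proof -
      consider "y \<in> K j" | "y \<notin> K j" "y \<in> K n" | "y \<notin> K n" by blast
      then show ?thesis
      proof cases
        case 1
        then have "y \<in> K n" using K_mono[OF elim(4)] by blast
        then show ?thesis using 1 elim(2) by (simp add: t.l_def)
      next
        case 2
        have "\<bar>u n y - v n y\<bar> \<le> 2 * C' * w y" using ub[of y] vb[of y] 2 by (simp add: t.l_def t.w'_def)
        then show ?thesis using 2 e by (simp add: t.l_def)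
      next
        case 3
        then have "y \<notin> K j" using K_mono[OF elim(4)] by blast
        moreover have "0 \<le> C' * w y" using C' w_ge1[of y] by simp
        moreover have "\<bar>u n y - v n (t.l n y)\<bar> \<le> C' * w y + C' * \<gamma> n"
          using ub[of y] vb[of y] 3 t.\<Delta>[of n] by (simp add: t.l_def t.w'_def)
        ultimately show ?thesis using 3 e by simp
      qed
    qed
    show ?case
    proof
      fix \<mu> assume \<mu>: "\<mu> \<in> Q"
      then interpret prob_space \<mu> using Q by (simp add: tight_def)
      have st [measurable_cong, simp]: "sets \<mu> = sets borel" and wi: "integrable \<mu> w"
        using Q \<mu> by (simp_all add: tight_def)
      have ui: "integrable \<mu> (u n)"
        by (rule Bochner_Integration.integrable_bound[of \<mu> "\<lambda>y. C' * w y"])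
          (use wi in \<open>auto intro!: AE_I2 order_trans[OF ub abs_ge_self]\<close>)
      obtain D where D: "\<And>x. \<bar>t.w' n x\<bar> \<le> D" using t.bounded_on_S' by blast
      have vi: "integrable \<mu> (\<lambda>y. v n (t.l n y))"
      proof (rule integrable_const_bound)
        show "AE y in \<mu>. norm (v n (t.l n y)) \<le> C' * D"
        proof (rule AE_I2)
          fix y
          have "C' * t.w' n (t.l n y) \<le> C' * D" using D[of "t.l n y"] C' by (intro mult_left_mono) auto
          with vb[of y] show "norm (v n (t.l n y)) \<le> C' * D" by simp
        qed
      qed simp
      have ti: "integrable \<mu> (\<lambda>y. indicator (- K j) y * w y)" by (rule tail_integrable[OF st wi])
      have ii: "integrable \<mu> (indicator (- K n) :: _ \<Rightarrow> real)"
        by (rule integrable_real_indicator) (auto simp: emeasure_eq_measure)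
      have bi: "integrable \<mu> (\<lambda>y. e / 3 + 2 * C' * (indicator (- K j) y * w y) + C' * \<gamma> n * indicator (- K n) y)"
        using ti ii by (intro Bochner_Integration.integrable_add integrable_mult_right) auto
      have "\<bar>(\<integral>y. u n y \<partial>\<mu>) - (\<integral>y. v n (t.l n y) \<partial>\<mu>)\<bar> = \<bar>\<integral>y. u n y - v n (t.l n y) \<partial>\<mu>\<bar>"
        using ui vi by simp
      also have "\<dots> \<le> (\<integral>y. \<bar>u n y - v n (t.l n y)\<bar> \<partial>\<mu>)" by (rule integral_abs_bound)
      also have "\<dots> \<le> (\<integral>y. e / 3 + 2 * C' * (indicator (- K j) y * w y) + C' * \<gamma> n * indicator (- K n) y \<partial>\<mu>)"
        by (rule integral_mono[OF _ bi pw]) (use ui vi in auto)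
      also have "\<dots> = e / 3 + 2 * C' * tail j \<mu> + C' * (\<gamma> n * measure \<mu> (- K n))"
        using ti ii sets_eq_imp_space_eq[OF st] prob_space by (simp add: tail_def)
      also have "\<dots> \<le> e / 3 + 2 * C' * (e / (6 * C')) + C' * (e / (3 * C'))"
        using j[OF \<mu>] elim(1) \<mu> C' by (intro add_mono mult_left_mono order_refl) auto
      also have "\<dots> = e" using C' by (simp add: field_simps)
      finally show "\<bar>(\<integral>y. u n y \<partial>\<mu>) - (\<integral>y. v n (t.l n y) \<partial>\<mu>)\<bar> \<le> e" .
    qed
  qed
qed

end

subsection \<open>Comparison of average costs\<close>

lemma quotient_difference_tendsto_zero:
  fixes a a' d d' :: "nat \<Rightarrow> real"
  assumes a: "(\<lambda>n. a n - a' n) \<longlonglongrightarrow> 0" and d: "(\<lambda>n. d n - d' n) \<longlonglongrightarrow> 0"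
    and ge: "\<forall>\<^sub>F n in sequentially. 1 \<le> d n \<and> 1 \<le> d' n \<and> \<bar>a n\<bar> \<le> C"
  shows "(\<lambda>n. a n / d n - a' n / d' n) \<longlonglongrightarrow> 0"
proof (rule Lim_null_comparison)
  have "(\<lambda>n. \<bar>a n - a' n\<bar> + C * \<bar>d n - d' n\<bar>) \<longlonglongrightarrow> \<bar>0\<bar> + C * \<bar>0\<bar>"
    by (intro tendsto_intros a d)
  then show "(\<lambda>n. \<bar>a n - a' n\<bar> + C * \<bar>d n - d' n\<bar>) \<longlonglongrightarrow> 0" by simp
  show "\<forall>\<^sub>F n in sequentially. norm (a n / d n - a' n / d' n) \<le> \<bar>a n - a' n\<bar> + C * \<bar>d n - d' n\<bar>"
    using ge
  proof eventually_elim
    case (elim n)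
    then have pos: "0 < d n" "0 < d' n" "1 \<le> d n * d' n"
      using mult_mono[of 1 "d n" 1 "d' n"] by auto
    have "a n / d n - a' n / d' n = (a n - a' n) / d' n + a n * (d' n - d n) / (d n * d' n)"
      using pos by (simp add: field_simps)
    moreover have "\<bar>(a n - a' n) / d' n\<bar> \<le> \<bar>a n - a' n\<bar>"
      using elim divide_left_mono[of 1 "d' n" "\<bar>a n - a' n\<bar>"] by (simp add: abs_divide)
    moreover have "\<bar>a n * (d' n - d n) / (d n * d' n)\<bar> \<le> \<bar>a n * (d' n - d n)\<bar>"
      using pos divide_left_mono[of 1 "d n * d' n" "\<bar>a n * (d' n - d n)\<bar>"] by (simp add: abs_divide abs_mult)
    moreover have "\<bar>a n * (d' n - d n)\<bar> \<le> C * \<bar>d n - d' n\<bar>"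
      using elim by (simp add: abs_mult abs_minus_commute mult_right_mono)
    ultimately show ?case unfolding real_norm_def by linarith
  qed
qed

text \<open>No relation between policies of different index is assumed, so the estimates must be
  uniform over policies. It is instantiated with the extended near-optimal policies and with a fixed
  policy repeated.\<close>

locale policy_sequence = approximation M w \<eta> \<phi> \<alpha> B K \<Delta> \<nu> \<gamma> \<tau> \<sigma>
  for M :: "('x::{metric_space, second_countable_topology},
               'a::{metric_space, second_countable_topology}) mdp"
    and w \<eta> \<phi> \<alpha> B K \<Delta> \<nu> \<gamma> \<tau> \<sigma> +
  fixes F f :: "nat \<Rightarrow> 'x \<Rightarrow> 'a"
  assumes F: "\<And>n. F n \<in> stationary_policies M"
    and f: "\<And>n. f n \<in> stationary_policies (t.N n)"
    and agree: "\<And>n x. x \<in> K n \<Longrightarrow> F n x = f n x"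
begin

abbreviation "kF n \<equiv> \<lambda>y. kernel M y (F n y)"
abbreviation "\<phi>F n \<equiv> \<lambda>y. \<phi> y (F n y)"
abbreviation "PF n \<equiv> sub_op (kF n) \<eta> (\<phi>F n)"
abbreviation "RF n \<equiv> resolvent (kF n) \<eta> (\<phi>F n)"
abbreviation "kf n \<equiv> \<lambda>y. kernel (t.N n) y (f n y)"
abbreviation "\<phi>f n \<equiv> \<lambda>y. t.\<phi>' n y (f n y)"
abbreviation "Pf n \<equiv> sub_op (kf n) (t.\<eta>' n) (\<phi>f n)"
abbreviation "Rf n \<equiv> resolvent (kf n) (t.\<eta>' n) (\<phi>f n)"

lemma chain_F: "drift_chain borel (kF n) w \<eta> (\<phi>F n) \<alpha>"
  using stationary_chain[OF F[of n]] by (simp add: state_borel)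

lemma chain_f: "good n \<Longrightarrow> drift_chain (t.S' n) (kf n) (t.w' n) (t.\<eta>' n) (\<phi>f n) \<alpha>'"
  using drift_mdp.stationary_chain[OF drift_mdp_N f[of n]] by (simp add: t.state_N)

lemma dominated_iff:
  "dominated C u v \<longleftrightarrow> (\<forall>n. good n \<longrightarrow>
     drift_chain.wfun borel w C (u n) \<and> drift_chain.wfun (t.S' n) (t.w' n) C (v n))"
proof -
  have "good n \<longrightarrow> (drift_chain.wfun borel w C (u n) \<longleftrightarrow> u n \<in> borel_measurable borel \<and> (\<forall>x. \<bar>u n x\<bar> \<le> C * w x))"
    for n using drift_chain.wfun_def[OF chain_F[of n]] by simp
  moreover have "good n \<longrightarrow> (drift_chain.wfun (t.S' n) (t.w' n) C (v n) \<longleftrightarrow>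
      v n \<in> borel_measurable (t.S' n) \<and> (\<forall>x\<in>space (t.S' n). \<bar>v n x\<bar> \<le> C * t.w' n x))" for n
    using drift_chain.wfun_def[OF chain_f[of n]] by simp
  ultimately show ?thesis unfolding dominated_def by blast
qed

text \<open>Both contraction factors are below 1, so the constant \<open>C\<close> survives any
  number of applications.\<close>

lemma dominated_P:
  assumes "dominated C u v" shows "dominated C (\<lambda>n. PF n (u n)) (\<lambda>n. Pf n (v n))"
  unfolding dominated_iff
proof (intro allI impI)
  fix n assume n: "good n"
  interpret cF: drift_chain borel "kF n" w \<eta> "\<phi>F n" \<alpha> by (rule chain_F)
  interpret cf: drift_chain "t.S' n" "kf n" "t.w' n" "t.\<eta>' n" "\<phi>f n" \<alpha>' by (rule chain_f[OF n])
  have u: "cF.wfun C (u n)" and v: "cf.wfun C (v n)" using assms n by (simp_all add: dominated_iff)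
  have C: "0 \<le> C" by (rule cF.wfun_nonneg[OF u])
  have "\<alpha> * C \<le> C" "\<alpha>' * C \<le> C" using C \<alpha> \<alpha>' by (simp_all add: mult_left_le_one_le)
  then show "cF.wfun C (PF n (u n)) \<and> cf.wfun C (Pf n (v n))"
    using cF.wfun_mono[OF cF.P_wfun[OF u]] cf.wfun_mono[OF cf.P_wfun[OF v]] by blast
qed

lemma integral_lump: "v \<in> borel_measurable (t.S' n) \<Longrightarrow> (\<integral>y. v y \<partial>t.\<eta>' n) = (\<integral>y. (v (t.l n y) :: real) \<partial>\<eta>)"
  unfolding t.\<eta>'_def by (rule t.integral_lump) simp

text \<open>For \<open>x\<close> in \<open>K m\<close> and \<open>n \<ge> m\<close> both operators
  use the same action and the same law, in the compact model composed with \<open>t.l n\<close>.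
  What remains are differences of integrals over a transition law and over \<open>\<eta>\<close>,
  and both families are tight.\<close>

lemma close_P:
  assumes dom: "dominated C u v" and cl: "close u v"
  shows "close (\<lambda>n. PF n (u n)) (\<lambda>n. Pf n (v n))"
  unfolding close_def
proof (intro allI impI)
  fix m and e :: real assume "e > 0"
  then have e: "e / 2 > 0" by simp
  show "\<forall>\<^sub>F n in sequentially. \<forall>x\<in>K m. \<bar>PF n (u n) x - Pf n (v n) x\<bar> \<le> e"
    using tight_integral[OF tight_kernel[of m] dom cl e] tight_integral[OF tight_\<eta> dom cl e]
      eventually_good eventually_ge_at_top[of m]
  proof eventually_elim
    case (elim n)
    show ?case
    proof
      fix x assume x: "x \<in> K m"
      then have xn: "x \<in> K n" using K_mono[OF elim(4)] by blast
      have vn: "v n \<in> borel_measurable (t.S' n)" using dom elim(3) by (simp add: dominated_def)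
      let ?a = "F n x"
      let ?D = "(\<integral>y. u n y \<partial>kernel M x ?a) - (\<integral>y. v n (t.l n y) \<partial>kernel M x ?a)"
      let ?E = "(\<integral>y. u n y \<partial>\<eta>) - (\<integral>y. v n (t.l n y) \<partial>\<eta>)"
      have "Pf n (v n) x = (\<integral>y. v n (t.l n y) \<partial>kernel M x ?a) - \<phi> x ?a * (\<integral>y. v n (t.l n y) \<partial>\<eta>)"
        using xn by (simp add: sub_op_def agree[symmetric] t.kernel_N_K t.\<phi>'_def t.integral_lump[OF _ vn] integral_lump[OF vn])
      then have "PF n (u n) x - Pf n (v n) x = ?D - \<phi> x ?a * ?E"
        by (simp add: sub_op_def algebra_simps)
      moreover have "\<bar>?D\<bar> \<le> e / 2" using elim(1) x by blast
      moreover have "\<bar>\<phi> x ?a * ?E\<bar> \<le> 1 * (e / 2)"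
        unfolding abs_mult using elim(2) t.\<phi>_01 by (intro mult_mono) auto
      ultimately show "\<bar>PF n (u n) x - Pf n (v n) x\<bar> \<le> e" by linarith
    qed
  qed
qed

lemma dominated_close_P_pow:
  assumes "dominated C u v" "close u v"
  shows "dominated C (\<lambda>n. (PF n ^^ i) (u n)) (\<lambda>n. (Pf n ^^ i) (v n)) \<and>
    close (\<lambda>n. (PF n ^^ i) (u n)) (\<lambda>n. (Pf n ^^ i) (v n))"
  by (induction i) (use assms dominated_P close_P in \<open>auto\<close>)

lemma dominated_R:
  assumes dom: "dominated C u v"
  shows "dominated (C / (1 - \<alpha>')) (\<lambda>n. RF n (u n)) (\<lambda>n. Rf n (v n))"
  unfolding dominated_iff
proof (intro allI impI)
  fix n assume n: "good n"
  interpret cF: drift_chain borel "kF n" w \<eta> "\<phi>F n" \<alpha> by (rule chain_F)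
  interpret cf: drift_chain "t.S' n" "kf n" "t.w' n" "t.\<eta>' n" "\<phi>f n" \<alpha>' by (rule chain_f[OF n])
  have u: "cF.wfun C (u n)" and v: "cf.wfun C (v n)" using dom n by (simp_all add: dominated_iff)
  have "C / (1 - \<alpha>) \<le> C / (1 - \<alpha>')"
    using cF.wfun_nonneg[OF u] \<alpha> \<alpha>' by (intro divide_left_mono) auto
  then show "cF.wfun (C / (1 - \<alpha>')) (RF n (u n)) \<and> cf.wfun (C / (1 - \<alpha>')) (Rf n (v n))"
    using cF.wfun_mono[OF cF.R_wfun[OF u]] cf.R_wfun[OF v] by blast
qed

text \<open>The geometric remainders are small uniformly in good \<open>n\<close> and on
  \<open>K m\<close>, so finitely many terms decide, and each of these is close by iterating
  \<open>close_P\<close>.\<close>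

lemma close_R:
  assumes dom: "dominated C u v" and cl: "close u v"
  shows "close (\<lambda>n. RF n (u n)) (\<lambda>n. Rf n (v n))"
  unfolding close_def
proof (intro allI impI)
  fix m and e :: real assume e: "e > 0"
  obtain W where W: "\<And>x. x \<in> K m \<Longrightarrow> w x \<le> W" "0 \<le> W"
  proof -
    have "bounded (w ` K m)"
      by (rule compact_imp_bounded[OF compact_continuous_image[OF continuous_on_subset[OF w_cont] t.K]]) simp
    then obtain W where "\<And>x. x \<in> K m \<Longrightarrow> \<bar>w x\<bar> \<le> W" by (auto simp: bounded_iff)
    then show ?thesis using that[of "max 0 W"] by (simp add: abs_le_iff le_max_iff_disj)
  qed
  \<comment> \<open>The sign of \<open>C\<close> is known only once a good index is at hand, hence
    the absolute value.\<close>
  have "(\<lambda>i. \<alpha>' ^ i * \<bar>C\<bar> / (1 - \<alpha>') * W) \<longlonglongrightarrow> 0 * \<bar>C\<bar> / (1 - \<alpha>') * W"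
    using \<alpha>' by (intro tendsto_intros LIMSEQ_power_zero) auto
  then have "\<forall>\<^sub>F i in sequentially. \<alpha>' ^ i * \<bar>C\<bar> / (1 - \<alpha>') * W < e / 3"
    by (rule order_tendstoD(2)) (use e in simp)
  then obtain i where i: "\<alpha>' ^ i * \<bar>C\<bar> / (1 - \<alpha>') * W < e / 3" by (auto simp: eventually_sequentially)
  \<comment> \<open>Adding 1 avoids a division by zero when no term is kept.\<close>
  have ei: "e / (3 * (real i + 1)) > 0" using e by simp
  have "\<forall>\<^sub>F n in sequentially. \<forall>x\<in>K m. \<bar>(PF n ^^ j) (u n) x - (Pf n ^^ j) (v n) x\<bar> \<le> e / (3 * (real i + 1))" for j
    using dominated_close_P_pow[OF dom cl, of j] ei unfolding close_def by blast
  then have "\<forall>\<^sub>F n in sequentially. \<forall>j\<in>{..<i}. \<forall>x\<in>K m. \<bar>(PF n ^^ j) (u n) x - (Pf n ^^ j) (v n) x\<bar> \<le> e / (3 * (real i + 1))"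
    by (simp add: eventually_ball_finite_distrib)
  then show "\<forall>\<^sub>F n in sequentially. \<forall>x\<in>K m. \<bar>RF n (u n) x - Rf n (v n) x\<bar> \<le> e"
    using eventually_good eventually_ge_at_top[of m]
  proof eventually_elim
    case (elim n)
    interpret cF: drift_chain borel "kF n" w \<eta> "\<phi>F n" \<alpha> by (rule chain_F)
    interpret cf: drift_chain "t.S' n" "kf n" "t.w' n" "t.\<eta>' n" "\<phi>f n" \<alpha>' by (rule chain_f[OF elim(2)])
    have u: "cF.wfun C (u n)" and v: "cf.wfun C (v n)" using dom elim(2) by (simp_all add: dominated_iff)
    have C: "0 \<le> C" by (rule cF.wfun_nonneg[OF u])
    then have i': "\<alpha>' ^ i * C / (1 - \<alpha>') * W < e / 3" using i by simp
    show ?case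
    proof
      fix x assume x: "x \<in> K m"
      then have xn: "x \<in> K n" using K_mono[OF elim(3)] by blast
      then have xS: "x \<in> space (t.S' n)" by (simp add: t.space_S')
      have "\<bar>RF n (u n) x - (\<Sum>j<i. (PF n ^^ j) (u n) x)\<bar> \<le> \<alpha> ^ i * C / (1 - \<alpha>) * w x"
        using cF.R_tail[OF u] by simp
      also have "\<dots> \<le> \<alpha>' ^ i * C / (1 - \<alpha>') * W"
        using C \<alpha> \<alpha>' W(1)[OF x] w_ge1[of x]
        by (intro mult_mono frac_le power_mono mult_nonneg_nonneg divide_nonneg_nonneg) auto
      finally have 1: "\<bar>RF n (u n) x - (\<Sum>j<i. (PF n ^^ j) (u n) x)\<bar> < e / 3" using i' by linarith
      have "\<bar>Rf n (v n) x - (\<Sum>j<i. (Pf n ^^ j) (v n) x)\<bar> \<le> \<alpha>' ^ i * C / (1 - \<alpha>') * t.w' n x"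
        by (rule cf.R_tail[OF v xS])
      also have "\<dots> \<le> \<alpha>' ^ i * C / (1 - \<alpha>') * W"
        using C \<alpha>' W(1)[OF x] xn by (intro mult_left_mono divide_nonneg_nonneg mult_nonneg_nonneg) (auto simp: t.w'_def)
      finally have 2: "\<bar>Rf n (v n) x - (\<Sum>j<i. (Pf n ^^ j) (v n) x)\<bar> < e / 3" using i' by linarith
      have "\<bar>(\<Sum>j<i. (PF n ^^ j) (u n) x) - (\<Sum>j<i. (Pf n ^^ j) (v n) x)\<bar>
          \<le> (\<Sum>j<i. \<bar>(PF n ^^ j) (u n) x - (Pf n ^^ j) (v n) x\<bar>)"
        unfolding sum_subtractf[symmetric] by (rule sum_abs)
      also have "\<dots> \<le> (\<Sum>j<i. e / (3 * (real i + 1)))" using elim(1) x by (intro sum_mono) auto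
      also have "\<dots> \<le> e / 3" using e by (simp add: field_simps)
      finally show "\<bar>RF n (u n) x - Rf n (v n) x\<bar> \<le> e" using 1 2 by linarith
    qed
  qed
qed

lemma integral_R_difference:
  assumes dom: "dominated C u v" and cl: "close u v"
  shows "(\<lambda>n. (\<integral>x. RF n (u n) x \<partial>\<eta>) - (\<integral>x. Rf n (v n) x \<partial>t.\<eta>' n)) \<longlonglongrightarrow> 0"
proof (rule tendstoI)
  fix e :: real assume e: "0 < e"
  then have "e / 2 > 0" by simp
  from tight_integral[OF tight_\<eta> dominated_R[OF dom] close_R[OF dom cl] this] eventually_good
  show "\<forall>\<^sub>F n in sequentially. dist ((\<integral>x. RF n (u n) x \<partial>\<eta>) - (\<integral>x. Rf n (v n) x \<partial>t.\<eta>' n)) 0 < e"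
  proof eventually_elim
    case (elim n)
    have "Rf n (v n) \<in> borel_measurable (t.S' n)"
      using dominated_R[OF dom] elim(2) by (simp add: dominated_def)
    then show ?case using elim(1) e by (simp add: integral_lump dist_real_def)
  qed
qed

text \<open>Numerators are compared through the costs, which agree exactly on \<open>K n\<close>,
  denominators through the constant 1. The uniform lower bound on the denominators turns this into
  closeness of the quotients.\<close>

lemma mean_cost_difference:
  "(\<lambda>n. mean_cost (kF n) \<eta> (\<phi>F n) (\<lambda>y. cost M y (F n y)) -
        mean_cost (kf n) (t.\<eta>' n) (\<phi>f n) (\<lambda>y. cost (t.N n) y (f n y))) \<longlonglongrightarrow> 0"
proof -
  have one: "dominated 1 (\<lambda>_ _. 1) (\<lambda>_ _. 1)"
    using w_ge1 t.w'_ge1 by (simp add: dominated_def)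
  have one_close: "close (\<lambda>_ _. 1) (\<lambda>_ _. 1)" by (simp add: close_def)
  have dom: "dominated B (\<lambda>n y. cost M y (F n y)) (\<lambda>n y. cost (t.N n) y (f n y))"
    unfolding dominated_iff
    using cost_stationary_wfun[OF F] drift_mdp.cost_stationary_wfun[OF drift_mdp_N f]
    by (simp add: state_borel t.state_N)
  have cl: "close (\<lambda>n y. cost M y (F n y)) (\<lambda>n y. cost (t.N n) y (f n y))"
    unfolding close_def
  proof (intro allI impI)
    fix m and e :: real assume e: "e > 0"
    show "\<forall>\<^sub>F n in sequentially. \<forall>x\<in>K m. \<bar>cost M x (F n x) - cost (t.N n) x (f n x)\<bar> \<le> e"
      using eventually_ge_at_top[of m]
    proof eventually_elim
      case (elim n)
      then show ?case using K_mono[OF elim] e by (auto simp: t.cost_N_K agree subset_iff)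
    qed
  qed
  show ?thesis unfolding mean_cost_def
  proof (rule quotient_difference_tendsto_zero[OF integral_R_difference[OF dom cl] integral_R_difference[OF one one_close]])
    show "\<forall>\<^sub>F n in sequentially. 1 \<le> (\<integral>x. RF n (\<lambda>_. 1) x \<partial>\<eta>) \<and> 1 \<le> (\<integral>x. Rf n (\<lambda>_. 1) x \<partial>t.\<eta>' n) \<and>
        \<bar>\<integral>x. RF n (\<lambda>y. cost M y (F n y)) x \<partial>\<eta>\<bar> \<le> B / (1 - \<alpha>) * b"
      using eventually_good
    proof eventually_elim
      case (elim n)
      interpret cF: drift_chain borel "kF n" w \<eta> "\<phi>F n" \<alpha> by (rule chain_F)
      interpret cf: drift_chain "t.S' n" "kf n" "t.w' n" "t.\<eta>' n" "\<phi>f n" \<alpha>' by (rule chain_f[OF elim])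
      have u: "cF.wfun B (\<lambda>y. cost M y (F n y))" using dom elim by (simp add: dominated_iff)
      note Ru = cF.R_wfun[OF u]
      have "\<bar>\<integral>x. RF n (\<lambda>y. cost M y (F n y)) x \<partial>\<eta>\<bar> \<le> (\<integral>x. \<bar>RF n (\<lambda>y. cost M y (F n y)) x\<bar> \<partial>\<eta>)"
        by (rule integral_abs_bound)
      also have "\<dots> \<le> (\<integral>x. B / (1 - \<alpha>) * w x \<partial>\<eta>)"
        using cF.wfun_int_\<eta>[OF Ru] \<eta>_int cF.wfunD(2)[OF Ru] by (intro integral_mono) auto
      also have "\<dots> = B / (1 - \<alpha>) * b" by (simp add: b_def)
      finally show ?case using cF.mean_R_one_ge cf.mean_R_one_ge by simp
    qed
  qed
qed

end

subsection \<open>Convergence\<close>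

text \<open>From below, no policy beats the value \<open>\<rho>\<close>. From above, pass to the
  compact model, compare there with a fixed policy \<open>g\<close> that is nearly optimal in the
  original model, and come back; the two model changes, \<open>\<epsilon> n\<close> and the
  suboptimality of \<open>g\<close> cost a quarter of \<open>e\<close> each. Compact models are
  evaluated at \<open>\<Delta> n\<close>, which is a state even when \<open>K n\<close> is
  empty.\<close>

lemma (in approximation) ergodic_cost_tendsto_value:
  assumes f: "\<And>n. f n \<in> stationary_policies (t.N n)"
    and opt: "\<And>n. \<bar>average_cost (t.N n) (stationary (t.N n) (f n)) (\<Delta> n) - value_function (t.N n) (\<Delta> n)\<bar> \<le> ereal (\<epsilon> n)"
    and \<epsilon>: "\<epsilon> \<longlonglongrightarrow> 0"
  obtains \<rho> where "\<And>x. value_function M x = ereal \<rho>"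
    "(\<lambda>n. ergodic_cost M (\<lambda>x. f n (t.l n x))) \<longlonglongrightarrow> \<rho>"
proof -
  define F where "F n = (\<lambda>x. f n (t.l n x))" for n
  have F: "F n \<in> stationary_policies M" for n
    using measurable_compose[OF t.l_meas] f[of n]
    by (simp add: F_def stationary_policies_def t.state_N t.action_N state_borel action_borel)
  interpret pF: policy_sequence M w \<eta> \<phi> \<alpha> B K \<Delta> \<nu> \<gamma> \<tau> \<sigma> F f
    by unfold_locales (use F f in \<open>auto simp: F_def t.l_def\<close>)
  obtain \<rho> where \<rho>: "\<And>x. value_function M x = ereal \<rho>"
    and near: "\<And>e. e > 0 \<Longrightarrow> \<exists>g\<in>stationary_policies M. \<forall>x. average_cost M (stationary M g) x \<le> ereal (\<rho> + e)"
    using stationary_near_optimal by blast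
  define r where "r n = ergodic_cost M (F n)" for n
  define r' where "r' n = mean_cost (pF.kf n) (t.\<eta>' n) (pF.\<phi>f n) (\<lambda>y. cost (t.N n) y (f n y))" for n
  have rr': "(\<lambda>n. r n - r' n) \<longlonglongrightarrow> 0"
    using pF.mean_cost_difference unfolding r_def r'_def ergodic_cost_eq_mean_cost[OF F] .
  have \<Delta>_space: "\<Delta> n \<in> space (state_space (t.N n))" for n by (simp add: t.state_N t.space_S')
  have "r \<longlonglongrightarrow> \<rho>"
  proof (rule tendstoI)
    fix e :: real assume e: "e > 0"
    obtain g where g: "g \<in> stationary_policies M" "\<And>x. average_cost M (stationary M g) x \<le> ereal (\<rho> + e / 4)"
      using near[of "e / 4"] e by auto
    have g': "g \<in> stationary_policies (t.N n)" for n
      using measurable_compose[OF t.id_meas] g(1)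
      by (simp add: stationary_policies_def t.state_N t.action_N state_borel action_borel)
    \<comment> \<open>The same function \<open>g\<close> is a policy of every model, so the
      comparison applies to constant sequences.\<close>
    interpret pg: policy_sequence M w \<eta> \<phi> \<alpha> B K \<Delta> \<nu> \<gamma> \<tau> \<sigma> "\<lambda>_. g" "\<lambda>_. g"
      by unfold_locales (use g(1) g' in auto)
    \<comment> \<open>The index 0 is arbitrary: neither the original model nor \<open>g\<close>
      varies with it.\<close>
    define s where "s = mean_cost (pg.kF 0) \<eta> (pg.\<phi>F 0) (\<lambda>y. cost M y (g y))"
    define s' where "s' n = mean_cost (pg.kf n) (t.\<eta>' n) (pg.\<phi>f n) (\<lambda>y. cost (t.N n) y (g y))" for n
    have ss': "(\<lambda>n. s - s' n) \<longlonglongrightarrow> 0" using pg.mean_cost_difference unfolding s_def s'_def .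
    have s: "s \<le> \<rho> + e / 4"
      using g(2)[of undefined] average_cost_stationary[OF g(1), of undefined] by (simp add: s_def state_borel)
    have e4: "e / 4 > 0" using e by simp
    show "\<forall>\<^sub>F n in sequentially. dist (r n) \<rho> < e"
      using eventually_good tendstoD[OF rr' e4] tendstoD[OF ss' e4] tendstoD[OF \<epsilon> e4]
    proof eventually_elim
      case (elim n)
      interpret N: drift_mdp "t.N n" "t.w' n" "t.\<eta>' n" "t.\<phi>' n" \<alpha>' B by (rule drift_mdp_N[OF elim(1)])
      have V: "value_function (t.N n) (\<Delta> n) \<le> ereal (s' n)"
        unfolding s'_def N.average_cost_stationary[OF g' \<Delta>_space, symmetric] value_function_def
        by (rule INF_lower[OF stationary_in_policies[OF g']])
      have "\<bar>ereal (r' n) - value_function (t.N n) (\<Delta> n)\<bar> \<le> ereal (\<epsilon> n)"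
        using opt[of n] unfolding r'_def N.average_cost_stationary[OF f \<Delta>_space] .
      then have "r' n \<le> s' n + \<epsilon> n"
        \<comment> \<open>The real bound on the absolute difference excludes an infinite
          value.\<close>
        using V by (cases "value_function (t.N n) (\<Delta> n)") auto
      moreover have "ereal \<rho> \<le> ereal (r n)"
      proof -
        have "value_function M undefined \<le> average_cost M (stationary M (F n)) undefined"
          unfolding value_function_def by (rule INF_lower[OF stationary_in_policies[OF F]])
        also have "\<dots> = ereal (r n)"
          unfolding r_def ergodic_cost_eq_mean_cost[OF F] by (rule average_cost_stationary[OF F]) (simp add: state_borel)
        finally show ?thesis by (simp add: \<rho>)
      qed
      moreover have "\<bar>r n - r' n\<bar> < e / 4" "\<bar>s - s' n\<bar> < e / 4" "\<bar>\<epsilon> n\<bar> < e / 4"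
        using elim(2-4) by (simp_all add: dist_real_def)
      ultimately have "\<bar>r n - \<rho>\<bar> < e" using s unfolding ereal_less_eq by linarith
      then show ?case by (simp add: dist_real_def)
    qed
  qed
  then have "(\<lambda>n. ergodic_cost M (\<lambda>x. f n (t.l n x))) \<longlonglongrightarrow> \<rho>"
    unfolding r_def[abs_def] F_def .
  with \<rho> show ?thesis by (rule that)
qed

text \<open>For a fixed \<open>u\<close> below \<open>w\<close> the difference of integrals is one
  of the terms in the supremum that defines \<open>w_dist\<close>.\<close>

lemma continuous_integral_w_dist:
  fixes p :: "'x::{metric_space, second_countable_topology} \<Rightarrow> 'a::{metric_space, second_countable_topology} \<Rightarrow> 'x measure"
  assumes lim: "\<And>x a. ((\<lambda>(y, b). w_dist w (p y b) (p x a)) \<longlongrightarrow> 0) (at (x, a))"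
    and u: "u \<in> borel_measurable borel" "\<And>y. \<bar>u y\<bar> \<le> w y"
  shows "continuous_on UNIV (\<lambda>z. \<integral>y. u y \<partial>p (fst z) (snd z))"
proof -
  have "isCont (\<lambda>z. \<integral>y. u y \<partial>p (fst z) (snd z)) z" for z
    unfolding isCont_def
  proof (rule tendstoI)
    fix e :: real assume e: "e > 0"
    have "\<forall>\<^sub>F v in at z. (case v of (y, b) \<Rightarrow> w_dist w (p y b) (p (fst z) (snd z))) < ennreal e"
      using lim[of "fst z" "snd z"] e by (intro order_tendstoD(2)[of _ 0]) auto
    then show "\<forall>\<^sub>F v in at z. dist (\<integral>y. u y \<partial>p (fst v) (snd v)) (\<integral>y. u y \<partial>p (fst z) (snd z)) < e"
    proof eventually_elim
      case (elim v)
      have "ennreal \<bar>(\<integral>y. u y \<partial>p (fst v) (snd v)) - (\<integral>y. u y \<partial>p (fst z) (snd z))\<bar>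
          \<le> w_dist w (p (fst v) (snd v)) (p (fst z) (snd z))"
        unfolding w_dist_def by (rule SUP_upper) (use u in auto)
      also have "\<dots> < ennreal e" using elim by (simp add: case_prod_beta')
      finally show ?case by (simp add: dist_real_def ennreal_less_iff)
    qed
  qed
  then show ?thesis by (simp add: continuous_at_imp_continuous_on)
qed

theorem theorem3p5:
  fixes M :: "('x::{metric_space, second_countable_topology},
               'a::{metric_space, second_countable_topology}) mdp"
    and p :: "'x \<Rightarrow> 'a \<Rightarrow> 'x measure" and c :: "'x \<Rightarrow> 'a \<Rightarrow> real"
    and w :: "'x \<Rightarrow> real" and B :: real
    and \<eta> :: "'x measure" and \<phi> :: "'x \<Rightarrow> 'a \<Rightarrow> real" and \<alpha> :: real
    and K :: "nat \<Rightarrow> 'x set" and \<nu> :: "nat \<Rightarrow> 'x measure" and \<Delta> :: "nat \<Rightarrow> 'x"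
    and \<gamma> \<tau> \<sigma> \<epsilon> \<delta> :: "nat \<Rightarrow> real"
    and N :: "nat \<Rightarrow> ('x, 'a) mdp" and f F :: "nat \<Rightarrow> 'x \<Rightarrow> 'a"
  assumes M: "M = \<lparr>state_space = borel, action_space = borel, kernel = p, cost = c\<rparr>"
    and mdp: "is_mdp M"
    and A1: "continuous_on UNIV (\<lambda>(x, a). c x a)"
    and A2: "locally compact (UNIV :: 'x set)" "\<not> compact (UNIV :: 'x set)"
      "compact (UNIV :: 'a set)"
    and A3: "B \<ge> 0" "continuous_on UNIV w" "\<And>x. w x \<ge> 1"
      "\<And>x a. \<bar>c x a\<bar> \<le> B * w x"
      "\<And>x a. integrable (p x a) w"
      "continuous_on UNIV (\<lambda>(x, a). \<integral>y. w y \<partial>p x a)"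
    and \<eta>: "prob_space \<eta>" "sets \<eta> = sets borel" "integrable \<eta> w"
    and \<phi>: "(\<lambda>(x, a). \<phi> x a) \<in> borel_measurable (borel \<Otimes>\<^sub>M borel)" "\<And>x a. \<phi> x a > 0"
    and \<alpha>: "0 < \<alpha>" "\<alpha> < 1"
    and A4: "\<And>x a. (\<integral>y. w y \<partial>p x a) \<le> \<alpha> * w x + (\<integral>y. w y \<partial>\<eta>) * \<phi> x a"
    and A5: "\<And>x a D. D \<in> sets borel \<Longrightarrow> measure (p x a) D \<ge> measure \<eta> D * \<phi> x a"
    and A6: "\<And>n. (INF (x, a)\<in>K n \<times> UNIV. ennreal (\<phi> x a)) > 0"
    and A7: "\<And>x a. ((\<lambda>(y, b). w_dist w (p y b) (p x a)) \<longlongrightarrow> 0) (at (x, a))"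
    and K: "\<And>n. compact (K n)" "\<And>n. K n \<subseteq> interior (K (Suc n))" "(\<Union>n. K n) = UNIV"
    and \<nu>: "\<And>n. prob_space (\<nu> n)" "\<And>n. sets (\<nu> n) = sets borel"
      "\<And>n. measure (\<nu> n) (- K n) = 1" "\<And>n. set_integrable (\<nu> n) (- K n) w"
    and \<gamma>: "\<And>n. \<gamma> n = (LINT y:- K n|\<nu> n. w y)"
    and \<tau>: "\<And>n. \<tau> n = max 0 (SUP (x, a)\<in>UNIV. LINT y:- K n|p x a. \<gamma> n - w y)"
    and \<sigma>: "\<And>n. \<sigma> n = (LINT y:- K n|\<eta>. w y)"
    and \<tau>_bdd: "bdd_above (range \<tau>)"
    and lim_\<tau>_\<sigma>: "(\<lambda>n. \<tau> n + \<sigma> n) \<longlonglongrightarrow> 0"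
    and \<Delta>: "\<And>n. \<Delta> n \<notin> K n"
    and N: "\<And>n. N n = compact_mdp M (K n) (\<Delta> n) (\<nu> n)"
    and \<epsilon>: "\<And>n. \<epsilon> n > 0" "\<epsilon> \<longlonglongrightarrow> 0"
    and \<delta>: "\<And>n. \<delta> n > 0"
    and f: "\<And>n. f n \<in> stationary_policies (N n)"
      "\<And>n. finite_state_policy (N n) (\<delta> n) (f n)"
    and near_optimal:
      "\<And>n. (SUP x\<in>space (state_space (N n)).
              \<bar>average_cost (N n) (stationary (N n) (f n)) x - value_function (N n) x\<bar>) \<le> ereal (\<epsilon> n)"
    and F: "\<And>n x. F n x = (if x \<in> K n then f n x else f n (\<Delta> n))"
  shows "\<forall>x. (\<lambda>n. \<bar>ereal (ergodic_cost M (F n)) - value_function M x\<bar>) \<longlonglongrightarrow> 0"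
proof -
  have Ms [simp]: "state_space M = borel" "action_space M = borel" "kernel M = p" "cost M = c"
    by (simp_all add: M)
  interpret e: prob_space \<eta> by (rule \<eta>)
  have \<eta>1: "1 \<le> (\<integral>y. w y \<partial>\<eta>)"
  proof -
    have "(\<integral>y. 1 \<partial>\<eta>) \<le> (\<integral>y. w y \<partial>\<eta>)" using \<eta>(3) A3(3) by (intro integral_mono) auto
    then show ?thesis using e.prob_space by simp
  qed
  \<comment> \<open>The least nonnegative function with which the drift inequality holds for this
    \<open>\<alpha>\<close>; by \<open>A4\<close> the function \<open>\<phi>\<close> is another one,
    whence \<open>\<psi> \<le> \<phi>\<close>.\<close>
  define \<psi> where "\<psi> x a = max 0 (((\<integral>y. w y \<partial>p x a) - \<alpha> * w x) / (\<integral>y. w y \<partial>\<eta>))" for x a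
  have \<psi>_cont: "continuous_on UNIV (\<lambda>z. \<psi> (fst z) (snd z))"
  proof -
    have "continuous_on UNIV (\<lambda>z. \<integral>y. w y \<partial>p (fst z) (snd z))"
      using A3(6) by (simp add: case_prod_beta')
    moreover have "continuous_on UNIV (\<lambda>z :: 'x \<times> 'a. w (fst z))"
      by (rule continuous_on_compose2[OF A3(2)]) (auto intro!: continuous_intros)
    ultimately show ?thesis unfolding \<psi>_def using \<eta>1 by (intro continuous_intros) auto
  qed
  have \<psi>_le: "\<psi> x a \<le> \<phi> x a" for x a
  proof -
    have "((\<integral>y. w y \<partial>p x a) - \<alpha> * w x) / (\<integral>y. w y \<partial>\<eta>) \<le> \<phi> x a"
      using A4[of x a] \<eta>1 by (simp add: divide_le_eq algebra_simps)
    then show ?thesis using \<phi>(2)[of x a] by (simp add: \<psi>_def)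
  qed
  have kernel_meas: "(\<lambda>z. p (fst z) (snd z)) \<in> borel \<Otimes>\<^sub>M borel \<rightarrow>\<^sub>M prob_algebra borel"
    using mdp by (simp add: is_mdp_def case_prod_beta')
  have pxa: "prob_space (p x a)" "sets (p x a) = sets borel" for x a
    using measurable_space[OF kernel_meas, of "(x, a)"] by (auto simp: space_pair_measure space_prob_algebra)
  have cd: "continuous_drift_mdp M w \<eta> \<psi> \<alpha> B"
  proof
    show "is_mdp M" by (rule mdp)
    show "w \<in> borel_measurable (state_space M)" using A3(2) by (simp add: borel_measurable_continuous_onI)
    show "(\<lambda>(x, a). \<psi> x a) \<in> borel_measurable (stage_space M)"
      using borel_measurable_continuous_onI[OF \<psi>_cont] by (simp add: borel_prod case_prod_beta')
    show "measure \<eta> D * \<psi> x a \<le> measure (kernel M x a) D" if "D \<in> sets (state_space M)" for x a D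
      using mult_left_mono[OF \<psi>_le[of x a], of "measure \<eta> D"] A5[of D x a] that by simp
    show "(\<integral>y. w y \<partial>kernel M x a) \<le> \<alpha> * w x + (\<integral>y. w y \<partial>\<eta>) * \<psi> x a" for x a
    proof -
      have "((\<integral>y. w y \<partial>p x a) - \<alpha> * w x) = (\<integral>y. w y \<partial>\<eta>) * (((\<integral>y. w y \<partial>p x a) - \<alpha> * w x) / (\<integral>y. w y \<partial>\<eta>))"
        using \<eta>1 by simp
      also have "\<dots> \<le> (\<integral>y. w y \<partial>\<eta>) * \<psi> x a" using \<eta>1 by (intro mult_left_mono) (auto simp: \<psi>_def)
      finally show ?thesis by simp
    qed
    show "continuous_on UNIV (\<lambda>z. cost M (fst z) (snd z))" using A1 by (simp add: case_prod_beta')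
    show "continuous_on UNIV (\<lambda>z. \<integral>y. u y \<partial>kernel M (fst z) (snd z))"
      if "u \<in> borel_measurable borel" "\<And>y. \<bar>u y\<bar> \<le> w y" for u
      using continuous_integral_w_dist[OF A7 that] by simp
  qed (use \<psi>_cont A2 A3 \<eta> \<alpha> in \<open>auto simp: \<psi>_def space_prob_algebra\<close>)
  have K_borel [measurable]: "K n \<in> sets borel" for n using K(1) by (simp add: compact_imp_closed borel_closed)
  have \<gamma>0: "0 \<le> \<gamma> n" for n
    unfolding \<gamma> set_lebesgue_integral_def
    by (rule integral_nonneg_AE) (use A3(3) in \<open>auto intro!: AE_I2 intro: order_trans[OF zero_le_one] split: split_indicator\<close>)
  have \<tau>_ge: "(LINT y:- K n|p x a. \<gamma> n - w y) \<le> \<tau> n" for n x a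
  proof -
    \<comment> \<open>A real supremum bounds its terms only if they are bounded above; here the
      integrals are at most \<open>\<gamma> n\<close>, because \<open>w\<close> is positive.\<close>
    have "bdd_above (range (\<lambda>(x, a). LINT y:- K n|p x a. \<gamma> n - w y))"
    proof (rule bdd_aboveI2)
      fix z :: "'x \<times> 'a"
      obtain x a where z: "z = (x, a)" by fastforce
      interpret k: prob_space "p x a" by (rule pxa)
      have i: "integrable (p x a) (\<lambda>y. indicator (- K n) y *\<^sub>R (\<gamma> n - w y))"
        using A3(5)[of x a] pxa(2)[of x a] by (intro integrable_mult_indicator) auto
      have "(\<integral>y. indicator (- K n) y *\<^sub>R (\<gamma> n - w y) \<partial>p x a) \<le> (\<integral>y. \<gamma> n \<partial>p x a)"
        using \<gamma>0[of n] A3(3) by (intro integral_mono[OF i]) (auto intro: order_trans[OF zero_le_one] split: split_indicator)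
      then show "(case z of (x, a) \<Rightarrow> LINT y:- K n|p x a. \<gamma> n - w y) \<le> \<gamma> n"
        using k.prob_space by (simp add: z set_lebesgue_integral_def)
    qed
    from cSUP_upper[OF UNIV_I this, of "(x, a)"] show ?thesis by (simp add: \<tau>)
  qed
  have tr: "truncation M w \<eta> \<psi> \<alpha> B (K n) (\<Delta> n) (\<nu> n) (\<gamma> n) (\<tau> n) (\<sigma> n)" for n
  proof (rule truncation.intro[OF cd], rule truncation_axioms.intro)
    show "(LINT y:- K n|kernel M x a. \<gamma> n - w y) \<le> \<tau> n" for x a using \<tau>_ge by simp
    show "0 \<le> \<tau> n" by (simp only: \<tau> max.cobounded1)
  qed (rule K \<Delta> \<nu> \<gamma> \<sigma>)+
  have ap: "approximation M w \<eta> \<psi> \<alpha> B K \<Delta> \<nu> \<gamma> \<tau> \<sigma>"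
  proof (rule approximation.intro[OF cd], rule approximation_axioms.intro)
    show "K n \<subseteq> K (Suc n)" for n using K(2)[of n] interior_subset by blast
    show "\<exists>x a r. r > 0 \<and> (\<forall>D\<in>sets borel. measure \<eta> D * r \<le> measure (kernel M x a) D)"
      \<comment> \<open>The original \<open>\<phi>\<close> supplies the positive constant, at any
        state and action, whereas \<open>\<psi>\<close> may vanish.\<close>
      using A5 \<phi>(2) by (intro exI[of _ undefined] exI[of _ "\<phi> undefined undefined"]) simp
  qed (rule tr K(3) lim_\<tau>_\<sigma>)+
  interpret approximation M w \<eta> \<psi> \<alpha> B K \<Delta> \<nu> \<gamma> \<tau> \<sigma> by (rule ap)
  have N': "N n = t.N n" for n by (simp add: N t.N_def)
  have F': "F n = (\<lambda>x. f n (t.l n x))" for n by (auto simp: F t.l_def)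
  have f': "f n \<in> stationary_policies (t.N n)" for n using f(1) by (simp add: N')
  have opt: "\<bar>average_cost (t.N n) (stationary (t.N n) (f n)) (\<Delta> n) - value_function (t.N n) (\<Delta> n)\<bar> \<le> ereal (\<epsilon> n)" for n
    by (rule order_trans[OF SUP_upper near_optimal[of n, unfolded N']]) (simp add: t.state_N t.space_S')
  obtain \<rho> where \<rho>: "\<And>x. value_function M x = ereal \<rho>" "(\<lambda>n. ergodic_cost M (F n)) \<longlonglongrightarrow> \<rho>"
    using ergodic_cost_tendsto_value[OF f' opt \<epsilon>(2)] unfolding F' by blast
  have "(\<lambda>n. \<bar>ergodic_cost M (F n) - \<rho>\<bar>) \<longlonglongrightarrow> 0"
    using tendsto_rabs[OF tendsto_diff[OF \<rho>(2) tendsto_const[of \<rho>]]] by simp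
  then have "(\<lambda>n. ereal \<bar>ergodic_cost M (F n) - \<rho>\<bar>) \<longlonglongrightarrow> ereal 0" by (intro tendsto_ereal)
  then show ?thesis by (simp add: \<rho>(1) zero_ereal_def)
qed

end
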